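(* Let $\mathfrak{n}$ be a (finite-dimensional) complex nilpotent Lie algebra, let $l=\dim \mathfrak{n}/[\mathfrak{n},\mathfrak{n}]$, and let $n\ge 1$. Then there is an identification $$\operatorname{Hom}_{\text{Lie alg}}(\mathfrak{n}, \mathfrak{gl}_n(\mathbb{C}))/\!\!/\operatorname{GL}_n(\mathbb{C}) = S^n\mathbb{C}^l .$$
   Context: $\operatorname{Hom}_{\text{Lie alg}}(\mathfrak{n},\mathfrak{gl}_n(\mathbb{C}))$ is the affine variety of Lie algebra homomorphisms $\mathfrak{n}\to\mathfrak{gl}_n(\mathbb{C})$, with $\operatorname{GL}_n(\mathbb{C})$ acting by conjugation, and $\operatorname{Hom}_{\text{Lie alg}}(\mathfrak{n},\mathfrak{gl}_n(\mathbb{C}))/\!\!/\operatorname{GL}_n(\mathbb{C}) := \operatorname{Spec}\big(\mathbb{C}[\operatorname{Hom}_{\text{Lie alg}}(\mathfrak{n},\mathfrak{gl}_n(\mathbb{C}))]^{\operatorname{GL}_n(\mathbb{C})}\big)$ is the categorical quotient. $S^n\mathbb{C}^l=(\mathbb{C}^l)^n/S_n$ is the $n$-th symmetric product of $\mathbb{C}^l$. The equality is an identification of affine varieties. *)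

theory Defs
  imports
    "Jordan_Normal_Form.Matrix"
    "HOL-Algebra.QuotRing"
    "HOL-Combinatorics.Permutations"
    "HOL-Library.FuncSet"
begin

section \<open>Complex Lie algebras\<close>

locale lie_algebra = vector_space scale
  for scale :: "complex \<Rightarrow> 'a::ab_group_add \<Rightarrow> 'a" (infixr \<open>*s\<close> 75) +
  fixes bracket :: "'a \<Rightarrow> 'a \<Rightarrow> 'a"
  assumes bracket_linear_left: "Vector_Spaces.linear scale scale (\<lambda>x. bracket x y)"
    and bracket_linear_right: "Vector_Spaces.linear scale scale (bracket x)"
    and bracket_self: "bracket x x = 0"
    and jacobi: "bracket x (bracket y z) + bracket y (bracket z x) + bracket z (bracket x y) = 0"
begin

definition finite_dimensional :: bool where
  "finite_dimensional \<longleftrightarrow> (\<exists>B. finite B \<and> span B = UNIV)"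

primrec lower_central :: "nat \<Rightarrow> 'a set" where
  "lower_central 0 = UNIV"
| "lower_central (Suc k) = span {bracket x y | x y. y \<in> lower_central k}"

definition nilpotent :: bool where
  "nilpotent \<longleftrightarrow> (\<exists>k. lower_central k = {0})"

definition derived :: "'a set" where
  "derived = span {bracket x y | x y. True}"

definition abelianization :: "'a set set" where
  "abelianization = UNIV // {(x, y). x - y \<in> derived}"

text \<open>The dimension of the quotient space is the length \<open>d\<close> of a basis, the basis vectors being
  the classes of \<open>b 0, \<dots>, b (d - 1)\<close>: every class \<open>X\<close> is, for unique coefficients \<open>c\<close>, the class
  of \<open>\<Sum>i<d. c i *s b i\<close>. The type-based \<open>dim\<close> does not apply, as the quotient is not a type.\<close>

definition abelianization_dim :: nat where
  "abelianization_dim = (THE d. \<exists>b :: nat \<Rightarrow> 'a. \<forall>X \<in> abelianization.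
     \<exists>!c. c \<in> {..<d} \<rightarrow>\<^sub>E UNIV \<and> (\<Sum>i<d. c i *s b i) \<in> X)"

end

section \<open>Affine varieties as spaces with functions\<close>

text \<open>A complex affine variety is given by its points and its algebra of regular functions;
  functions are extensional, that is, equal to \<open>undefined\<close> off the points. Morphisms are the maps
  that pull regular functions back to regular functions.\<close>

record 'x variety =
  points :: "'x set"
  coord_ring :: "('x \<Rightarrow> complex) set"

definition variety_morphism :: "'x variety \<Rightarrow> 'y variety \<Rightarrow> ('x \<Rightarrow> 'y) \<Rightarrow> bool" where
  "variety_morphism X Y \<phi> \<longleftrightarrow> \<phi> \<in> points X \<rightarrow> points Y \<and>
     (\<forall>f \<in> coord_ring Y. compose (points X) f \<phi> \<in> coord_ring X)"

definition variety_isomorphic :: "'x variety \<Rightarrow> 'y variety \<Rightarrow> bool" (infix \<open>\<cong>\<^sub>v\<close> 50) where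
  "X \<cong>\<^sub>v Y \<longleftrightarrow> (\<exists>\<phi> \<psi>. variety_morphism X Y \<phi> \<and> variety_morphism Y X \<psi> \<and>
     (\<forall>x \<in> points X. \<psi> (\<phi> x) = x) \<and> (\<forall>y \<in> points Y. \<phi> (\<psi> y) = y))"

text \<open>Restrictions to \<open>X\<close> of the polynomials in a given family of coordinate functions.\<close>

inductive_set polynomial_functions :: "'x set \<Rightarrow> ('x \<Rightarrow> complex) set \<Rightarrow> ('x \<Rightarrow> complex) set"
  for X :: "'x set" and coords :: "('x \<Rightarrow> complex) set" where
  const: "(\<lambda>x\<in>X. c) \<in> polynomial_functions X coords"
| coord: "f \<in> coords \<Longrightarrow> restrict f X \<in> polynomial_functions X coords"
| add: "f \<in> polynomial_functions X coords \<Longrightarrow> g \<in> polynomial_functions X coords \<Longrightarrow>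
    (\<lambda>x\<in>X. f x + g x) \<in> polynomial_functions X coords"
| mult: "f \<in> polynomial_functions X coords \<Longrightarrow> g \<in> polynomial_functions X coords \<Longrightarrow>
    (\<lambda>x\<in>X. f x * g x) \<in> polynomial_functions X coords"

definition function_ring :: "'x set \<Rightarrow> ('x \<Rightarrow> complex) set \<Rightarrow> ('x \<Rightarrow> complex) ring" where
  "function_ring X A = \<lparr>carrier = A, mult = (\<lambda>f g. \<lambda>x\<in>X. f x * g x), one = (\<lambda>x\<in>X. 1),
     zero = (\<lambda>x\<in>X. 0), add = (\<lambda>f g. \<lambda>x\<in>X. f x + g x)\<rparr>"

text \<open>The spectrum, as a variety, of a complex algebra \<open>R\<close> with structure map \<open>\<iota>\<close>: the points
  are the maximal ideals, and \<open>a \<in> carrier R\<close> takes at \<open>m\<close> the value given by its class in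
  the residue field \<open>R Quot m\<close>, identified with the complex numbers through \<open>\<iota>\<close>.\<close>

definition Spec :: "('r, 's) ring_scheme \<Rightarrow> (complex \<Rightarrow> 'r) \<Rightarrow> 'r set variety" where
  "Spec R \<iota> = \<lparr>points = {m. maximalideal m R},
     coord_ring = (\<lambda>a. \<lambda>m \<in> {m. maximalideal m R}. THE c. m +>\<^bsub>R\<^esub> a = m +>\<^bsub>R\<^esub> \<iota> c) ` carrier R\<rparr>"

definition invariants :: "'x variety \<Rightarrow> 'g set \<Rightarrow> ('g \<Rightarrow> 'x \<Rightarrow> 'x) \<Rightarrow> ('x \<Rightarrow> complex) set" where
  "invariants X G act = {f \<in> coord_ring X. \<forall>g \<in> G. \<forall>x \<in> points X. f (act g x) = f x}"

definition categorical_quotient ::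
    "'x variety \<Rightarrow> 'g set \<Rightarrow> ('g \<Rightarrow> 'x \<Rightarrow> 'x) \<Rightarrow> ('x \<Rightarrow> complex) set variety" where
  "categorical_quotient X G act =
     Spec (function_ring (points X) (invariants X G act)) (\<lambda>c. \<lambda>x\<in>points X. c)"

text \<open>For a finite group \<open>G\<close>, the quotient \<open>X / G\<close> is the orbit space; a function on it is regular
  iff its pullback to \<open>X\<close> is.\<close>

definition orbit_of :: "'g set \<Rightarrow> ('g \<Rightarrow> 'x \<Rightarrow> 'x) \<Rightarrow> 'x \<Rightarrow> 'x set" where
  "orbit_of G act x = (\<lambda>g. act g x) ` G"

definition orbit_variety ::
    "'x variety \<Rightarrow> 'g set \<Rightarrow> ('g \<Rightarrow> 'x \<Rightarrow> 'x) \<Rightarrow> 'x set variety" where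
  "orbit_variety X G act = \<lparr>points = orbit_of G act ` points X,
     coord_ring = {f \<in> extensional (orbit_of G act ` points X).
       compose (points X) f (orbit_of G act) \<in> coord_ring X}\<rparr>"

section \<open>The two varieties\<close>

abbreviation gl_ring :: "nat \<Rightarrow> complex mat ring" where
  "gl_ring n \<equiv> ring_mat TYPE(complex) n ()"

definition GL :: "nat \<Rightarrow> complex mat set" where
  "GL n = Units (gl_ring n)"

definition conjugation :: "nat \<Rightarrow> complex mat \<Rightarrow> ('a \<Rightarrow> complex mat) \<Rightarrow> 'a \<Rightarrow> complex mat" where
  "conjugation n g \<rho> = (\<lambda>x. g * \<rho> x * inv\<^bsub>gl_ring n\<^esub> g)"

definition lie_homs ::
    "(complex \<Rightarrow> 'a::ab_group_add \<Rightarrow> 'a) \<Rightarrow> ('a \<Rightarrow> 'a \<Rightarrow> 'a) \<Rightarrow> nat \<Rightarrow> ('a \<Rightarrow> complex mat) set" where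
  "lie_homs scale bracket n = {\<rho>. (\<forall>x. \<rho> x \<in> carrier_mat n n) \<and>
     (\<forall>x y. \<rho> (x + y) = \<rho> x + \<rho> y) \<and>
     (\<forall>c x. \<rho> (scale c x) = c \<cdot>\<^sub>m \<rho> x) \<and>
     (\<forall>x y. \<rho> (bracket x y) = \<rho> x * \<rho> y - \<rho> y * \<rho> x)}"

text \<open>The coordinates are the matrix entries of \<open>\<rho> x\<close> for all \<open>x\<close>; those with \<open>x\<close> in a basis
  generate the same functions.\<close>

definition Hom_variety ::
    "(complex \<Rightarrow> 'a::ab_group_add \<Rightarrow> 'a) \<Rightarrow> ('a \<Rightarrow> 'a \<Rightarrow> 'a) \<Rightarrow> nat \<Rightarrow> ('a \<Rightarrow> complex mat) variety" where
  "Hom_variety scale bracket n = \<lparr>points = lie_homs scale bracket n,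
     coord_ring = polynomial_functions (lie_homs scale bracket n)
       {\<lambda>\<rho>. \<rho> x $$ (i, j) | x i j. i < n \<and> j < n}\<rparr>"

definition vec_power_variety :: "nat \<Rightarrow> nat \<Rightarrow> (nat \<Rightarrow> complex vec) variety" where
  "vec_power_variety l n = \<lparr>points = {..<n} \<rightarrow>\<^sub>E carrier_vec l,
     coord_ring = polynomial_functions ({..<n} \<rightarrow>\<^sub>E carrier_vec l)
       {\<lambda>v. v i $ j | i j. i < n \<and> j < l}\<rparr>"

definition symmetric_product :: "nat \<Rightarrow> nat \<Rightarrow> (nat \<Rightarrow> complex vec) set variety" where
  "symmetric_product n l =
     orbit_variety (vec_power_variety l n) {p. p permutes {..<n}} (\<lambda>p v. v \<circ> p)"

end

theory Submission
  imports
    Defs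
    "HOL-Computational_Algebra.Fundamental_Theorem_Algebra"
    "HOL-Analysis.Continuum_Not_Denumerable"
    "Jordan_Normal_Form.DL_Rank"
    "Jordan_Normal_Form.Schur_Decomposition"
begin

text \<open>A representation of a nilpotent Lie algebra can be triangularized, and a triangular
  representation degenerates under conjugation to its diagonal part. The latter is a sum of \<open>n\<close>
  characters, that is, a tuple in \<open>(C^l)^n\<close>; so an invariant function is determined by its
  restriction to diagonal representations, which is a symmetric polynomial. Conversely, traces of
  products of the \<open>\<rho> x\<close> restrict to the polarized power sums, and these generate the multisymmetric
  polynomials. Hence the invariant ring is the ring of multisymmetric polynomials. By the
  Nullstellensatz and averaging over the symmetric group its maximal ideals are the points of
  \<open>(C^l)^n\<close>, and symmetric polynomials separate the orbits.\<close>

section \<open>Polynomial functions\<close>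

text \<open>The invariant ring is not known beforehand to be finitely generated, and the matrix
  entries are indexed by all elements of the Lie algebra. So the Nullstellensatz is not applied
  there: a maximal ideal is carried over to the polynomial ring in the \<open>n * l\<close>
  coordinates of tuples of vectors, where a common zero is found. Averaging over the finite
  symmetric group, possible since \<open>n!\<close> is invertible, takes the place of a Reynolds
  operator for the general linear group. The Nullstellensatz itself rests on the complex numbers
  being uncountable while a finitely generated algebra has countable dimension. Characters have
  \<open>l\<close> coordinates because they kill brackets, hence are functionals on the
  abelianization. Passing to a limit is unavoidable: a triangular representation is in general not
  conjugate to its diagonal part, which lies only in the closure of its orbit, but polynomial
  invariants cannot tell the two apart.\<close>

abbreviation poly_funs :: "('x \<Rightarrow> complex) set \<Rightarrow> ('x \<Rightarrow> complex) set" where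
  "poly_funs \<equiv> polynomial_functions UNIV"

lemma restrict_UNIV_eq: "restrict f UNIV = f"
  by (simp add: restrict_def)

lemma poly_funs_const: "(\<lambda>x. a) \<in> poly_funs C"
  using polynomial_functions.const[of a UNIV C] by (simp add: restrict_UNIV_eq)

lemma poly_funs_coord: "f \<in> C \<Longrightarrow> f \<in> poly_funs C"
  using polynomial_functions.coord[of f C UNIV] by (simp add: restrict_UNIV_eq)

lemma poly_funs_add:
  "f \<in> poly_funs C \<Longrightarrow> g \<in> poly_funs C \<Longrightarrow> (\<lambda>x. f x + g x) \<in> poly_funs C"
  using polynomial_functions.add[of f UNIV C g] by (simp add: restrict_UNIV_eq)

lemma poly_funs_mult:
  "f \<in> poly_funs C \<Longrightarrow> g \<in> poly_funs C \<Longrightarrow> (\<lambda>x. f x * g x) \<in> poly_funs C"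
  using polynomial_functions.mult[of f UNIV C g] by (simp add: restrict_UNIV_eq)

lemma poly_funs_diff:
  assumes "f \<in> poly_funs C" "g \<in> poly_funs C"
  shows "(\<lambda>x. f x - g x) \<in> poly_funs C"
proof -
  have "(\<lambda>x. f x + (-1) * g x) \<in> poly_funs C"
    by (intro poly_funs_add poly_funs_mult poly_funs_const assms)
  then show ?thesis by simp
qed

lemma poly_funs_sum:
  "(\<And>i. i \<in> I \<Longrightarrow> f i \<in> poly_funs C) \<Longrightarrow> (\<lambda>x. \<Sum>i\<in>I. f i x) \<in> poly_funs C"
  by (induction I rule: infinite_finite_induct) (auto intro: poly_funs_const poly_funs_add)

lemma poly_funs_prod:
  "(\<And>i. i \<in> I \<Longrightarrow> f i \<in> poly_funs C) \<Longrightarrow> (\<lambda>x. \<Prod>i\<in>I. f i x) \<in> poly_funs C"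
  by (induction I rule: infinite_finite_induct) (auto intro: poly_funs_const poly_funs_mult)

lemma poly_funs_induct [consumes 1, case_names const coord add mult]:
  assumes "f \<in> poly_funs C"
    and "\<And>a. P (\<lambda>x. a)"
    and "\<And>f. f \<in> C \<Longrightarrow> P f"
    and "\<And>f g. f \<in> poly_funs C \<Longrightarrow> P f \<Longrightarrow> g \<in> poly_funs C \<Longrightarrow> P g \<Longrightarrow> P (\<lambda>x. f x + g x)"
    and "\<And>f g. f \<in> poly_funs C \<Longrightarrow> P f \<Longrightarrow> g \<in> poly_funs C \<Longrightarrow> P g \<Longrightarrow> P (\<lambda>x. f x * g x)"
  shows "P f"
  using assms(1)
proof (induction rule: polynomial_functions.induct)
  case (const c)
  then show ?case using assms(2) by (simp add: restrict_UNIV_eq)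
next
  case (coord f)
  then show ?case using assms(3) by (simp add: restrict_UNIV_eq)
next
  case (add f g)
  then show ?case using assms(4) by (simp add: restrict_UNIV_eq)
next
  case (mult f g)
  then show ?case using assms(5) by (simp add: restrict_UNIV_eq)
qed

lemma poly_funs_compose:
  assumes "f \<in> poly_funs C" and "\<And>c. c \<in> C \<Longrightarrow> (\<lambda>y. c (\<phi> y)) \<in> poly_funs D"
  shows "(\<lambda>y. f (\<phi> y)) \<in> poly_funs D"
  using assms(1)
  by (induction rule: poly_funs_induct)
    (auto intro: assms(2) poly_funs_const poly_funs_add poly_funs_mult)

text \<open>Working with total functions keeps the ring operations pointwise, without
  \<open>restrict\<close>. Nothing is lost: a polynomial expression in the coordinates makes sense
  off \<open>X\<close> as well, and restricting commutes with building it up.\<close>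

lemma polynomial_functions_eq: "polynomial_functions X C = (\<lambda>f. restrict f X) ` poly_funs C"
proof (intro equalityI subsetI)
  fix f assume "f \<in> polynomial_functions X C"
  then show "f \<in> (\<lambda>f. restrict f X) ` poly_funs C"
  proof (induction rule: polynomial_functions.induct)
    case (const c)
    then show ?case using poly_funs_const by blast
  next
    case (coord f)
    then show ?case using poly_funs_coord by blast
  next
    case (add f g)
    then obtain p q where "f = restrict p X" "g = restrict q X" "p \<in> poly_funs C" "q \<in> poly_funs C"
      by blast
    moreover have "(\<lambda>x\<in>X. restrict p X x + restrict q X x) = (\<lambda>x\<in>X. p x + q x)"
      by (rule restrict_ext) simp
    ultimately show ?case using poly_funs_add[of p C q] by auto
  next
    case (mult f g)
    then obtain p q where "f = restrict p X" "g = restrict q X" "p \<in> poly_funs C" "q \<in> poly_funs C"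
      by blast
    moreover have "(\<lambda>x\<in>X. restrict p X x * restrict q X x) = (\<lambda>x\<in>X. p x * q x)"
      by (rule restrict_ext) simp
    ultimately show ?case using poly_funs_mult[of p C q] by auto
  qed
next
  fix f assume "f \<in> (\<lambda>f. restrict f X) ` poly_funs C"
  then obtain p where p: "p \<in> poly_funs C" and f: "f = restrict p X" by blast
  from p have "restrict p X \<in> polynomial_functions X C"
  proof (induction rule: poly_funs_induct)
    case (const a)
    then show ?case by (rule polynomial_functions.const)
  next
    case (coord f)
    then show ?case by (rule polynomial_functions.coord)
  next
    case (add f g)
    from polynomial_functions.add[OF add.IH] show ?case by (simp add: restrict_def if_distrib cong: if_cong)
  next
    case (mult f g)
    from polynomial_functions.mult[OF mult.IH] show ?case by (simp add: restrict_def if_distrib cong: if_cong)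
  qed
  then show "f \<in> polynomial_functions X C" using f by simp
qed

lemma polynomial_functionsE:
  assumes "f \<in> polynomial_functions X C"
  obtains p where "p \<in> poly_funs C" "f = restrict p X"
  using assms by (subst (asm) polynomial_functions_eq) (rule imageE)

lemma polynomial_functionsI: "p \<in> poly_funs C \<Longrightarrow> restrict p X \<in> polynomial_functions X C"
  by (subst polynomial_functions_eq) (rule imageI)

section \<open>Linear dependence and algebras of countable dimension\<close>

lemma ex_linear_relation:
  fixes M :: "nat \<Rightarrow> nat \<Rightarrow> complex"
  shows "\<exists>c. (\<exists>r\<le>N. c r \<noteq> 0) \<and> (\<forall>k<N. (\<Sum>r\<le>N. c r * M r k) = 0)"
proof -
  \<comment> \<open>The \<open>N + 1\<close> columns have \<open>N\<close> entries each; a zero row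
    makes the matrix square and singular, and a kernel vector is the relation.\<close>
  define A where "A = mat (Suc N) (Suc N) (\<lambda>(k, r). if k < N then M r k else 0)"
  have A: "A \<in> carrier_mat (Suc N) (Suc N)" by (simp add: A_def)
  have "det A = (\<Sum>j<Suc N. A $$ (N, j) * cofactor A N j)"
    by (rule laplace_expansion_row[OF A]) simp
  also have "\<dots> = 0" by (intro sum.neutral ballI) (simp add: A_def)
  finally obtain v where v: "v \<in> carrier_vec (Suc N)" "v \<noteq> 0\<^sub>v (Suc N)" "A *\<^sub>v v = 0\<^sub>v (Suc N)"
    using det_0_iff_vec_prod_zero[OF A] by auto
  have "\<exists>r\<le>N. v $ r \<noteq> 0"
  proof (rule ccontr)
    assume "\<not> ?thesis"
    then have "v = 0\<^sub>v (Suc N)" using v(1) by (intro eq_vecI) auto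
    then show False using v(2) by simp
  qed
  moreover have "(\<Sum>r\<le>N. v $ r * M r k) = 0" if "k < N" for k
  proof -
    have "(A *\<^sub>v v) $ k = (\<Sum>r\<le>N. v $ r * M r k)"
      using that v(1) A
      by (auto simp: A_def scalar_prod_def lessThan_Suc_atMost atLeast0LessThan intro!: sum.cong)
    then show ?thesis using v(3) that by simp
  qed
  ultimately show ?thesis by (intro exI[of _ "\<lambda>r. v $ r"]) auto
qed

text \<open>Monomials in countably many coordinates are indexed by lists over \<open>'k\<close>,
  which \<open>from_nat\<close> enumerates; reordered lists repeat a monomial harmlessly. A single
  sequence \<open>e\<close> serves every \<open>p\<close> and only the length \<open>N\<close>
  varies, which later allows a pigeonhole argument over uncountably many \<open>p\<close>.\<close>

lemma poly_funs_countable_span: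
  fixes c :: "'k::countable \<Rightarrow> 'x \<Rightarrow> complex"
  shows "\<exists>e :: nat \<Rightarrow> 'x \<Rightarrow> complex. \<forall>p \<in> poly_funs (range c). \<exists>N a. \<forall>x. p x = (\<Sum>k<N. a k * e k x)"
proof -
  define e where "e k x = (\<Prod>j\<leftarrow>(from_nat k :: 'k list). c j x)" for k x
  define L where "L = {p. \<exists>N a. \<forall>x. p x = (\<Sum>k<N. a k * e k x)}"
  have e_to_nat: "e (to_nat w) x = (\<Prod>j\<leftarrow>w. c j x)" for w x by (simp add: e_def)
  \<comment> \<open>Extending by zero coefficients brings two combinations of different lengths to a
    common length, so that they can be added.\<close>
  have pad: "\<exists>a'. \<forall>x. (\<Sum>k<N. a k * e k x) = (\<Sum>k<N + M. a' k * e k x)" for N M a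
  proof (intro exI allI)
    fix x
    show "(\<Sum>k<N. a k * e k x) = (\<Sum>k<N + M. (if k < N then a k else 0) * e k x)"
      by (rule sum.mono_neutral_cong_left) auto
  qed
  have L_add: "(\<lambda>x. p x + q x) \<in> L" if pL: "p \<in> L" and qL: "q \<in> L" for p q
  proof -
    obtain N a where p: "\<forall>x. p x = (\<Sum>k<N. a k * e k x)" using pL unfolding L_def by blast
    obtain M b where q: "\<forall>x. q x = (\<Sum>k<M. b k * e k x)" using qL unfolding L_def by blast
    obtain a' where a': "\<forall>x. (\<Sum>k<N. a k * e k x) = (\<Sum>k<N + M. a' k * e k x)"
      using pad by blast
    obtain b' where b': "\<forall>x. (\<Sum>k<M. b k * e k x) = (\<Sum>k<M + N. b' k * e k x)"
      using pad by blast
    have "\<forall>x. p x + q x = (\<Sum>k<N + M. (a' k + b' k) * e k x)"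
      using p q a' b' by (simp add: sum.distrib distrib_right add.commute)
    then show ?thesis unfolding L_def by (intro CollectI exI)
  qed
  have L_smult: "(\<lambda>x. s * p x) \<in> L" if pL: "p \<in> L" for p s
  proof -
    obtain N a where "\<forall>x. p x = (\<Sum>k<N. a k * e k x)" using pL unfolding L_def by blast
    then have "\<forall>x. s * p x = (\<Sum>k<N. (s * a k) * e k x)"
      by (simp add: sum_distrib_left mult.assoc)
    then show ?thesis unfolding L_def by (intro CollectI exI)
  qed
  have L_mon: "(\<lambda>x. \<Prod>j\<leftarrow>w. c j x) \<in> L" for w
  proof -
    have "\<forall>x. (\<Prod>j\<leftarrow>w. c j x) = (\<Sum>k<Suc (to_nat w). (if k = to_nat w then 1 else 0) * e k x)"
      by (subst sum.lessThan_Suc) (simp add: e_to_nat)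
    then show ?thesis unfolding L_def by (intro CollectI exI)
  qed
  have L_sum: "(\<lambda>x. \<Sum>k<N. f k x) \<in> L" if "\<And>k. f k \<in> L" for f and N :: nat
  proof (induction N)
    case 0
    show ?case using L_smult[OF L_mon, of 0] by simp
  next
    case (Suc N)
    then show ?case using L_add that by simp
  qed
  have L_mult: "(\<lambda>x. p x * q x) \<in> L" if pL: "p \<in> L" and qL: "q \<in> L" for p q
  proof -
    obtain N a where p: "\<forall>x. p x = (\<Sum>k<N. a k * e k x)" using pL unfolding L_def by blast
    obtain M b where q: "\<forall>x. q x = (\<Sum>k<M. b k * e k x)" using qL unfolding L_def by blast
    have "(\<lambda>x. e k x * e m x) \<in> L" for k m
      using L_mon[of "from_nat k @ from_nat m"] by (simp add: e_def)
    then have "(\<lambda>x. \<Sum>k<N. \<Sum>m<M. (a k * b m) * (e k x * e m x)) \<in> L"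
      by (intro L_sum L_smult)
    then show ?thesis using p q by (simp add: sum_product mult_ac)
  qed
  have "p \<in> L" if "p \<in> poly_funs (range c)" for p
    using that
  proof (induction rule: poly_funs_induct)
    case (const a)
    show ?case using L_smult[OF L_mon[of "[]"], of a] by simp
  next
    case (coord f)
    then obtain j where "f = c j" by blast
    then show ?case using L_mon[of "[j]"] by simp
  qed (auto intro: L_add L_mult)
  then show ?thesis unfolding L_def by blast
qed

section \<open>Weak Nullstellensatz\<close>

text \<open>Ideals of total functions, as bare sets: the Nullstellensatz needs only these closure
  conditions, not the record-based ideals over which the spectrum is defined.\<close>

definition proper_ideal :: "('x \<Rightarrow> complex) set \<Rightarrow> ('x \<Rightarrow> complex) set \<Rightarrow> bool" where
  "proper_ideal P I \<longleftrightarrow> I \<subseteq> P \<and> (\<lambda>x. 0) \<in> I \<and> (\<lambda>x. 1) \<notin> I \<and>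
     (\<forall>f\<in>I. \<forall>g\<in>I. (\<lambda>x. f x + g x) \<in> I) \<and> (\<forall>p\<in>P. \<forall>f\<in>I. (\<lambda>x. p x * f x) \<in> I)"

lemma proper_idealD:
  assumes "proper_ideal P I"
  shows "I \<subseteq> P" "(\<lambda>x. 0) \<in> I" "(\<lambda>x. 1) \<notin> I"
    "f \<in> I \<Longrightarrow> g \<in> I \<Longrightarrow> (\<lambda>x. f x + g x) \<in> I"
    "p \<in> P \<Longrightarrow> f \<in> I \<Longrightarrow> (\<lambda>x. p x * f x) \<in> I"
  using assms unfolding proper_ideal_def by blast+

lemma proper_ideal_sum:
  assumes "proper_ideal P I" "\<And>i. i \<in> S \<Longrightarrow> f i \<in> I"
  shows "(\<lambda>x. \<Sum>i\<in>S. f i x) \<in> I"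
  using assms(2)
  by (induction S rule: infinite_finite_induct)
    (auto intro: proper_idealD(2,4)[OF assms(1)])

lemma poly_funs_poly:
  fixes u :: "'x \<Rightarrow> complex"
  assumes "u \<in> poly_funs C"
  shows "(\<lambda>x. poly Q (u x)) \<in> poly_funs C"
  by (induction Q) (simp_all add: poly_funs_const poly_funs_add poly_funs_mult assms)

text \<open>If every \<open>u - a\<close> is invertible modulo \<open>I\<close>, no nonzero polynomial in \<open>u\<close> lies in \<open>I\<close>; but the
  uncountably many inverses live in a space of countable dimension, and a linear relation
  between them becomes such a polynomial on clearing denominators.\<close>

lemma proper_ideal_add_root:
  fixes c :: "'k::countable \<Rightarrow> 'x \<Rightarrow> complex"
  assumes I: "proper_ideal (poly_funs C) I" and C: "C \<subseteq> range c" and u: "u \<in> poly_funs C"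
  shows "\<exists>a J. proper_ideal (poly_funs C) J \<and> I \<subseteq> J \<and> (\<lambda>x. u x - a) \<in> J"
proof (rule ccontr)
  assume neg: "\<not> ?thesis"
  note ID = proper_idealD[OF I]
  have um: "(\<lambda>x. u x - a) \<in> poly_funs C" for a
    by (intro poly_funs_diff poly_funs_const u)
  have "\<exists>q i. q \<in> poly_funs C \<and> i \<in> I \<and> (\<forall>x. (u x - a) * q x = 1 - i x)" for a
  proof -
    \<comment> \<open>The ideal generated by \<open>I\<close> and \<open>u - a\<close>. By the
      contrary assumption it cannot be proper, so it contains 1, which yields an inverse of
      \<open>u - a\<close> modulo \<open>I\<close>.\<close>
    define J where "J = {f. \<exists>i q. i \<in> I \<and> q \<in> poly_funs C \<and> (\<forall>x. f x = i x + q x * (u x - a))}"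
    have IJ: "i \<in> J" if "i \<in> I" for i
      unfolding J_def using that poly_funs_const[of 0 C] by (force intro: exI[of _ i])
    have uJ: "(\<lambda>x. u x - a) \<in> J"
      unfolding J_def using ID(2) poly_funs_const[of 1 C] by force
    have "proper_ideal (poly_funs C) J" if "(\<lambda>x. 1) \<notin> J"
      unfolding proper_ideal_def
    proof (intro conjI ballI that)
      show "J \<subseteq> poly_funs C"
      proof
        fix f assume "f \<in> J"
        then obtain i q where "i \<in> I" "q \<in> poly_funs C" "f = (\<lambda>x. i x + q x * (u x - a))"
          unfolding J_def by auto
        then show "f \<in> poly_funs C"
          using ID(1) um by (auto intro!: poly_funs_add poly_funs_mult)
      qed
      show "(\<lambda>x. 0) \<in> J" using IJ ID(2) by blast
    next
      fix f g assume "f \<in> J" "g \<in> J"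
      then obtain i q j r where f: "i \<in> I" "q \<in> poly_funs C" "\<forall>x. f x = i x + q x * (u x - a)"
        and g: "j \<in> I" "r \<in> poly_funs C" "\<forall>x. g x = j x + r x * (u x - a)"
        unfolding J_def by auto
      have "\<forall>x. f x + g x = (i x + j x) + (q x + r x) * (u x - a)"
        using f(3) g(3) by (simp add: algebra_simps)
      then show "(\<lambda>x. f x + g x) \<in> J"
        unfolding J_def using ID(4)[OF f(1) g(1)] poly_funs_add[OF f(2) g(2)] by blast
    next
      fix p f assume p: "p \<in> poly_funs C" and "f \<in> J"
      then obtain i q where f: "i \<in> I" "q \<in> poly_funs C" "\<forall>x. f x = i x + q x * (u x - a)"
        unfolding J_def by auto
      have "\<forall>x. p x * f x = p x * i x + (p x * q x) * (u x - a)"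
        using f(3) by (simp add: distrib_left mult.assoc)
      then show "(\<lambda>x. p x * f x) \<in> J"
        unfolding J_def using ID(5)[OF p f(1)] poly_funs_mult[OF p f(2)] by blast
    qed
    then have "(\<lambda>x. 1) \<in> J" using neg IJ uJ by blast
    then obtain i q where "i \<in> I" "q \<in> poly_funs C" "\<forall>x. 1 = i x + q x * (u x - a)"
      unfolding J_def by auto
    then show ?thesis by (intro exI[of _ q] exI[of _ i]) (auto simp: algebra_simps)
  qed
  then obtain q i where q: "\<And>a. q a \<in> poly_funs C" and i: "\<And>a. i a \<in> I"
    and inv: "\<And>a x. (u x - a) * q a x = 1 - i a x"
    by metis
  have no_poly: "Q = 0" if "(\<lambda>x. poly Q (u x)) \<in> I" for Q
    using that
  proof (induction "degree Q" arbitrary: Q)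
    case 0
    then obtain s where s: "Q = [:s:]" using degree_eq_zeroE by metis
    show ?case
    proof (rule ccontr)
      assume "Q \<noteq> 0"
      then have "s \<noteq> 0" using s by simp
      then have "(\<lambda>x. (1 / s) * poly Q (u x)) = (\<lambda>x. 1)" using s by simp
      then show False using ID(5)[OF poly_funs_const[of "1 / s"] 0(2)] ID(3) by simp
    qed
  next
    case (Suc d)
    have "\<not> constant (poly Q)" using Suc(2) by (simp add: constant_degree)
    then obtain b where "poly Q b = 0" using fundamental_theorem_of_algebra by blast
    then obtain R where R: "Q = [:-b, 1:] * R" by (metis poly_eq_0_iff_dvd dvdE)
    then have "R \<noteq> 0" using Suc(2) by auto
    then have d: "d = degree R"
      using Suc(2) R degree_mult_eq[of "[:-b, 1:]" R] by simp
    \<comment> \<open>\<open>q b\<close> inverts \<open>u - b\<close> modulo \<open>I\<close>, so it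
      cancels the factor of \<open>Q\<close> belonging to the root \<open>b\<close>; membership in
      \<open>I\<close> passes to the cofactor of smaller degree.\<close>
    have eq: "q b x * poly Q (u x) + poly R (u x) * i b x = poly R (u x)" for x
    proof -
      have "q b x * poly Q (u x) = ((u x - b) * q b x) * poly R (u x)"
        by (simp add: R algebra_simps)
      then show ?thesis unfolding inv by (simp add: algebra_simps)
    qed
    have "(\<lambda>x. q b x * poly Q (u x) + poly R (u x) * i b x) \<in> I"
      by (rule ID(4)[OF ID(5)[OF q Suc(3)] ID(5)[OF poly_funs_poly[OF u] i]])
    then have "R = 0" using Suc(1)[OF d] by (simp add: eq)
    then show ?case using R by simp
  qed
  obtain e :: "nat \<Rightarrow> 'x \<Rightarrow> complex"
    where e: "\<forall>p \<in> poly_funs (range c). \<exists>N a. \<forall>x. p x = (\<Sum>k<N. a k * e k x)"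
    using poly_funs_countable_span[of c] by blast
  have "q a \<in> poly_funs (range c)" for a
    using poly_funs_compose[OF q, of id "range c"] C by (auto intro: poly_funs_coord)
  then have "\<exists>N m. \<forall>x. q a x = (\<Sum>k<N. m k * e k x)" for a using e by blast
  then obtain N m where qm: "\<And>a x. q a x = (\<Sum>k<N a. m a k * e k x)" by metis
  \<comment> \<open>The lengths \<open>N a\<close> split the uncountable set of all \<open>a\<close>
    into countably many classes, so one class is infinite. It supplies \<open>M + 1\<close> inverses
    in the span of the same \<open>M\<close> functions.\<close>
  have "\<exists>M. infinite {a. N a = M}"
  proof (rule ccontr)
    assume "\<not> ?thesis"
    then have "\<And>M. countable {a. N a = M}" using countable_finite by blast
    then have "countable (\<Union>M. {a. N a = M})" by blast
    moreover have "(\<Union>M. {a. N a = M}) = (UNIV :: complex set)" by auto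
    ultimately show False using uncountable_UNIV_complex by simp
  qed
  then obtain M where "infinite {a. N a = M}" by blast
  then obtain F where F: "F \<subseteq> {a. N a = M}" "finite F" "card F = Suc M"
    using infinite_arbitrarily_large by metis
  obtain s where s: "bij_betw s {..<Suc M} F"
    using ex_bij_betw_nat_finite[OF F(2)] F(3) by (auto simp: atLeast0LessThan)
  have sF: "N (s r) = M" if "r \<le> M" for r
    using s F(1) that by (force simp: bij_betw_def lessThan_Suc_atMost)
  obtain k where k: "\<exists>r\<le>M. k r \<noteq> 0" "\<forall>j<M. (\<Sum>r\<le>M. k r * m (s r) j) = 0"
    using ex_linear_relation[of M "\<lambda>r. m (s r)"] by blast
  have rel: "(\<Sum>r\<le>M. k r * q (s r) x) = 0" for x
  proof -
    have "(\<Sum>r\<le>M. k r * q (s r) x) = (\<Sum>r\<le>M. \<Sum>j<M. k r * m (s r) j * e j x)"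
      by (intro sum.cong refl) (simp add: qm sF sum_distrib_left mult.assoc)
    also have "\<dots> = (\<Sum>j<M. (\<Sum>r\<le>M. k r * m (s r) j) * e j x)"
      by (subst sum.swap) (simp add: sum_distrib_right)
    finally show ?thesis using k(2) by simp
  qed
  \<comment> \<open>Numerator of the sum of \<open>k r / (u - s r)\<close> over the common
    denominator. At \<open>s r0\<close> all summands but one vanish, so it is not the zero
    polynomial.\<close>
  define Q where "Q = (\<Sum>r\<le>M. smult (k r) (\<Prod>t\<in>{..M} - {r}. [:- s t, 1:]))"
  obtain r0 where r0: "r0 \<le> M" "k r0 \<noteq> 0" using k(1) by blast
  have "poly Q (s r0) = (\<Sum>r\<le>M. k r * (\<Prod>t\<in>{..M} - {r}. s r0 - s t))"
    by (simp add: Q_def poly_sum poly_prod)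
  also have "\<dots> = (\<Sum>r\<le>M. if r = r0 then k r0 * (\<Prod>t\<in>{..M} - {r0}. s r0 - s t) else 0)"
    using r0(1) by (intro sum.cong refl) (auto intro!: prod_zero)
  also have "\<dots> = k r0 * (\<Prod>t\<in>{..M} - {r0}. s r0 - s t)" using r0(1) by simp
  also have "\<dots> \<noteq> 0"
    using r0 s by (auto simp: bij_betw_def inj_on_def lessThan_Suc_atMost)
  finally have "Q \<noteq> 0" by auto
  moreover have "(\<lambda>x. poly Q (u x)) \<in> I"
  proof -
    \<comment> \<open>Multiplying \<open>rel\<close> by all factors \<open>u - s t\<close> replaces
      \<open>q (s r)\<close> by \<open>w r\<close> times \<open>1 - i (s r)\<close>, up to scalars
      already contained in \<open>w r\<close>. Hence the sum of the \<open>w r\<close>, which is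
      \<open>Q\<close> at \<open>u\<close>, lies in \<open>I\<close>.\<close>
    define w where "w r x = k r * (\<Prod>t\<in>{..M} - {r}. u x - s t)" for r x
    have w: "w r \<in> poly_funs C" for r
      unfolding w_def by (intro poly_funs_mult poly_funs_const poly_funs_prod um)
    have "poly Q (u x) = (\<Sum>r\<le>M. w r x * i (s r) x)" for x
    proof -
      have "(\<Sum>r\<le>M. w r x * ((u x - s r) * q (s r) x))
          = (\<Sum>r\<le>M. (\<Prod>t\<le>M. u x - s t) * (k r * q (s r) x))"
      proof (intro sum.cong refl)
        fix r assume "r \<in> {..M}"
        then have "(\<Prod>t\<le>M. u x - s t) = (u x - s r) * (\<Prod>t\<in>{..M} - {r}. u x - s t)"
          by (intro prod.remove) auto
        then show "w r x * ((u x - s r) * q (s r) x) = (\<Prod>t\<le>M. u x - s t) * (k r * q (s r) x)"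
          by (simp add: w_def)
      qed
      also have "\<dots> = 0" using rel by (simp flip: sum_distrib_left)
      finally have "(\<Sum>r\<le>M. w r x * (1 - i (s r) x)) = 0" by (simp only: inv)
      then have "(\<Sum>r\<le>M. w r x) = (\<Sum>r\<le>M. w r x * i (s r) x)"
        by (simp add: algebra_simps sum_subtractf)
      then show ?thesis by (simp add: Q_def poly_sum poly_prod w_def)
    qed
    then show ?thesis using proper_ideal_sum[OF I ID(5)[OF w i]] by simp
  qed
  ultimately show False using no_poly by blast
qed

text \<open>The coordinates receive values one at a time, each time enlarging the ideal. The domain
  \<open>'x\<close> is arbitrary, so no point with the coordinates \<open>a\<close> is claimed to
  exist; an application has to exhibit one.\<close>

lemma weak_nullstellensatz:
  fixes c :: "'k::countable \<Rightarrow> 'x \<Rightarrow> complex"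
  assumes I: "proper_ideal (poly_funs (c ` K)) I" and K: "finite K"
  shows "\<exists>a. \<forall>x. (\<forall>k\<in>K. c k x = a k) \<longrightarrow> (\<forall>f\<in>I. f x = 0)"
proof -
  let ?P = "poly_funs (c ` K)"
  have "\<exists>a J. proper_ideal ?P J \<and> I \<subseteq> J \<and> (\<forall>k\<in>S. (\<lambda>x. c k x - a k) \<in> J)" if "S \<subseteq> K" for S
    using finite_subset[OF that K] that
  proof (induction S)
    case empty
    show ?case using I by (intro exI[of _ "\<lambda>_. 0"] exI[of _ I]) simp
  next
    case (insert k S)
    then obtain a J where J: "proper_ideal ?P J" "I \<subseteq> J" "\<forall>k\<in>S. (\<lambda>x. c k x - a k) \<in> J"
      by (metis insert_subset)
    have "c k \<in> ?P" using insert.prems by (intro poly_funs_coord) auto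
    then obtain b J' where J': "proper_ideal ?P J'" "J \<subseteq> J'" "(\<lambda>x. c k x - b) \<in> J'"
      using proper_ideal_add_root[OF J(1) image_subset_iff[THEN iffD2], of c "c k"] by auto
    then show ?case using J insert.hyps
      by (intro exI[of _ "a(k := b)"] exI[of _ J']) auto
  qed
  then obtain a J where J: "proper_ideal ?P J" "I \<subseteq> J" "\<And>k. k \<in> K \<Longrightarrow> (\<lambda>x. c k x - a k) \<in> J"
    using subset_refl by metis
  note JD = proper_idealD[OF J(1)]
  have "f x = 0" if x: "\<forall>k\<in>K. c k x = a k" and f: "f \<in> I" for f x
  proof -
    \<comment> \<open>Modulo \<open>J\<close> each coordinate equals its value at \<open>x\<close>,
      so every polynomial does. For \<open>f\<close> in \<open>I\<close> the constant
      \<open>f x\<close> then lies in the proper ideal \<open>J\<close> and must be 0.\<close>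
    have cong: "(\<lambda>y. p y - p x) \<in> J" if "p \<in> ?P" for p
      using that
    proof (induction rule: poly_funs_induct)
      case (const a)
      then show ?case using JD(2) by simp
    next
      case (coord f)
      then show ?case using J(3) x by auto
    next
      case (add f g)
      then show ?case using JD(4) by (simp add: add_diff_add)
    next
      case (mult f g)
      have "(\<lambda>y. g y * (f y - f x) + f x * (g y - g x)) \<in> J"
        by (rule JD(4)[OF JD(5)[OF mult.hyps(2) mult.IH(1)] JD(5)[OF poly_funs_const mult.IH(2)]])
      then show ?case by (simp add: algebra_simps)
    qed
    have fJ: "f \<in> J" using f J(2) by blast
    have "(\<lambda>y. (-1) * (f y - f x) + f y) \<in> J"
      by (rule JD(4)[OF JD(5)[OF poly_funs_const cong] fJ]) (use fJ JD(1) in blast)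
    then have "(\<lambda>y. f x) \<in> J" by simp
    then have "(\<lambda>y. (1 / f x) * f x) \<in> J" by (rule JD(5)[OF poly_funs_const])
    then show ?thesis using JD(3) by (cases "f x = 0") auto
  qed
  then show ?thesis by blast
qed

section \<open>Multisymmetric polynomials\<close>

text \<open>\<open>G\<close> may be any algebra of functions on tuples that contains the power sums.
  In the application it consists of the restrictions of invariants to diagonal
  representations.\<close>

locale power_sum_algebra =
  fixes n :: nat and G :: "((nat \<Rightarrow> 'u) \<Rightarrow> complex) set" and C :: "('u \<Rightarrow> complex) set"
  assumes G_const: "(\<lambda>v. a) \<in> G"
    and G_add: "f \<in> G \<Longrightarrow> h \<in> G \<Longrightarrow> (\<lambda>v. f v + h v) \<in> G"
    and G_mult: "f \<in> G \<Longrightarrow> h \<in> G \<Longrightarrow> (\<lambda>v. f v * h v) \<in> G"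
    and G_power_sum: "g \<in> poly_funs C \<Longrightarrow> (\<lambda>v. \<Sum>i<n. g (v i)) \<in> G"
begin

lemma G_sum: "(\<And>i. i \<in> I \<Longrightarrow> f i \<in> G) \<Longrightarrow> (\<lambda>v. \<Sum>i\<in>I. f i v) \<in> G"
  by (induction I rule: infinite_finite_induct) (auto intro: G_const G_add)

text \<open>Multiply the symmetrization for \<open>T\<close> by the power sum of \<open>g t\<close>, \<open>t \<notin> T\<close>. The summands in
  which \<open>g t\<close> is evaluated at an index used by \<open>T\<close> are symmetrizations for \<open>T\<close> with one factor
  modified; all others equal, by symmetry, the symmetrization for \<open>insert t T\<close>.\<close>

lemma symmetrized_product:
  assumes "T \<subseteq> {..<n}" and "\<And>i. g i \<in> poly_funs C"
  shows "(\<lambda>v. \<Sum>\<sigma> | \<sigma> permutes {..<n}. \<Prod>i\<in>T. g i (v (\<sigma> i))) \<in> G"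
proof -
  have "finite T" using assms(1) finite_subset by blast
  then show ?thesis using assms
  proof (induction T arbitrary: g)
    case empty
    then show ?case using G_const by simp
  next
    case (insert t T)
    define h where "h S g v = (\<Sum>\<sigma> | \<sigma> permutes {..<n}. \<Prod>i\<in>S. g i (v (\<sigma> i)))"
      for S and g :: "nat \<Rightarrow> 'u \<Rightarrow> complex" and v
    define g' where "g' i = g(i := \<lambda>u. g t u * g i u)" for i
    have T: "T \<subseteq> {..<n}" "t < n" "t \<notin> T" "finite T" using insert by auto
    have hT: "h T g'' \<in> G" if "\<And>i. g'' i \<in> poly_funs C" for g''
      unfolding h_def by (rule insert.IH[OF T(1) that])
    have g': "g' i j \<in> poly_funs C" for i j
      using insert.prems(2) by (auto simp: g'_def intro: poly_funs_mult)
    have main: "(\<Sum>i<n. g t (v i)) * h T g v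
        = (\<Sum>i\<in>T. h T (g' i) v) + of_nat (n - card T) * h (insert t T) g v" for v
    proof -
      have "(\<Sum>i<n. g t (v i)) * h T g v
          = (\<Sum>\<sigma> | \<sigma> permutes {..<n}. (\<Sum>i<n. g t (v (\<sigma> i))) * (\<Prod>j\<in>T. g j (v (\<sigma> j))))"
        unfolding h_def sum_distrib_left
      proof (intro sum.cong refl)
        fix \<sigma> assume "\<sigma> \<in> {\<sigma>. \<sigma> permutes {..<n}}"
        then have "(\<Sum>i<n. g t (v i)) = (\<Sum>i<n. g t (v (\<sigma> i)))"
          using sum.permute[of \<sigma> "{..<n}" "\<lambda>i. g t (v i)"] by (simp add: o_def)
        then show "(\<Sum>i<n. g t (v i)) * (\<Prod>j\<in>T. g j (v (\<sigma> j)))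
            = (\<Sum>i<n. g t (v (\<sigma> i))) * (\<Prod>j\<in>T. g j (v (\<sigma> j)))" by simp
      qed
      also have "\<dots> = (\<Sum>i<n. \<Sum>\<sigma> | \<sigma> permutes {..<n}. g t (v (\<sigma> i)) * (\<Prod>j\<in>T. g j (v (\<sigma> j))))"
        unfolding sum_distrib_right by (rule sum.swap)
      also have "\<dots> = (\<Sum>i\<in>T. \<Sum>\<sigma> | \<sigma> permutes {..<n}. g t (v (\<sigma> i)) * (\<Prod>j\<in>T. g j (v (\<sigma> j))))
          + (\<Sum>i\<in>{..<n} - T. \<Sum>\<sigma> | \<sigma> permutes {..<n}. g t (v (\<sigma> i)) * (\<Prod>j\<in>T. g j (v (\<sigma> j))))"
        using sum.subset_diff[OF T(1)] by (simp add: add.commute)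
      also have "(\<Sum>i\<in>T. \<Sum>\<sigma> | \<sigma> permutes {..<n}. g t (v (\<sigma> i)) * (\<Prod>j\<in>T. g j (v (\<sigma> j))))
          = (\<Sum>i\<in>T. h T (g' i) v)"
        unfolding h_def
      proof (intro sum.cong refl)
        fix i \<sigma> assume i: "i \<in> T"
        have "(\<Prod>j\<in>T. g' i j (v (\<sigma> j)))
            = g' i i (v (\<sigma> i)) * (\<Prod>j\<in>T - {i}. g' i j (v (\<sigma> j)))"
          using prod.remove[OF T(4) i] .
        also have "(\<Prod>j\<in>T - {i}. g' i j (v (\<sigma> j))) = (\<Prod>j\<in>T - {i}. g j (v (\<sigma> j)))"
          by (intro prod.cong) (auto simp: g'_def)
        also have "g' i i (v (\<sigma> i)) * \<dots> = g t (v (\<sigma> i)) * (\<Prod>j\<in>T. g j (v (\<sigma> j)))"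
          using prod.remove[OF T(4) i, of "\<lambda>j. g j (v (\<sigma> j))"] by (simp add: g'_def)
        finally show "g t (v (\<sigma> i)) * (\<Prod>j\<in>T. g j (v (\<sigma> j))) = (\<Prod>j\<in>T. g' i j (v (\<sigma> j)))" ..
      qed
      also have "(\<Sum>i\<in>{..<n} - T. \<Sum>\<sigma> | \<sigma> permutes {..<n}. g t (v (\<sigma> i)) * (\<Prod>j\<in>T. g j (v (\<sigma> j))))
          = (\<Sum>i\<in>{..<n} - T. h (insert t T) g v)"
      proof (intro sum.cong refl)
        fix i assume i: "i \<in> {..<n} - T"
        \<comment> \<open>\<open>\<tau>\<close> exchanges \<open>i\<close> and \<open>t\<close>,
          both outside \<open>T\<close>, so reindexing by it moves the extra factor to index
          \<open>t\<close> and leaves the product over \<open>T\<close> alone. For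
          \<open>i = t\<close> it is the identity.\<close>
        define \<tau> where "\<tau> = transpose i t"
        have "\<tau> permutes {..<n}" unfolding \<tau>_def using i T by (intro permutes_swap_id) auto
        then have "(\<Sum>\<sigma> | \<sigma> permutes {..<n}. g t (v (\<sigma> i)) * (\<Prod>j\<in>T. g j (v (\<sigma> j))))
            = (\<Sum>\<sigma> | \<sigma> permutes {..<n}. g t (v ((\<sigma> \<circ> \<tau>) i)) * (\<Prod>j\<in>T. g j (v ((\<sigma> \<circ> \<tau>) j))))"
          by (rule sum_permutations_compose_right)
        also have "\<dots> = h (insert t T) g v"
          unfolding h_def
        proof (intro sum.cong refl)
          fix \<sigma>
          have "(\<Prod>j\<in>T. g j (v ((\<sigma> \<circ> \<tau>) j))) = (\<Prod>j\<in>T. g j (v (\<sigma> j)))"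
            using i T by (intro prod.cong refl) (auto simp: \<tau>_def transpose_def)
          then show "g t (v ((\<sigma> \<circ> \<tau>) i)) * (\<Prod>j\<in>T. g j (v ((\<sigma> \<circ> \<tau>) j)))
              = (\<Prod>j\<in>insert t T. g j (v (\<sigma> j)))"
            using T by (simp add: \<tau>_def)
        qed
        finally show "(\<Sum>\<sigma> | \<sigma> permutes {..<n}. g t (v (\<sigma> i)) * (\<Prod>j\<in>T. g j (v (\<sigma> j))))
            = h (insert t T) g v" .
      qed
      also have "\<dots> = of_nat (n - card T) * h (insert t T) g v"
        using T by (simp add: card_Diff_subset)
      finally show ?thesis .
    qed
    \<comment> \<open>The coefficient \<open>n - card T\<close> counts the indices outside
      \<open>T\<close>; \<open>t\<close> is one of them, so the coefficient is nonzero and can be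
      divided out.\<close>
    have "card T < n"
      using psubset_card_mono[of "{..<n}" T] T by auto
    then have "h (insert t T) g v = 1 / of_nat (n - card T) *
        ((\<Sum>i<n. g t (v i)) * h T g v + (-1) * (\<Sum>i\<in>T. h T (g' i) v))" for v
      using main[of v] by simp
    moreover have "(\<lambda>v. 1 / of_nat (n - card T) *
        ((\<Sum>i<n. g t (v i)) * h T g v + (-1) * (\<Sum>i\<in>T. h T (g' i) v))) \<in> G"
      using insert.prems(2) g'
      by (intro G_mult G_add G_const G_sum G_power_sum hT)
    ultimately have "h (insert t T) g \<in> G" by presburger
    then show ?case by (simp only: h_def[abs_def])
  qed
qed

text \<open>Expanded, \<open>f\<close> is a sum of products with one polynomial factor per index,
  and those are settled by \<open>symmetrized_product\<close> with \<open>T\<close> the whole index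
  set. The proof absorbs coordinates into these factors instead of expanding.\<close>

lemma symmetrization_mem:
  assumes "f \<in> poly_funs {\<lambda>v. c (v i) | c i. c \<in> C \<and> i < n}"
  shows "(\<lambda>v. \<Sum>\<sigma> | \<sigma> permutes {..<n}. f (v \<circ> \<sigma>)) \<in> G"
proof -
  \<comment> \<open>Generalized from \<open>\<lambda>v. 1\<close> to all \<open>h \<in> U\<close> so that the induction passes through products.\<close>
  define U where "U = {h :: (nat \<Rightarrow> 'u) \<Rightarrow> complex. \<forall>g. (\<forall>i. g i \<in> poly_funs C) \<longrightarrow>
    (\<lambda>v. \<Sum>\<sigma> | \<sigma> permutes {..<n}. h (v \<circ> \<sigma>) * (\<Prod>i<n. g i (v (\<sigma> i)))) \<in> G}"
  have "\<forall>h\<in>U. (\<lambda>v. f v * h v) \<in> U" using assms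
  proof (induction rule: poly_funs_induct)
    case (const a)
    show ?case
    proof
      fix h assume h: "h \<in> U"
      show "(\<lambda>v. a * h v) \<in> U" unfolding U_def
      proof (intro CollectI allI impI)
        fix g :: "nat \<Rightarrow> 'u \<Rightarrow> complex" assume "\<forall>i. g i \<in> poly_funs C"
        then have "(\<lambda>v. a * (\<Sum>\<sigma> | \<sigma> permutes {..<n}. h (v \<circ> \<sigma>) * (\<Prod>i<n. g i (v (\<sigma> i))))) \<in> G"
          using h unfolding U_def by (intro G_mult G_const) blast
        then show "(\<lambda>v. \<Sum>\<sigma> | \<sigma> permutes {..<n}. a * h (v \<circ> \<sigma>) * (\<Prod>i<n. g i (v (\<sigma> i)))) \<in> G"
          by (simp add: sum_distrib_left mult.assoc)
      qed
    qed
  next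
    case (coord f)
    then obtain c j where c: "c \<in> C" "j < n" and f: "f = (\<lambda>v. c (v j))" by blast
    show ?case
    proof
      fix h assume h: "h \<in> U"
      show "(\<lambda>v. f v * h v) \<in> U" unfolding U_def
      proof (intro CollectI allI impI)
        fix g :: "nat \<Rightarrow> 'u \<Rightarrow> complex" assume g: "\<forall>i. g i \<in> poly_funs C"
        define g' where "g' = g(j := \<lambda>u. c u * g j u)"
        have "\<forall>i. g' i \<in> poly_funs C"
          using g c by (auto simp: g'_def intro: poly_funs_mult poly_funs_coord)
        then have mem:
          "(\<lambda>v. \<Sum>\<sigma> | \<sigma> permutes {..<n}. h (v \<circ> \<sigma>) * (\<Prod>i<n. g' i (v (\<sigma> i)))) \<in> G"
          using h unfolding U_def by blast
        have eq: "(\<Prod>i<n. g' i (v (\<sigma> i))) = c (v (\<sigma> j)) * (\<Prod>i<n. g i (v (\<sigma> i)))"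
          for v :: "nat \<Rightarrow> 'u" and \<sigma> :: "nat \<Rightarrow> nat"
        proof -
          have "(\<Prod>i<n. g' i (v (\<sigma> i))) = g' j (v (\<sigma> j)) * (\<Prod>i\<in>{..<n} - {j}. g' i (v (\<sigma> i)))"
            using c(2) by (intro prod.remove) auto
          also have "(\<Prod>i\<in>{..<n} - {j}. g' i (v (\<sigma> i))) = (\<Prod>i\<in>{..<n} - {j}. g i (v (\<sigma> i)))"
            by (intro prod.cong) (auto simp: g'_def)
          also have "g' j (v (\<sigma> j)) * \<dots> = c (v (\<sigma> j)) * (\<Prod>i<n. g i (v (\<sigma> i)))"
            using prod.remove[of "{..<n}" j "\<lambda>i. g i (v (\<sigma> i))"] c(2) by (simp add: g'_def)
          finally show ?thesis .
        qed
        have "(\<Sum>\<sigma> | \<sigma> permutes {..<n}. f (v \<circ> \<sigma>) * h (v \<circ> \<sigma>) * (\<Prod>i<n. g i (v (\<sigma> i))))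
            = (\<Sum>\<sigma> | \<sigma> permutes {..<n}. h (v \<circ> \<sigma>) * (\<Prod>i<n. g' i (v (\<sigma> i))))" for v
          by (intro sum.cong refl) (simp add: eq f)
        then show "(\<lambda>v. \<Sum>\<sigma> | \<sigma> permutes {..<n}.
            f (v \<circ> \<sigma>) * h (v \<circ> \<sigma>) * (\<Prod>i<n. g i (v (\<sigma> i)))) \<in> G"
          using mem by presburger
      qed
    qed
  next
    case (add f1 f2)
    show ?case
    proof
      fix h assume h: "h \<in> U"
      show "(\<lambda>v. (f1 v + f2 v) * h v) \<in> U" unfolding U_def
      proof (intro CollectI allI impI)
        fix g :: "nat \<Rightarrow> 'u \<Rightarrow> complex" assume g: "\<forall>i. g i \<in> poly_funs C"
        have *: "(\<lambda>v. \<Sum>\<sigma> | \<sigma> permutes {..<n}.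
            (f1 (v \<circ> \<sigma>) * h (v \<circ> \<sigma>)) * (\<Prod>i<n. g i (v (\<sigma> i)))) \<in> G"
          "(\<lambda>v. \<Sum>\<sigma> | \<sigma> permutes {..<n}.
            (f2 (v \<circ> \<sigma>) * h (v \<circ> \<sigma>)) * (\<Prod>i<n. g i (v (\<sigma> i)))) \<in> G"
          using g bspec[OF add.IH(1) h] bspec[OF add.IH(2) h] unfolding U_def by auto
        show "(\<lambda>v. \<Sum>\<sigma> | \<sigma> permutes {..<n}.
            (f1 (v \<circ> \<sigma>) + f2 (v \<circ> \<sigma>)) * h (v \<circ> \<sigma>) * (\<Prod>i<n. g i (v (\<sigma> i)))) \<in> G"
          using G_add[OF *] by (simp add: distrib_right sum.distrib)
      qed
    qed
  next
    case (mult f1 f2)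
    then show ?case by (simp add: mult.assoc)
  qed
  moreover have "(\<lambda>v. 1) \<in> U"
    unfolding U_def using symmetrized_product[of "{..<n}"] by simp
  ultimately have "(\<lambda>v. f v * 1) \<in> U" by (rule bspec)
  then have "\<forall>g. (\<forall>i. g i \<in> poly_funs C) \<longrightarrow>
    (\<lambda>v. \<Sum>\<sigma> | \<sigma> permutes {..<n}. f (v \<circ> \<sigma>) * (\<Prod>i<n. g i (v (\<sigma> i)))) \<in> G"
    by (simp add: U_def)
  from spec[OF this, of "\<lambda>_ _. 1"] show ?thesis using poly_funs_const by auto
qed

end

section \<open>The abelianization\<close>

context lie_algebra
begin

text \<open>Linear algebra in the quotient space is done with representatives in \<open>'a\<close>,
  reading equations modulo \<open>derived\<close>.\<close>

definition spans_mod_derived :: "nat \<Rightarrow> (nat \<Rightarrow> 'a) \<Rightarrow> bool" where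
  "spans_mod_derived d b \<longleftrightarrow> (\<forall>x. \<exists>c. x - (\<Sum>i<d. c i *s b i) \<in> derived)"

definition independent_mod_derived :: "nat \<Rightarrow> (nat \<Rightarrow> 'a) \<Rightarrow> bool" where
  "independent_mod_derived d b \<longleftrightarrow> (\<forall>c. (\<Sum>i<d. c i *s b i) \<in> derived \<longrightarrow> (\<forall>i<d. c i = 0))"

lemma subspace_derived: "subspace derived"
  by (simp add: derived_def)

lemma bracket_in_derived: "bracket x y \<in> derived"
  unfolding derived_def by (rule span_base) blast

text \<open>Steinitz bound: expressed through \<open>b'\<close>, the first \<open>d' + 1\<close>
  vectors of a longer family \<open>b\<close> would have coefficient rows with only
  \<open>d'\<close> entries, hence a nontrivial relation.\<close>

lemma independent_le_spans_mod_derived: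
  assumes ind: "independent_mod_derived d b" and sp: "spans_mod_derived d' b'"
  shows "d \<le> d'"
proof (rule ccontr)
  assume "\<not> d \<le> d'"
  then have d: "Suc d' \<le> d" by simp
  have "\<forall>r. \<exists>c. b r - (\<Sum>i<d'. c i *s b' i) \<in> derived"
    using sp unfolding spans_mod_derived_def by blast
  then obtain M where M: "\<And>r. b r - (\<Sum>k<d'. M r k *s b' k) \<in> derived" by metis
  obtain c where c: "\<exists>r\<le>d'. c r \<noteq> 0" "\<forall>k<d'. (\<Sum>r\<le>d'. c r * M r k) = 0"
    using ex_linear_relation by blast
  have "(\<Sum>r\<le>d'. c r *s (b r - (\<Sum>k<d'. M r k *s b' k))) \<in> derived"
    by (intro subspace_sum subspace_scale subspace_derived M)
  also have "(\<Sum>r\<le>d'. c r *s (b r - (\<Sum>k<d'. M r k *s b' k)))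
      = (\<Sum>r\<le>d'. c r *s b r) - (\<Sum>r\<le>d'. \<Sum>k<d'. (c r * M r k) *s b' k)"
    by (simp add: scale_right_diff_distrib scale_sum_right sum_subtractf)
  also have "(\<Sum>r\<le>d'. \<Sum>k<d'. (c r * M r k) *s b' k) = (\<Sum>k<d'. (\<Sum>r\<le>d'. c r * M r k) *s b' k)"
    by (subst sum.swap) (simp add: scale_sum_left)
  also have "\<dots> = 0" using c(2) by simp
  also have "(\<Sum>r\<le>d'. c r *s b r) - 0 = (\<Sum>r<d. (if r \<le> d' then c r else 0) *s b r)"
    using d by (simp, intro sum.mono_neutral_cong_left) auto
  finally have "\<forall>r<d. (if r \<le> d' then c r else 0) = 0"
    using ind[unfolded independent_mod_derived_def, rule_format, of "\<lambda>r. if r \<le> d' then c r else 0"]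
    by blast
  moreover obtain r where "r \<le> d'" "c r \<noteq> 0" using c(1) by blast
  ultimately show False using d by (auto dest!: spec[of _ r])
qed

text \<open>Existence of coefficients for every class is spanning. Uniqueness for the class of 0 is
  independence, since the zero family already represents that class; extensionality pins the
  coefficients outside \<open>{..<d}\<close>.\<close>

lemma abelianization_dim_props:
  "(\<forall>X \<in> abelianization. \<exists>!c. c \<in> {..<d} \<rightarrow>\<^sub>E UNIV \<and> (\<Sum>i<d. c i *s b i) \<in> X)
    \<longleftrightarrow> spans_mod_derived d b \<and> independent_mod_derived d b"
proof -
  have X: "abelianization = (\<lambda>x. {y. x - y \<in> derived}) ` UNIV"
    by (auto simp: abelianization_def quotient_def)
  show ?thesis
  proof (intro iffI conjI)
    assume L: "\<forall>X \<in> abelianization. \<exists>!c. c \<in> {..<d} \<rightarrow>\<^sub>E UNIV \<and> (\<Sum>i<d. c i *s b i) \<in> X"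
    show "spans_mod_derived d b"
      unfolding spans_mod_derived_def
    proof
      fix x
      have "\<exists>!c. c \<in> {..<d} \<rightarrow>\<^sub>E UNIV \<and> (\<Sum>i<d. c i *s b i) \<in> {y. x - y \<in> derived}"
        by (rule bspec[OF L]) (simp add: X)
      then show "\<exists>c. x - (\<Sum>i<d. c i *s b i) \<in> derived" by blast
    qed
    show "independent_mod_derived d b"
      unfolding independent_mod_derived_def
    proof (intro allI impI)
      fix c i assume c: "(\<Sum>i<d. c i *s b i) \<in> derived" and i: "i < d"
      have ex1: "\<exists>!c. c \<in> {..<d} \<rightarrow>\<^sub>E UNIV \<and> (\<Sum>i<d. c i *s b i) \<in> {y. 0 - y \<in> derived}"
        by (rule bspec[OF L]) (simp only: X, rule rangeI)
      have "(\<Sum>i<d. restrict c {..<d} i *s b i) \<in> {y. 0 - y \<in> derived}"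
        using c subspace_neg[OF subspace_derived] by simp
      moreover have "(\<Sum>i<d. (\<lambda>i\<in>{..<d}. 0) i *s b i) \<in> {y. 0 - y \<in> derived}"
        using subspace_0[OF subspace_derived] by simp
      moreover have "restrict c {..<d} \<in> {..<d} \<rightarrow>\<^sub>E UNIV" "(\<lambda>i\<in>{..<d}. 0) \<in> {..<d} \<rightarrow>\<^sub>E (UNIV :: complex set)"
        by auto
      ultimately have "restrict c {..<d} = (\<lambda>i\<in>{..<d}. 0)" using ex1 by blast
      then show "c i = 0" using i by (metis restrict_apply' lessThan_iff)
    qed
  next
    assume "spans_mod_derived d b \<and> independent_mod_derived d b"
    then have sp: "spans_mod_derived d b" and ind: "independent_mod_derived d b" by auto
    show "\<forall>X \<in> abelianization. \<exists>!c. c \<in> {..<d} \<rightarrow>\<^sub>E UNIV \<and> (\<Sum>i<d. c i *s b i) \<in> X"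
      proof
      fix Y assume "Y \<in> abelianization"
      then obtain x where Y: "Y = {y. x - y \<in> derived}" unfolding X by blast
      obtain c where c: "x - (\<Sum>i<d. c i *s b i) \<in> derived"
        using sp unfolding spans_mod_derived_def by blast
      show "\<exists>!c. c \<in> {..<d} \<rightarrow>\<^sub>E UNIV \<and> (\<Sum>i<d. c i *s b i) \<in> Y"
        unfolding Y
      proof (rule ex1I[of _ "restrict c {..<d}"])
        show "restrict c {..<d} \<in> {..<d} \<rightarrow>\<^sub>E UNIV
            \<and> (\<Sum>i<d. restrict c {..<d} i *s b i) \<in> {y. x - y \<in> derived}"
          using c by simp
      next
        fix c' assume c': "c' \<in> {..<d} \<rightarrow>\<^sub>E UNIV \<and> (\<Sum>i<d. c' i *s b i) \<in> {y. x - y \<in> derived}"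
        then have "(x - (\<Sum>i<d. c i *s b i)) - (x - (\<Sum>i<d. c' i *s b i)) \<in> derived"
          by (intro subspace_diff[OF subspace_derived c]) simp
        then have "(\<Sum>i<d. (c' i - c i) *s b i) \<in> derived"
          by (simp add: scale_left_diff_distrib sum_subtractf)
        then have "\<forall>i<d. c' i - c i = 0"
          using ind[unfolded independent_mod_derived_def, rule_format, of "\<lambda>i. c' i - c i"] by blast
        then show "c' = restrict c {..<d}"
          using c' by (intro extensionalityI[of _ "{..<d}"]) (auto simp: PiE_def)
      qed
    qed
  qed
qed

text \<open>A basis of \<open>derived\<close> is extended to a basis of the whole algebra: the added
  vectors are \<open>b\<close>, and their coordinate functionals \<open>\<pi>\<close> vanish on
  \<open>derived\<close>.\<close>

lemma ex_abelianization_coordinates: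
  assumes "finite_dimensional"
  shows "\<exists>(b :: nat \<Rightarrow> 'a) (\<pi> :: nat \<Rightarrow> 'a \<Rightarrow> complex).
    (\<forall>j x y. \<pi> j (x + y) = \<pi> j x + \<pi> j y) \<and> (\<forall>j c x. \<pi> j (c *s x) = c * \<pi> j x) \<and>
    (\<forall>j. \<forall>x \<in> derived. \<pi> j x = 0) \<and>
    (\<forall>i < abelianization_dim. \<forall>j < abelianization_dim. \<pi> j (b i) = of_bool (i = j)) \<and>
    (\<forall>x. x - (\<Sum>i<abelianization_dim. \<pi> i x *s b i) \<in> derived)"
proof -
  obtain S where S: "finite S" "span S = UNIV" using assms unfolding finite_dimensional_def by blast
  obtain B0 where B0: "B0 \<subseteq> derived" "independent B0" "derived \<subseteq> span B0"
    by (rule maximal_independent_subset)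
  obtain B where B: "B0 \<subseteq> B" "independent B" "UNIV \<subseteq> span B"
    by (rule maximal_independent_subset_extend[OF subset_UNIV B0(2)])
  have spB: "span B = UNIV" using B(3) by blast
  have spB0: "span B0 = derived"
    using B0 span_minimal[OF B0(1) subspace_derived] by blast
  have "finite B" using independent_span_bound[OF S(1) B(2)] S(2) by auto
  then have finE: "finite (B - B0)" and finB0: "finite B0" using B(1) finite_subset by auto
  define d where "d = card (B - B0)"
  obtain b where b: "bij_betw b {..<d} (B - B0)"
    using ex_bij_betw_nat_finite[OF finE] by (auto simp: atLeast0LessThan d_def)
  \<comment> \<open>Zero beyond \<open>d\<close>, so that linearity and vanishing on
    \<open>derived\<close> hold for all \<open>j\<close>.\<close>
  define \<pi> where "\<pi> j x = (if j < d then representation B x (b j) else 0)" for j x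
  have add: "\<pi> j (x + y) = \<pi> j x + \<pi> j y" for j x y
    using B(2) spB by (simp add: \<pi>_def representation_add)
  have scale: "\<pi> j (c *s x) = c * \<pi> j x" for j c x
    using B(2) spB by (simp add: \<pi>_def representation_scale)
  have bE: "b j \<in> B - B0" if "j < d" for j using b that by (auto simp: bij_betw_def)
  have der: "\<pi> j x = 0" if "x \<in> derived" for j x
  proof (cases "j < d")
    case True
    have "representation B x = representation B0 x"
      using representation_extend[OF B(2) _ B(1)] that spB0 by blast
    moreover have "representation B0 x (b j) = 0"
      using representation_ne_zero[of B0 x "b j"] bE[OF True] by blast
    ultimately show ?thesis by (simp add: \<pi>_def)
  qed (simp add: \<pi>_def)
  have dual: "\<pi> j (b i) = of_bool (i = j)" if "i < d" "j < d" for i j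
  proof -
    have "representation B (b i) = (\<lambda>v. if v = b i then 1 else 0)"
      using representation_basis[OF B(2)] bE[OF that(1)] by blast
    moreover have "b i = b j \<longleftrightarrow> i = j" using b that by (auto simp: bij_betw_def inj_on_def)
    ultimately show ?thesis using that by (auto simp: \<pi>_def)
  qed
  have span: "x - (\<Sum>i<d. \<pi> i x *s b i) \<in> derived" for x
  proof -
    have "x = (\<Sum>v\<in>B. representation B x v *s v)"
      using sum_representation_eq[OF B(2) _ \<open>finite B\<close> order.refl] spB by simp
    also have "\<dots> = (\<Sum>v\<in>B - B0. representation B x v *s v) + (\<Sum>v\<in>B0. representation B x v *s v)"
      using sum.subset_diff[OF B(1) \<open>finite B\<close>] .
    also have "(\<Sum>v\<in>B - B0. representation B x v *s v) = (\<Sum>i<d. \<pi> i x *s b i)"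
      using sum.reindex_bij_betw[OF b, of "\<lambda>v. representation B x v *s v"] by (simp add: \<pi>_def)
    finally have "x - (\<Sum>i<d. \<pi> i x *s b i) = (\<Sum>v\<in>B0. representation B x v *s v)"
      by (metis add_diff_cancel_left')
    also have "\<dots> \<in> derived"
      using B0(1) by (intro subspace_sum subspace_scale subspace_derived) auto
    finally show ?thesis .
  qed
  have sp: "spans_mod_derived d b"
    unfolding spans_mod_derived_def
  proof
    fix x
    show "\<exists>c. x - (\<Sum>i<d. c i *s b i) \<in> derived"
      by (rule exI[of _ "\<lambda>i. \<pi> i x"]) (rule span)
  qed
  have pi_sum: "\<pi> j (\<Sum>i\<in>I. c i *s b i) = (\<Sum>i\<in>I. c i * \<pi> j (b i))" for j c and I :: "nat set"
  proof (induction I rule: infinite_finite_induct)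
    case (insert i I)
    then show ?case by (simp add: add scale)
  qed (auto intro: der subspace_0[OF subspace_derived])
  have ind: "independent_mod_derived d b"
    unfolding independent_mod_derived_def
  proof (intro allI impI)
    fix c j assume c: "(\<Sum>i<d. c i *s b i) \<in> derived" and j: "j < d"
    have "0 = (\<Sum>i<d. c i * \<pi> j (b i))" using der[OF c] pi_sum by simp
    also have "\<dots> = (\<Sum>i<d. if i = j then c j else 0)"
      using j by (intro sum.cong) (auto simp: dual)
    also have "\<dots> = c j" using j by simp
    finally show "c j = 0" by simp
  qed
  \<comment> \<open>The definite description is well defined: of two such families each is
    independent and the other spans, which bounds the lengths both ways.\<close>
  have dim: "abelianization_dim = d"
    unfolding abelianization_dim_def abelianization_dim_props
  proof (rule the_equality)
    show "\<exists>b. spans_mod_derived d b \<and> independent_mod_derived d b" using sp ind by blast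
    show "d' = d" if ex: "\<exists>b. spans_mod_derived d' b \<and> independent_mod_derived d' b" for d'
    proof -
      obtain b' where "spans_mod_derived d' b'" "independent_mod_derived d' b'" using ex by blast
      then show ?thesis
        using independent_le_spans_mod_derived[OF ind] independent_le_spans_mod_derived[OF _ sp]
        by (intro le_antisym) blast+
    qed
  qed
  show ?thesis
    unfolding dim
    by (intro exI[of _ b] exI[of _ \<pi>] conjI allI ballI impI add scale der dual span)
qed

end

section \<open>Representations of nilpotent Lie algebras are triangularizable\<close>

text \<open>Horner evaluation of \<open>p(A) v\<close>.\<close>

definition poly_act :: "complex mat \<Rightarrow> complex vec \<Rightarrow> complex poly \<Rightarrow> complex vec" where
  "poly_act A v p = fold_coeffs (\<lambda>a u. a \<cdot>\<^sub>v v + A *\<^sub>v u) p (0\<^sub>v (dim_vec v))"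

context
  fixes A :: "complex mat" and v :: "complex vec" and n :: nat
  assumes A: "A \<in> carrier_mat n n" and v: "v \<in> carrier_vec n"
begin

lemma poly_act_0 [simp]: "poly_act A v 0 = 0\<^sub>v n"
  using v by (simp add: poly_act_def)

lemma poly_act_pCons: "poly_act A v (pCons a p) = a \<cdot>\<^sub>v v + A *\<^sub>v poly_act A v p"
proof (cases "a = 0 \<and> p = 0")
  case True
  then show ?thesis using A v by (auto intro!: eq_vecI simp: poly_act_def)
next
  case False
  then show ?thesis by (auto simp: poly_act_def)
qed

lemma poly_act_carrier [simp]: "poly_act A v p \<in> carrier_vec n"
  using A v by (induction p) (auto simp: poly_act_pCons)

lemma dim_poly_act [simp]: "dim_vec (poly_act A v p) = n"
  using poly_act_carrier by (rule carrier_vecD)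

lemma poly_act_add: "poly_act A v (p + q) = poly_act A v p + poly_act A v q"
proof (induction p q rule: poly_induct2)
  case (pCons a p b q)
  have "poly_act A v (pCons a p + pCons b q)
      = (a + b) \<cdot>\<^sub>v v + (A *\<^sub>v poly_act A v p + A *\<^sub>v poly_act A v q)"
    using pCons mult_add_distrib_mat_vec[OF A] by (simp add: poly_act_pCons)
  then show ?case
    using A v by (auto intro!: eq_vecI simp: poly_act_pCons algebra_simps)
qed simp

lemma poly_act_smult: "poly_act A v (smult c p) = c \<cdot>\<^sub>v poly_act A v p"
proof (induction p)
  case 0
  show ?case by (auto intro!: eq_vecI)
next
  case (pCons a p)
  have "poly_act A v (smult c (pCons a p)) = (c * a) \<cdot>\<^sub>v v + c \<cdot>\<^sub>v (A *\<^sub>v poly_act A v p)"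
    using pCons mult_mat_vec[OF A] by (simp add: poly_act_pCons)
  then show ?case using A v by (auto intro!: eq_vecI simp: poly_act_pCons algebra_simps)
qed

lemma poly_act_linear_factor:
  "poly_act A v ([:- b, 1:] * q) = A *\<^sub>v poly_act A v q - b \<cdot>\<^sub>v poly_act A v q"
proof -
  have "[:- b, 1:] * q = smult (- b) q + pCons 0 q" by simp
  then have "poly_act A v ([:- b, 1:] * q)
      = (- b) \<cdot>\<^sub>v poly_act A v q + (0 \<cdot>\<^sub>v v + A *\<^sub>v poly_act A v q)"
    by (simp only: poly_act_add poly_act_smult poly_act_pCons)
  then show ?thesis using A v by (auto intro!: eq_vecI)
qed

text \<open>The \<open>n + 1\<close> vectors \<open>v\<close>, \<open>A v\<close>, ...,
  \<open>A^n v\<close> are dependent in \<open>C^n\<close>. Annihilating the single vector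
  \<open>v\<close> is enough below, so this takes the place of the characteristic
  polynomial.\<close>

lemma ex_annihilating_poly: "\<exists>p. p \<noteq> 0 \<and> poly_act A v p = 0\<^sub>v n"
proof -
  define w where "w r = ((\<lambda>u. A *\<^sub>v u) ^^ r) v" for r
  have w: "w r \<in> carrier_vec n" for r
    unfolding w_def using A v by (induction r) auto
  then have dim_w: "dim_vec (w r) = n" for r by (rule carrier_vecD)
  obtain c where c: "\<exists>r\<le>n. c r \<noteq> 0" "\<forall>k<n. (\<Sum>r\<le>n. c r * w r $ k) = 0"
    using ex_linear_relation[of n "\<lambda>r k. w r $ k"] by blast
  have mon: "poly_act A v (monom a r) = a \<cdot>\<^sub>v w r" for a r
  proof (induction r)
    case 0
    show ?case using A v by (auto intro!: eq_vecI simp: monom_0 poly_act_pCons w_def)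
  next
    case (Suc r)
    have "poly_act A v (monom a (Suc r)) = 0 \<cdot>\<^sub>v v + a \<cdot>\<^sub>v (A *\<^sub>v w r)"
      using Suc mult_mat_vec[OF A w] by (simp add: monom_Suc poly_act_pCons)
    then show ?case using A v by (auto intro!: eq_vecI simp: w_def)
  qed
  define p where "p = (\<Sum>r\<le>n. monom (c r) r)"
  have "poly_act A v (\<Sum>r\<le>m. monom (c r) r) $ k = (\<Sum>r\<le>m. c r * w r $ k)" if "k < n" for m k
    using that by (induction m) (simp_all add: poly_act_add mon dim_w)
  then have "poly_act A v p = 0\<^sub>v n"
    using c(2) by (auto intro!: eq_vecI simp: p_def)
  moreover have "p \<noteq> 0"
  proof -
    obtain r where r: "r \<le> n" "c r \<noteq> 0" using c(1) by blast
    have "coeff p r = (\<Sum>s\<le>n. if s = r then c s else 0)" by (simp add: p_def coeff_sum)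
    also have "\<dots> = c r" using r(1) by simp
    finally show ?thesis using r(2) by auto
  qed
  ultimately show ?thesis by blast
qed

end

section \<open>Eigenvectors in invariant subspaces\<close>

definition nonzero_subspace :: "nat \<Rightarrow> complex vec set \<Rightarrow> bool" where
  "nonzero_subspace n W \<longleftrightarrow> W \<subseteq> carrier_vec n \<and> (\<exists>w\<in>W. w \<noteq> 0\<^sub>v n) \<and>
     (\<forall>v\<in>W. \<forall>w\<in>W. v + w \<in> W) \<and> (\<forall>c. \<forall>w\<in>W. c \<cdot>\<^sub>v w \<in> W)"

lemma nonzero_subspaceD:
  assumes "nonzero_subspace n W"
  shows "w \<in> W \<Longrightarrow> w \<in> carrier_vec n" "\<exists>w\<in>W. w \<noteq> 0\<^sub>v n"
    "v \<in> W \<Longrightarrow> w \<in> W \<Longrightarrow> v + w \<in> W" "w \<in> W \<Longrightarrow> c \<cdot>\<^sub>v w \<in> W"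
  using assms unfolding nonzero_subspace_def by blast+

lemma poly_act_mem:
  assumes A: "A \<in> carrier_mat n n" and W: "nonzero_subspace n W"
    and inv: "\<And>w. w \<in> W \<Longrightarrow> A *\<^sub>v w \<in> W" and v: "v \<in> W"
  shows "poly_act A v p \<in> W"
proof (induction p)
  case 0
  have "0 \<cdot>\<^sub>v v = 0\<^sub>v n" using nonzero_subspaceD(1)[OF W v] by auto
  then show ?case
    using nonzero_subspaceD(4)[OF W v, of 0] poly_act_0[OF A nonzero_subspaceD(1)[OF W v]] by simp
next
  case (pCons a p)
  then show ?case
    using nonzero_subspaceD(3,4)[OF W] v inv poly_act_pCons[OF A nonzero_subspaceD(1)[OF W v]]
    by simp
qed

text \<open>Strip linear factors off a polynomial annihilating a nonzero \<open>v\<close> in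
  \<open>W\<close>. The last vector before zero is an eigenvector, and it lies in \<open>W\<close>,
  being a polynomial in \<open>A\<close> applied to \<open>v\<close>. The annihilating polynomial
  comes from the ambient dimension, so \<open>W\<close> needs no basis.\<close>

lemma ex_eigenvector_in_subspace:
  assumes A: "A \<in> carrier_mat n n" and W: "nonzero_subspace n W"
    and inv: "\<And>w. w \<in> W \<Longrightarrow> A *\<^sub>v w \<in> W"
  shows "\<exists>\<mu>. \<exists>w\<in>W. w \<noteq> 0\<^sub>v n \<and> A *\<^sub>v w = \<mu> \<cdot>\<^sub>v w"
proof -
  obtain v where v: "v \<in> W" "v \<noteq> 0\<^sub>v n" using nonzero_subspaceD(2)[OF W] by blast
  note vn = nonzero_subspaceD(1)[OF W v(1)]
  obtain p where "p \<noteq> 0" "poly_act A v p = 0\<^sub>v n" using ex_annihilating_poly[OF A vn] by blast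
  then show ?thesis
  proof (induction "degree p" arbitrary: p)
    case 0
    then obtain a where a: "p = [:a:]" "a \<noteq> 0" by (metis degree_eq_zeroE pCons_0_0)
    have "A *\<^sub>v 0\<^sub>v n = 0\<^sub>v n" using A by auto
    then have "a \<cdot>\<^sub>v v = 0\<^sub>v n"
      using 0(3) vn by (simp add: a poly_act_pCons[OF A vn] poly_act_0[OF A vn])
    then have "(1 / a) \<cdot>\<^sub>v (a \<cdot>\<^sub>v v) = 0\<^sub>v n" by auto
    then have "v = 0\<^sub>v n" using a(2) by (simp add: smult_smult_assoc)
    then show ?case using v(2) by simp
  next
    case (Suc d)
    have "\<not> constant (poly p)" using Suc(2) by (simp add: constant_degree)
    then obtain b where "poly p b = 0" using fundamental_theorem_of_algebra by blast
    then obtain q where q: "p = [:-b, 1:] * q" by (metis poly_eq_0_iff_dvd dvdE)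
    then have q0: "q \<noteq> 0" using Suc(3) by auto
    then have d: "d = degree q"
      using Suc(2) q degree_mult_eq[of "[:-b, 1:]" q] by simp
    show ?case
    proof (cases "poly_act A v q = 0\<^sub>v n")
      case True
      then show ?thesis using Suc(1)[OF d q0] by blast
    next
      case False
      let ?w = "poly_act A v q"
      have w: "?w \<in> W" by (rule poly_act_mem[OF A W inv v(1)])
      have "A *\<^sub>v ?w - b \<cdot>\<^sub>v ?w = 0\<^sub>v n"
        using Suc(4) unfolding q poly_act_linear_factor[OF A vn] .
      then have "A *\<^sub>v ?w = b \<cdot>\<^sub>v ?w"
        using A nonzero_subspaceD(1)[OF W w] by (simp add: vec_eq_iff)
      then show ?thesis using w False by blast
    qed
  qed
qed

text \<open>For an eigenvector \<open>u\<close> of \<open>K\<close>, the relation \<open>K X = X K + c\<close> gives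
  \<open>(K - \<mu>) p(X) u = c p'(X) u\<close>, so an annihilating polynomial of \<open>u\<close> can be differentiated
  down to a nonzero constant unless \<open>c = 0\<close>.\<close>

lemma scalar_commutator_zero:
  assumes X: "X \<in> carrier_mat n n" and K: "K \<in> carrier_mat n n" and W: "nonzero_subspace n W"
    and invX: "\<And>w. w \<in> W \<Longrightarrow> X *\<^sub>v w \<in> W" and invK: "\<And>w. w \<in> W \<Longrightarrow> K *\<^sub>v w \<in> W"
    and comm: "\<And>w. w \<in> W \<Longrightarrow> K *\<^sub>v (X *\<^sub>v w) = X *\<^sub>v (K *\<^sub>v w) + c \<cdot>\<^sub>v w"
  shows "c = 0"
proof (rule ccontr)
  assume c: "c \<noteq> 0"
  obtain \<mu> u where u: "u \<in> W" "u \<noteq> 0\<^sub>v n" "K *\<^sub>v u = \<mu> \<cdot>\<^sub>v u"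
    using ex_eigenvector_in_subspace[OF K W invK] by blast
  note un = nonzero_subspaceD(1)[OF W u(1)]
  note act = poly_act_carrier[OF X un]
  have shift: "K *\<^sub>v poly_act X u p = \<mu> \<cdot>\<^sub>v poly_act X u p + c \<cdot>\<^sub>v poly_act X u (pderiv p)" for p
  proof (induction p)
    case 0
    have "K *\<^sub>v 0\<^sub>v n = 0\<^sub>v n" using K by auto
    then show ?case by (auto intro!: eq_vecI simp: poly_act_0[OF X un])
  next
    case (pCons a p)
    let ?p = "poly_act X u p" and ?d = "poly_act X u (pderiv p)"
    have "K *\<^sub>v poly_act X u (pCons a p) = a \<cdot>\<^sub>v (\<mu> \<cdot>\<^sub>v u) + K *\<^sub>v (X *\<^sub>v ?p)"
      using u(3) X un act[of p]
      by (simp add: poly_act_pCons[OF X un] mult_add_distrib_mat_vec[OF K] mult_mat_vec[OF K])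
    also have "K *\<^sub>v (X *\<^sub>v ?p) = X *\<^sub>v (K *\<^sub>v ?p) + c \<cdot>\<^sub>v ?p"
      by (rule comm[OF poly_act_mem[OF X W invX u(1)]])
    also have "X *\<^sub>v (K *\<^sub>v ?p) = \<mu> \<cdot>\<^sub>v (X *\<^sub>v ?p) + c \<cdot>\<^sub>v (X *\<^sub>v ?d)"
      unfolding pCons.IH using act[of p] act[of "pderiv p"]
      by (simp add: mult_add_distrib_mat_vec[OF X] mult_mat_vec[OF X])
    finally have "K *\<^sub>v poly_act X u (pCons a p)
        = a \<cdot>\<^sub>v (\<mu> \<cdot>\<^sub>v u) + (\<mu> \<cdot>\<^sub>v (X *\<^sub>v ?p) + c \<cdot>\<^sub>v (X *\<^sub>v ?d) + c \<cdot>\<^sub>v ?p)" .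
    also have "\<dots> = \<mu> \<cdot>\<^sub>v (a \<cdot>\<^sub>v u + X *\<^sub>v ?p) + c \<cdot>\<^sub>v (?p + (0 \<cdot>\<^sub>v u + X *\<^sub>v ?d))"
      using X un carrier_vecD[OF act[of p]] carrier_vecD[OF act[of "pderiv p"]]
      by (intro eq_vecI) (auto simp: distrib_left mult.left_commute simp del: index_mult_mat_vec)
    finally show ?case
      by (simp add: pderiv_pCons poly_act_add[OF X un] poly_act_pCons[OF X un])
  qed
  obtain p where "p \<noteq> 0" "poly_act X u p = 0\<^sub>v n" using ex_annihilating_poly[OF X un] by blast
  then show False
  proof (induction "degree p" arbitrary: p)
    case 0
    then obtain a where a: "p = [:a:]" "a \<noteq> 0" by (metis degree_eq_zeroE pCons_0_0)
    have "X *\<^sub>v 0\<^sub>v n = 0\<^sub>v n" using X by auto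
    then have "a \<cdot>\<^sub>v u = 0\<^sub>v n"
      using 0(3) un by (simp add: a poly_act_pCons[OF X un] poly_act_0[OF X un])
    then have "(1 / a) \<cdot>\<^sub>v (a \<cdot>\<^sub>v u) = 0\<^sub>v n" by auto
    then have "u = 0\<^sub>v n" using a(2) by (simp add: smult_smult_assoc)
    then show ?case using u(2) by simp
  next
    case (Suc d)
    let ?d = "poly_act X u (pderiv p)"
    \<comment> \<open>In characteristic 0 the derivative of a polynomial of positive degree is
      nonzero and its degree drops by exactly one.\<close>
    have d: "d = degree (pderiv p)" "pderiv p \<noteq> 0"
      using Suc(2) by (auto simp: degree_pderiv pderiv_eq_0_iff)
    have "K *\<^sub>v 0\<^sub>v n = 0\<^sub>v n" "\<mu> \<cdot>\<^sub>v 0\<^sub>v n = 0\<^sub>v n" using K by auto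
    then have "0\<^sub>v n + c \<cdot>\<^sub>v ?d = 0\<^sub>v n" using shift[of p] Suc(4) by simp
    then have "(1 / c) \<cdot>\<^sub>v (c \<cdot>\<^sub>v ?d) = 0\<^sub>v n" using act[of "pderiv p"] by auto
    then have "?d = 0\<^sub>v n" using c by (simp add: smult_smult_assoc)
    then show ?case using Suc(1)[OF d] by blast
  qed
qed

lemma lie_homsD:
  assumes "\<rho> \<in> lie_homs scale bracket n"
  shows "\<rho> x \<in> carrier_mat n n" "\<rho> (x + y) = \<rho> x + \<rho> y" "\<rho> (scale c x) = c \<cdot>\<^sub>m \<rho> x"
    "\<rho> (bracket x y) = \<rho> x * \<rho> y - \<rho> y * \<rho> x"
  using assms unfolding lie_homs_def by blast+

context lie_algebra
begin

text \<open>Going up the lower central series: if every \<open>[x, y]\<close> acts by a scalar on an invariant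
  subspace, that scalar is \<open>0\<close>, so \<open>y\<close> commutes with the action and its eigenspaces are again
  invariant.\<close>

lemma ex_common_eigenvector:
  assumes fd: "finite_dimensional" and nil: "nilpotent"
    and \<rho>: "\<rho> \<in> lie_homs scale bracket n" and n: "n > 0"
  shows "\<exists>v \<kappa>. v \<in> carrier_vec n \<and> v \<noteq> 0\<^sub>v n \<and> (\<forall>x. \<rho> x *\<^sub>v v = \<kappa> x \<cdot>\<^sub>v v)"
proof -
  note \<rho>c = lie_homsD(1)[OF \<rho>]
  define stable where "stable W \<longleftrightarrow> nonzero_subspace n W \<and> (\<forall>x. \<forall>w\<in>W. \<rho> x *\<^sub>v w \<in> W)" for W
  define sc where "sc W y \<longleftrightarrow> (\<exists>c. \<forall>w\<in>W. \<rho> y *\<^sub>v w = c \<cdot>\<^sub>v w)" for W y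
  have sc_subspace: "subspace {y. sc W y}" if W: "stable W" for W
  proof (rule subspaceI)
    have wn: "w \<in> carrier_vec n" if "w \<in> W" for w
      using W that nonzero_subspaceD(1) unfolding stable_def by blast
    have "\<rho> 0 = 0 \<cdot>\<^sub>m \<rho> 0" using lie_homsD(3)[OF \<rho>, of 0 0] by simp
    also have "\<dots> = 0\<^sub>m n n" using \<rho>c[of 0] by (intro eq_matI) auto
    finally have "\<rho> 0 = 0\<^sub>m n n" .
    then have "\<rho> 0 *\<^sub>v w = 0 \<cdot>\<^sub>v w" if "w \<in> W" for w
      using wn[OF that] by auto
    then show "0 \<in> {y. sc W y}" unfolding sc_def by blast
    show "x + y \<in> {y. sc W y}" if x: "x \<in> {y. sc W y}" and y: "y \<in> {y. sc W y}" for x y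
    proof -
      obtain a where a: "\<forall>w\<in>W. \<rho> x *\<^sub>v w = a \<cdot>\<^sub>v w" using x unfolding sc_def by blast
      obtain b where b: "\<forall>w\<in>W. \<rho> y *\<^sub>v w = b \<cdot>\<^sub>v w" using y unfolding sc_def by blast
      have "\<rho> (x + y) *\<^sub>v w = (a + b) \<cdot>\<^sub>v w" if "w \<in> W" for w
        using a b that add_mult_distrib_mat_vec[OF \<rho>c \<rho>c wn[OF that]]
        by (simp add: lie_homsD(2)[OF \<rho>] add_smult_distrib_vec)
      then show ?thesis unfolding sc_def by blast
    qed
    show "scale a x \<in> {y. sc W y}" if x: "x \<in> {y. sc W y}" for a x
    proof -
      obtain b where b: "\<forall>w\<in>W. \<rho> x *\<^sub>v w = b \<cdot>\<^sub>v w" using x unfolding sc_def by blast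
      have "\<rho> (scale a x) *\<^sub>v w = (a * b) \<cdot>\<^sub>v w" if "w \<in> W" for w
      proof -
        have "(a \<cdot>\<^sub>m \<rho> x) *\<^sub>v w = a \<cdot>\<^sub>v (\<rho> x *\<^sub>v w)"
          using \<rho>c[of x] wn[OF that] by (auto intro!: eq_vecI)
        then show ?thesis using b that by (simp add: lie_homsD(3)[OF \<rho>] smult_smult_assoc)
      qed
      then show ?thesis unfolding sc_def by blast
    qed
  qed
  obtain S where S: "finite S" "span S = UNIV" using fd unfolding finite_dimensional_def by blast
  have step: "\<exists>W. stable W \<and> (\<forall>y\<in>lower_central i. sc W y)"
    if IH: "\<exists>W. stable W \<and> (\<forall>y\<in>lower_central (Suc i). sc W y)" for i
  proof -
    obtain W where W: "stable W" "\<forall>y\<in>lower_central (Suc i). sc W y" using IH by blast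
    have Wn: "nonzero_subspace n W" and WX: "\<And>x w. w \<in> W \<Longrightarrow> \<rho> x *\<^sub>v w \<in> W"
      using W(1) unfolding stable_def by auto
    have comm: "\<rho> y *\<^sub>v (\<rho> x *\<^sub>v w) = \<rho> x *\<^sub>v (\<rho> y *\<^sub>v w)"
      if y: "y \<in> lower_central i" and w: "w \<in> W" for x y w
    proof -
      have "bracket x y \<in> lower_central (Suc i)"
        using y by (auto intro: span_base)
      then obtain c where c: "\<forall>w\<in>W. \<rho> (bracket x y) *\<^sub>v w = c \<cdot>\<^sub>v w"
        using W(2) unfolding sc_def by blast
      have eq: "\<rho> y *\<^sub>v (\<rho> x *\<^sub>v w) = \<rho> x *\<^sub>v (\<rho> y *\<^sub>v w) + (- c) \<cdot>\<^sub>v w" if w: "w \<in> W" for w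
      proof -
        have wn: "w \<in> carrier_vec n" using nonzero_subspaceD(1)[OF Wn w] .
        have "c \<cdot>\<^sub>v w = (\<rho> x * \<rho> y - \<rho> y * \<rho> x) *\<^sub>v w"
          using c w lie_homsD(4)[OF \<rho>, of x y] by simp
        also have "\<dots> = (\<rho> x * \<rho> y) *\<^sub>v w - (\<rho> y * \<rho> x) *\<^sub>v w"
          by (rule minus_mult_distrib_mat_vec[OF mult_carrier_mat mult_carrier_mat]) (fact \<rho>c wn)+
        also have "\<dots> = \<rho> x *\<^sub>v (\<rho> y *\<^sub>v w) - \<rho> y *\<^sub>v (\<rho> x *\<^sub>v w)"
          using assoc_mult_mat_vec[OF \<rho>c \<rho>c wn] by simp
        finally have *: "c \<cdot>\<^sub>v w = \<rho> x *\<^sub>v (\<rho> y *\<^sub>v w) - \<rho> y *\<^sub>v (\<rho> x *\<^sub>v w)" .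
        have dims: "dim_vec (\<rho> x *\<^sub>v z) = n" "dim_vec w = n" for x z using \<rho>c[of x] wn by auto
        have "c * w $ k = (\<rho> x *\<^sub>v (\<rho> y *\<^sub>v w)) $ k - (\<rho> y *\<^sub>v (\<rho> x *\<^sub>v w)) $ k" if "k < n" for k
          using arg_cong[OF *, of "\<lambda>z. z $ k"] that dims by (simp del: index_mult_mat_vec)
        then show ?thesis
          using dims by (intro eq_vecI) (simp_all del: index_mult_mat_vec add: algebra_simps)
      qed
      \<comment> \<open>Applied with \<open>K = \<rho> y\<close> and \<open>X = \<rho> x\<close>,
        for which \<open>\<rho> (bracket x y)\<close> is \<open>X K - K X\<close>; hence the
        sign.\<close>
      have "- c = 0"
        by (rule scalar_commutator_zero[OF \<rho>c \<rho>c Wn WX WX eq])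
      then have "c = 0" by simp
      moreover have "\<rho> x *\<^sub>v (\<rho> y *\<^sub>v w) \<in> carrier_vec n"
        using WX w nonzero_subspaceD(1)[OF Wn] by auto
      moreover have "0 \<cdot>\<^sub>v w = 0\<^sub>v n"
        using nonzero_subspaceD(1)[OF Wn w] by auto
      ultimately show ?thesis using eq[OF w] by simp
    qed
    \<comment> \<open>Eigenspaces are cut out for a finite basis only; acting by a scalar on a fixed
      stable subspace passes to linear combinations by \<open>sc_subspace\<close>.\<close>
    obtain B where B: "B \<subseteq> lower_central i" "independent B" "lower_central i \<subseteq> span B"
      by (rule maximal_independent_subset)
    have "finite B" using independent_span_bound[OF S(1) B(2)] S(2) by auto
    then have "\<exists>W'. W' \<subseteq> W \<and> stable W' \<and> (\<forall>y\<in>B. sc W' y)"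
      using B(1)
    proof (induction B)
      case empty
      then show ?case using W(1) by blast
    next
      case (insert b B)
      then obtain V where V: "V \<subseteq> W" "stable V" "\<forall>y\<in>B. sc V y" by auto
      have Vn: "nonzero_subspace n V" and VX: "\<And>x w. w \<in> V \<Longrightarrow> \<rho> x *\<^sub>v w \<in> V"
        using V(2) unfolding stable_def by auto
      obtain \<mu> u where u: "u \<in> V" "u \<noteq> 0\<^sub>v n" "\<rho> b *\<^sub>v u = \<mu> \<cdot>\<^sub>v u"
        using ex_eigenvector_in_subspace[OF \<rho>c Vn VX] by blast
      define V' where "V' = {w \<in> V. \<rho> b *\<^sub>v w = \<mu> \<cdot>\<^sub>v w}"
      have Vc: "w \<in> carrier_vec n" if "w \<in> V" for w using nonzero_subspaceD(1)[OF Vn that] .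
      have "nonzero_subspace n V'"
        unfolding nonzero_subspace_def
      proof (intro conjI ballI allI)
        show "V' \<subseteq> carrier_vec n" using Vc unfolding V'_def by blast
        show "\<exists>w\<in>V'. w \<noteq> 0\<^sub>v n" using u unfolding V'_def by blast
        show "v + w \<in> V'" if "v \<in> V'" "w \<in> V'" for v w
          using that nonzero_subspaceD(3)[OF Vn] mult_add_distrib_mat_vec[OF \<rho>c Vc Vc]
            smult_add_distrib_vec[OF Vc Vc] unfolding V'_def by simp
        show "c \<cdot>\<^sub>v w \<in> V'" if "w \<in> V'" for c w
          using that nonzero_subspaceD(4)[OF Vn] Vc mult_mat_vec[OF \<rho>c]
          unfolding V'_def by (auto simp: smult_smult_assoc mult.commute)
      qed
      moreover have "\<rho> x *\<^sub>v w \<in> V'" if w: "w \<in> V'" for x w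
      proof -
        have "\<rho> b *\<^sub>v (\<rho> x *\<^sub>v w) = \<rho> x *\<^sub>v (\<rho> b *\<^sub>v w)"
          using comm[of b w x] insert.prems V(1) w unfolding V'_def by blast
        also have "\<dots> = \<mu> \<cdot>\<^sub>v (\<rho> x *\<^sub>v w)"
          using w Vc mult_mat_vec[OF \<rho>c] unfolding V'_def by auto
        finally show ?thesis using w VX unfolding V'_def by blast
      qed
      ultimately have "stable V'" unfolding stable_def by blast
      moreover have "sc V' y" if "y \<in> insert b B" for y
      proof (cases "y = b")
        case True
        then show ?thesis unfolding sc_def V'_def by blast
      next
        case False
        then have "sc V y" using that V(3) by blast
        then show ?thesis unfolding sc_def V'_def by blast
      qed
      moreover have "V' \<subseteq> W" using V(1) unfolding V'_def by blast
      ultimately show ?case by blast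
    qed
    then obtain W' where W': "stable W'" "\<forall>y\<in>B. sc W' y" by blast
    have "span B \<subseteq> {y. sc W' y}"
      using W' by (intro span_minimal sc_subspace) auto
    then show ?thesis using W'(1) B(3) by blast
  qed
  obtain k where k: "lower_central k = {0}" using nil unfolding nilpotent_def by blast
  have full: "stable (carrier_vec n)"
    unfolding stable_def nonzero_subspace_def
  proof (intro conjI ballI allI)
    show "\<exists>w\<in>carrier_vec n. w \<noteq> (0\<^sub>v n :: complex vec)"
    proof (rule bexI[where x = "unit_vec n 0 :: complex vec"])
      have "unit_vec n 0 $ 0 = (1 :: complex)" using n by simp
      then show "unit_vec n 0 \<noteq> (0\<^sub>v n :: complex vec)"
        using n by (metis index_zero_vec(1) zero_neq_one)
    qed simp
  qed (auto intro: mult_mat_vec_carrier[OF \<rho>c])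
  \<comment> \<open>Start with the whole space at the vanishing term \<open>lower_central k\<close>
    and descend to index 0, where the term is the full algebra and every element acts on
    \<open>W\<close> by a scalar.\<close>
  have "\<exists>W. stable W \<and> (\<forall>y\<in>lower_central (k - i). sc W y)" for i
  proof (induction i)
    case 0
    have "0 \<in> {y. sc (carrier_vec n) y}" by (rule subspace_0[OF sc_subspace[OF full]])
    then show ?case using full k by auto
  next
    case (Suc i)
    show ?case
    proof (cases "k - i")
      case 0
      then show ?thesis using Suc by simp
    next
      case (Suc j)
      then have "k - Suc i = j" by simp
      then show ?thesis using step[of j] Suc.IH Suc by simp
    qed
  qed
  from this[of k] obtain W where W: "stable W" "\<And>y. sc W y" by auto
  then obtain v where v: "v \<in> W" "v \<noteq> 0\<^sub>v n" unfolding stable_def nonzero_subspace_def by blast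
  have "v \<in> carrier_vec n" using W(1) v(1) unfolding stable_def nonzero_subspace_def by blast
  moreover have "\<forall>x. \<exists>c. \<rho> x *\<^sub>v v = c \<cdot>\<^sub>v v" using W(2) v(1) unfolding sc_def by blast
  ultimately show ?thesis using v(2) by metis
qed

end

section \<open>Simultaneous triangularization\<close>

lemma ex_invertible_first_col:
  fixes v :: "complex vec"
  assumes v: "v \<in> carrier_vec m" "v \<noteq> 0\<^sub>v m" and m: "0 < m"
  shows "\<exists>P Q. P \<in> carrier_mat m m \<and> Q \<in> carrier_mat m m \<and> P * Q = 1\<^sub>m m \<and> Q * P = 1\<^sub>m m \<and> col P 0 = v"
proof -
  interpret vec_space "TYPE(complex)" m .
  define ws where "ws = basis_completion v"
  note ws = basis_completion[OF v, folded ws_def]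
  define P where "P = mat_of_cols m ws"
  have P: "P \<in> carrier_mat m m" using ws(6) by (auto simp: P_def)
  have cols: "cols P = ws" using ws(2) by (simp add: P_def)
  have "rank P = m"
    using lin_indpt_full_rank[OF P] ws(4,5) by (simp add: cols)
  then have "det P \<noteq> 0" using det_rank_iff[OF P] by simp
  then have "P \<in> Units (gl_ring m)" by (rule det_non_zero_imp_unit[OF P])
  then obtain Q where "Q \<in> carrier_mat m m" "P * Q = 1\<^sub>m m" "Q * P = 1\<^sub>m m"
    by (auto simp: Units_def ring_mat_simps)
  moreover have "col P 0 = v"
    using ws(2,6,7) m by (cases ws) (auto simp: P_def)
  ultimately show ?thesis using P by blast
qed

lemma similar_lie_homs:
  assumes \<rho>: "\<rho> \<in> lie_homs scale bracket n"
    and P: "P \<in> carrier_mat n n" and Q: "Q \<in> carrier_mat n n" and PQ: "P * Q = 1\<^sub>m n"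
  shows "(\<lambda>x. Q * \<rho> x * P) \<in> lie_homs scale bracket n"
proof -
  note \<rho>c = lie_homsD(1)[OF \<rho>]
  have prod: "(Q * A * P) * (Q * B * P) = Q * (A * B) * P"
    if A: "A \<in> carrier_mat n n" and B: "B \<in> carrier_mat n n" for A B
  proof -
    have "(Q * A * P) * (Q * B * P) = Q * A * (P * Q) * (B * P)"
      using P Q A B by (simp add: assoc_mult_mat[of _ n n _ n _ n])
    also have "\<dots> = Q * (A * B) * P"
      using P Q A B by (simp add: PQ assoc_mult_mat[of _ n n _ n _ n])
    finally show ?thesis .
  qed
  show ?thesis
    unfolding lie_homs_def
  proof (intro CollectI conjI allI)
    fix x y c
    show "Q * \<rho> x * P \<in> carrier_mat n n" using P Q \<rho>c by auto
    show "Q * \<rho> (x + y) * P = Q * \<rho> x * P + Q * \<rho> y * P"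
      using P Q \<rho>c[of x] \<rho>c[of y] unfolding lie_homsD(2)[OF \<rho>]
      by (simp add: mult_add_distrib_mat[of _ n n _ n] add_mult_distrib_mat[of _ n n _ _ n])
    show "Q * \<rho> (scale c x) * P = c \<cdot>\<^sub>m (Q * \<rho> x * P)"
      using P Q \<rho>c[of x] unfolding lie_homsD(3)[OF \<rho>]
      by (simp add: mult_smult_distrib[of _ n n _ n] mult_smult_assoc_mat[of _ n n _ n])
    show "Q * \<rho> (bracket x y) * P
        = (Q * \<rho> x * P) * (Q * \<rho> y * P) - (Q * \<rho> y * P) * (Q * \<rho> x * P)"
      using P Q \<rho>c[of x] \<rho>c[of y] unfolding lie_homsD(4)[OF \<rho>] prod[OF \<rho>c \<rho>c]
      by (simp add: mult_minus_distrib_mat[of _ n n _ n] minus_mult_distrib_mat[of _ n n _ _ n])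
  qed
qed

text \<open>The lower right block is the action on the quotient by the line of the first basis
  vector. The zeros in the first column make that line invariant and remove the cross term from
  products of blocks.\<close>

lemma lie_homs_lower_block:
  assumes \<sigma>: "\<sigma> \<in> lie_homs scale bracket (Suc n)"
    and col0: "\<And>x i. i < n \<Longrightarrow> \<sigma> x $$ (Suc i, 0) = 0"
  shows "(\<lambda>x. mat n n (\<lambda>(i, j). \<sigma> x $$ (Suc i, Suc j))) \<in> lie_homs scale bracket n"
proof -
  note \<sigma>c = lie_homsD(1)[OF \<sigma>]
  have prod: "(\<sigma> x * \<sigma> y) $$ (Suc i, Suc j)
      = (mat n n (\<lambda>(i, j). \<sigma> x $$ (Suc i, Suc j)) * mat n n (\<lambda>(i, j). \<sigma> y $$ (Suc i, Suc j))) $$ (i, j)"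
    if "i < n" "j < n" for x y i j
  proof -
    have "(\<sigma> x * \<sigma> y) $$ (Suc i, Suc j) = (\<Sum>k<Suc n. \<sigma> x $$ (Suc i, k) * \<sigma> y $$ (k, Suc j))"
      using that \<sigma>c[of x] \<sigma>c[of y] by (simp add: scalar_prod_def atLeast0LessThan)
    also have "\<dots> = (\<Sum>k<n. \<sigma> x $$ (Suc i, Suc k) * \<sigma> y $$ (Suc k, Suc j))"
      unfolding sum.lessThan_Suc_shift using that by (simp add: col0)
    finally show ?thesis using that by (simp add: scalar_prod_def atLeast0LessThan)
  qed
  show ?thesis
    unfolding lie_homs_def
  proof (intro CollectI conjI allI)
    fix x y c
    let ?D = "\<lambda>x. mat n n (\<lambda>(i, j). \<sigma> x $$ (Suc i, Suc j))"
    show "?D x \<in> carrier_mat n n" by simp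
    show "?D (x + y) = ?D x + ?D y"
      using \<sigma>c[of x] \<sigma>c[of y] by (intro eq_matI) (auto simp: lie_homsD(2)[OF \<sigma>])
    show "?D (scale c x) = c \<cdot>\<^sub>m ?D x"
      using \<sigma>c[of x] by (intro eq_matI) (auto simp: lie_homsD(3)[OF \<sigma>])
    show "?D (bracket x y) = ?D x * ?D y - ?D y * ?D x"
    proof (intro eq_matI)
      fix i j assume "i < dim_row (?D x * ?D y - ?D y * ?D x)" "j < dim_col (?D x * ?D y - ?D y * ?D x)"
      then have ij: "i < n" "j < n" by auto
      have "?D (bracket x y) $$ (i, j) = (\<sigma> x * \<sigma> y) $$ (Suc i, Suc j) - (\<sigma> y * \<sigma> x) $$ (Suc i, Suc j)"
        using ij \<sigma>c[of x] \<sigma>c[of y] by (simp add: lie_homsD(4)[OF \<sigma>] del: index_mult_mat(1))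
      also have "\<dots> = (?D x * ?D y - ?D y * ?D x) $$ (i, j)"
        unfolding prod[OF ij] using ij by (simp del: index_mult_mat(1))
      finally show "?D (bracket x y) $$ (i, j) = (?D x * ?D y - ?D y * ?D x) $$ (i, j)" .
    qed auto
  qed
qed

context lie_algebra
begin

text \<open>A common eigenvector becomes the first basis vector, and the induction hypothesis
  triangularizes the quotient by it. One pair \<open>P\<close>, \<open>Q\<close> has to serve all
  \<open>x\<close>, which is why the eigenvector must be common.\<close>

lemma ex_triangularization:
  assumes fd: "finite_dimensional" and nil: "nilpotent" and \<rho>: "\<rho> \<in> lie_homs scale bracket n"
  shows "\<exists>P Q. P \<in> carrier_mat n n \<and> Q \<in> carrier_mat n n \<and> P * Q = 1\<^sub>m n \<and> Q * P = 1\<^sub>m n \<and>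
    (\<forall>x. upper_triangular (Q * \<rho> x * P))"
  using \<rho>
proof (induction n arbitrary: \<rho>)
  case 0
  show ?case by (intro exI[of _ "1\<^sub>m 0"]) (auto simp: upper_triangular_def)
next
  case (Suc n)
  let ?m = "Suc n"
  note \<rho>c = lie_homsD(1)[OF Suc.prems]
  obtain v \<kappa> where v: "v \<in> carrier_vec ?m" "v \<noteq> 0\<^sub>v ?m" "\<And>x. \<rho> x *\<^sub>v v = \<kappa> x \<cdot>\<^sub>v v"
    using ex_common_eigenvector[OF fd nil Suc.prems] by auto
  obtain P1 Q1 where P1: "P1 \<in> carrier_mat ?m ?m" and Q1: "Q1 \<in> carrier_mat ?m ?m"
    and PQ1: "P1 * Q1 = 1\<^sub>m ?m" and QP1: "Q1 * P1 = 1\<^sub>m ?m" and col1: "col P1 0 = v"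
    using ex_invertible_first_col[OF v(1,2)] by auto
  define \<sigma> where "\<sigma> x = Q1 * \<rho> x * P1" for x
  have \<sigma>: "\<sigma> \<in> lie_homs scale bracket ?m"
    using similar_lie_homs[OF Suc.prems P1 Q1 PQ1] by (simp add: \<sigma>_def[abs_def])
  note \<sigma>c = lie_homsD(1)[OF \<sigma>]
  have \<sigma>col: "\<sigma> x $$ (Suc i, 0) = 0" if "i < n" for x i
  proof -
    have "col (\<sigma> x) 0 = (Q1 * \<rho> x) *\<^sub>v v"
      using col_mult2[OF mult_carrier_mat[OF Q1 \<rho>c] P1, of 0] by (simp add: \<sigma>_def col1)
    also have "\<dots> = Q1 *\<^sub>v (\<kappa> x \<cdot>\<^sub>v v)"
      using \<rho>c[of x] Q1 v by (simp add: assoc_mult_mat_vec[of _ ?m ?m _ ?m])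
    also have "\<dots> = \<kappa> x \<cdot>\<^sub>v (Q1 *\<^sub>v col P1 0)"
      using mult_mat_vec[OF Q1 v(1)] by (simp add: col1)
    also have "Q1 *\<^sub>v col P1 0 = col (1\<^sub>m ?m) 0"
      using col_mult2[OF Q1 P1, of 0] by (simp add: QP1)
    finally have "col (\<sigma> x) 0 $ Suc i = (\<kappa> x \<cdot>\<^sub>v col (1\<^sub>m ?m) 0) $ Suc i" by simp
    then show ?thesis using that \<sigma>c[of x] by simp
  qed
  define A where "A x = mat 1 1 (\<lambda>_. \<sigma> x $$ (0, 0))" for x
  define B where "B x = mat 1 n (\<lambda>(i, j). \<sigma> x $$ (0, Suc j))" for x
  define D where "D x = mat n n (\<lambda>(i, j). \<sigma> x $$ (Suc i, Suc j))" for x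
  have ABD: "A x \<in> carrier_mat 1 1" "B x \<in> carrier_mat 1 n" "D x \<in> carrier_mat n n" for x
    by (auto simp: A_def B_def D_def)
  have block: "\<sigma> x = four_block_mat (A x) (B x) (0\<^sub>m n 1) (D x)" for x
  proof (intro eq_matI)
    fix i j
    assume "i < dim_row (four_block_mat (A x) (B x) (0\<^sub>m n 1) (D x))"
      "j < dim_col (four_block_mat (A x) (B x) (0\<^sub>m n 1) (D x))"
    then show "\<sigma> x $$ (i, j) = four_block_mat (A x) (B x) (0\<^sub>m n 1) (D x) $$ (i, j)"
      using \<sigma>col by (cases i; cases j) (auto simp: A_def B_def D_def)
  qed (use \<sigma>c[of x] in \<open>auto simp: A_def D_def\<close>)
  have "D \<in> lie_homs scale bracket n"
    using lie_homs_lower_block[OF \<sigma>] \<sigma>col by (simp add: D_def[abs_def])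
  then obtain P2 Q2 where P2: "P2 \<in> carrier_mat n n" and Q2: "Q2 \<in> carrier_mat n n"
    and PQ2: "P2 * Q2 = 1\<^sub>m n" and QP2: "Q2 * P2 = 1\<^sub>m n"
    and ut: "\<And>x. upper_triangular (Q2 * D x * P2)"
    using Suc.IH by blast
  \<comment> \<open>The change of basis of the quotient, extended by 1: it alters \<open>B x\<close>
    but keeps the eigenvalue and the zero block of the first column.\<close>
  define P3 where "P3 = four_block_mat (1\<^sub>m 1) (0\<^sub>m 1 n) (0\<^sub>m n 1) P2"
  define Q3 where "Q3 = four_block_mat (1\<^sub>m 1) (0\<^sub>m 1 n) (0\<^sub>m n 1) Q2"
  have P3: "P3 \<in> carrier_mat ?m ?m" and Q3: "Q3 \<in> carrier_mat ?m ?m"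
    using P2 Q2 four_block_carrier_mat[of "1\<^sub>m 1" 1 1] by (auto simp: P3_def Q3_def)
  have PQ3: "P3 * Q3 = 1\<^sub>m ?m"
    unfolding P3_def Q3_def
    by (subst mult_four_block_mat[of _ 1 1 _ n _ n _ _ 1 _ n]) (use P2 Q2 in \<open>auto simp: PQ2 four_block_one_mat[of 1 n, simplified]\<close>)
  have QP3: "Q3 * P3 = 1\<^sub>m ?m" using mat_mult_left_right_inverse[OF P3 Q3 PQ3] .
  have ut3: "upper_triangular (Q3 * \<sigma> x * P3)" for x
  proof -
    have "Q3 * \<sigma> x = four_block_mat (A x) (B x) (0\<^sub>m n 1) (Q2 * D x)"
      unfolding Q3_def block
      by (subst mult_four_block_mat[of _ 1 1 _ n _ n _ _ 1 _ n]) (use Q2 ABD[of x] in auto)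
    also have "\<dots> * P3 = four_block_mat (A x) (B x * P2) (0\<^sub>m n 1) (Q2 * D x * P2)"
      unfolding P3_def
      by (subst mult_four_block_mat[of _ 1 1 _ n _ n _ _ 1 _ n]) (use P2 Q2 ABD[of x] in auto)
    also have "upper_triangular \<dots>"
      by (rule upper_triangular_four_block[OF ABD(1) mult_carrier_mat[OF mult_carrier_mat[OF Q2 ABD(3)] P2] _ ut])
        (simp add: A_def upper_triangular_def)
    finally show ?thesis .
  qed
  have "P1 * P3 * (Q3 * Q1) = P1 * (P3 * Q3) * Q1"
    using P1 P3 Q1 Q3 by (simp add: assoc_mult_mat[of _ ?m ?m _ ?m _ ?m])
  then have 1: "P1 * P3 * (Q3 * Q1) = 1\<^sub>m ?m" using P1 by (simp add: PQ3 PQ1)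
  have "(Q3 * Q1) * \<rho> x * (P1 * P3) = Q3 * \<sigma> x * P3" for x
    using P1 P3 Q1 Q3 \<rho>c[of x] by (simp add: \<sigma>_def assoc_mult_mat[of _ ?m ?m _ ?m _ ?m])
  then have "upper_triangular ((Q3 * Q1) * \<rho> x * (P1 * P3))" for x using ut3 by simp
  moreover have PP: "P1 * P3 \<in> carrier_mat ?m ?m" "Q3 * Q1 \<in> carrier_mat ?m ?m"
    using P1 P3 Q1 Q3 by auto
  moreover have "(Q3 * Q1) * (P1 * P3) = 1\<^sub>m ?m"
    by (rule mat_mult_left_right_inverse[OF PP 1])
  ultimately show ?case using 1 by blast
qed

end

section \<open>Invariants of the variety of representations\<close>

lemma GL_iff:
  "g \<in> GL n \<longleftrightarrow> g \<in> carrier_mat n n \<and> (\<exists>h \<in> carrier_mat n n. g * h = 1\<^sub>m n \<and> h * g = 1\<^sub>m n)"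
  by (auto simp: GL_def Units_def ring_mat_simps)

lemma GL_inv:
  assumes "g \<in> carrier_mat n n" "h \<in> carrier_mat n n" "g * h = 1\<^sub>m n"
  shows "g \<in> GL n" "inv\<^bsub>gl_ring n\<^esub> g = h"
proof -
  have hg: "h * g = 1\<^sub>m n" using mat_mult_left_right_inverse assms by blast
  then show "g \<in> GL n" using assms GL_iff by blast
  interpret ring "gl_ring n" by (rule ring_mat)
  show "inv\<^bsub>gl_ring n\<^esub> g = h"
    by (rule inv_char) (use assms hg in \<open>auto simp: ring_mat_simps\<close>)
qed

lemma conjugation_eq:
  assumes "g \<in> carrier_mat n n" "h \<in> carrier_mat n n" "g * h = 1\<^sub>m n"
  shows "conjugation n g \<rho> = (\<lambda>x. g * \<rho> x * h)"
  using GL_inv(2)[OF assms] by (simp add: conjugation_def)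

lemma conjugation_lie_homs:
  assumes "g \<in> GL n" "\<rho> \<in> lie_homs scale bracket n"
  shows "conjugation n g \<rho> \<in> lie_homs scale bracket n"
proof -
  obtain h where "g \<in> carrier_mat n n" "h \<in> carrier_mat n n" "g * h = 1\<^sub>m n" "h * g = 1\<^sub>m n"
    using assms(1) GL_iff by blast
  then show ?thesis
    using similar_lie_homs[OF assms(2)] by (simp add: conjugation_eq)
qed

text \<open>The classes of \<open>b 0, \<dots>, b (l - 1)\<close> are a basis of the abelianization, with coordinate
  functionals \<open>\<pi>\<close>.\<close>

locale nilpotent_lie_algebra_coordinates = lie_algebra scale bracket
  for scale :: "complex \<Rightarrow> 'a::ab_group_add \<Rightarrow> 'a" (infixr \<open>*s\<close> 75) and bracket +
  fixes n l :: nat and b :: "nat \<Rightarrow> 'a" and \<pi> :: "nat \<Rightarrow> 'a \<Rightarrow> complex"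
  assumes fd: "finite_dimensional" and nil: "nilpotent"
    and pi_add: "\<pi> j (x + y) = \<pi> j x + \<pi> j y"
    and pi_scale: "\<pi> j (c *s x) = c * \<pi> j x"
    and pi_derived: "x \<in> derived \<Longrightarrow> \<pi> j x = 0"
    and pi_dual: "i < l \<Longrightarrow> j < l \<Longrightarrow> \<pi> j (b i) = of_bool (i = j)"
    and pi_span: "x - (\<Sum>i<l. \<pi> i x *s b i) \<in> derived"
begin

abbreviation reps :: "('a \<Rightarrow> complex mat) set" where
  "reps \<equiv> lie_homs scale bracket n"

definition entries :: "(('a \<Rightarrow> complex mat) \<Rightarrow> complex) set" where
  "entries = {\<lambda>\<rho>. \<rho> x $$ (i, j) | x i j. i < n \<and> j < n}"

text \<open>Invariance is asked only at representations, while the polynomials are defined on all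
  maps; two members may therefore agree on \<open>reps\<close> without being equal.\<close>

definition invs :: "(('a \<Rightarrow> complex mat) \<Rightarrow> complex) set" where
  "invs = {f \<in> poly_funs entries. \<forall>g \<in> GL n. \<forall>\<rho> \<in> reps. f (conjugation n g \<rho>) = f \<rho>}"

text \<open>The direct sum of the \<open>n\<close> characters whose coordinates with respect to
  \<open>\<pi>\<close> are the vectors \<open>v i\<close>. It is a representation for every function
  \<open>v\<close>, so polynomial identities in \<open>v\<close> need no restriction of the
  domain.\<close>

definition diag_rep :: "(nat \<Rightarrow> complex vec) \<Rightarrow> 'a \<Rightarrow> complex mat" where
  "diag_rep v x = mat_diag n (\<lambda>i. \<Sum>k<l. \<pi> k x * v i $ k)"

lemma diag_rep_carrier: "diag_rep v x \<in> carrier_mat n n"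
  by (simp add: diag_rep_def)

lemma diag_rep_index:
  "i < n \<Longrightarrow> j < n \<Longrightarrow> diag_rep v x $$ (i, j) = (if i = j then \<Sum>k<l. \<pi> k x * v i $ k else 0)"
  by (auto simp: diag_rep_def mat_diag_def)

lemma diag_rep_in_reps: "diag_rep v \<in> reps"
  unfolding lie_homs_def
proof (intro CollectI conjI allI)
  fix x y c
  show "diag_rep v x \<in> carrier_mat n n" by (rule diag_rep_carrier)
  show "diag_rep v (x + y) = diag_rep v x + diag_rep v y"
    by (intro eq_matI)
      (auto simp: diag_rep_def mat_diag_def pi_add distrib_right sum.distrib)
  show "diag_rep v (c *s x) = c \<cdot>\<^sub>m diag_rep v x"
    by (intro eq_matI)
      (auto simp: diag_rep_def mat_diag_def pi_scale sum_distrib_left mult.assoc)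
  have "diag_rep v (bracket x y) = 0\<^sub>m n n"
    by (intro eq_matI)
      (auto simp: diag_rep_def mat_diag_def pi_derived[OF bracket_in_derived])
  moreover have "diag_rep v x * diag_rep v y - diag_rep v y * diag_rep v x = 0\<^sub>m n n"
    unfolding diag_rep_def mat_diag_diag
    by (intro eq_matI) (auto simp: mat_diag_def mult.commute)
  ultimately show "diag_rep v (bracket x y)
      = diag_rep v x * diag_rep v y - diag_rep v y * diag_rep v x" by simp
qed

text \<open>A functional that kills brackets kills \<open>derived\<close>, so its values on the
  representatives \<open>b\<close> determine it. This is what identifies characters with
  \<open>C^l\<close>.\<close>

lemma functional_expansion:
  fixes \<kappa> :: "'a \<Rightarrow> complex"
  assumes add: "\<And>x y. \<kappa> (x + y) = \<kappa> x + \<kappa> y" and scale: "\<And>c x. \<kappa> (c *s x) = c * \<kappa> x"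
    and br: "\<And>x y. \<kappa> (bracket x y) = 0"
  shows "\<kappa> x = (\<Sum>k<l. \<pi> k x * \<kappa> (b k))"
proof -
  have zero: "\<kappa> 0 = 0" using scale[of 0 0] by simp
  have sub: "subspace {x. \<kappa> x = 0}"
    by (rule subspaceI) (simp_all add: zero add scale)
  have der: "\<kappa> x = 0" if "x \<in> derived" for x
  proof -
    have "derived \<subseteq> {x. \<kappa> x = 0}"
      unfolding derived_def by (rule span_minimal[OF _ sub]) (auto simp: br)
    then show ?thesis using that by blast
  qed
  have sum: "\<kappa> (\<Sum>i\<in>I. c i *s b i) = (\<Sum>i\<in>I. c i * \<kappa> (b i))" for c and I :: "nat set"
    by (induction I rule: infinite_finite_induct) (simp_all add: zero add scale)
  have "\<kappa> x = \<kappa> ((x - (\<Sum>i<l. \<pi> i x *s b i)) + (\<Sum>i<l. \<pi> i x *s b i))" by simp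
  also have "\<dots> = (\<Sum>k<l. \<pi> k x * \<kappa> (b k))"
    by (simp only: add der[OF pi_span] sum)  simp
  finally show ?thesis .
qed

text \<open>Commutators of triangular matrices therefore have zero diagonal, which makes the
  diagonal entries of a triangular representation characters.\<close>

lemma upper_triangular_mult_diag:
  fixes A B :: "complex mat"
  assumes "A \<in> carrier_mat n n" "B \<in> carrier_mat n n" "upper_triangular A" "upper_triangular B" "i < n"
  shows "(A * B) $$ (i, i) = A $$ (i, i) * B $$ (i, i)"
proof -
  have "(A * B) $$ (i, i) = (\<Sum>k<n. A $$ (i, k) * B $$ (k, i))"
    using assms by (simp add: scalar_prod_def atLeast0LessThan)
  also have "\<dots> = (\<Sum>k<n. if k = i then A $$ (i, i) * B $$ (i, i) else 0)"
  proof (intro sum.cong refl)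
    fix k assume "k \<in> {..<n}"
    then show "A $$ (i, k) * B $$ (k, i) = (if k = i then A $$ (i, i) * B $$ (i, i) else 0)"
      using assms upper_triangularD[of A k i] upper_triangularD[of B i k]
      by (cases k i rule: linorder_cases) auto
  qed
  finally show ?thesis using assms(5) by simp
qed

text \<open>The diagonal part of a triangular representation is the limit, as \<open>t \<rightarrow> 0\<close>, of its
  conjugates by \<open>diag(1, 1/t, 1/t^2, \<dots>)\<close>, along which an invariant polynomial is constant.\<close>

lemma invs_triangular:
  assumes \<rho>: "\<rho> \<in> reps" and ut: "\<And>x. upper_triangular (\<rho> x)"
  shows "\<exists>v \<in> {..<n} \<rightarrow>\<^sub>E carrier_vec l. \<forall>f\<in>invs. f \<rho> = f (diag_rep v)"
proof -
  note \<rho>c = lie_homsD(1)[OF \<rho>]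
  define v where "v = (\<lambda>i\<in>{..<n}. vec l (\<lambda>k. \<rho> (b k) $$ (i, i)))"
  \<comment> \<open>Conjugation multiplies the entry \<open>(i, j)\<close> by the power of
    \<open>t\<close> with exponent \<open>j - i\<close>. Triangularity leaves only non-negative
    exponents, so \<open>t = 0\<close> makes sense, and \<open>0 ^ 0 = 1\<close> keeps the
    diagonal.\<close>
  define \<rho>t where "\<rho>t t x = mat n n (\<lambda>(i, j). if i \<le> j then t ^ (j - i) * \<rho> x $$ (i, j) else 0)"
    for t x
  have \<rho>t1: "\<rho>t 1 = \<rho>"
  proof
    fix x
    show "\<rho>t 1 x = \<rho> x"
      using \<rho>c[of x] upper_triangularD[OF ut] by (intro eq_matI) (auto simp: \<rho>t_def)
  qed
  have diag: "\<rho> x $$ (i, i) = (\<Sum>k<l. \<pi> k x * \<rho> (b k) $$ (i, i))" if i: "i < n" for i x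
  proof (rule functional_expansion[of "\<lambda>x. \<rho> x $$ (i, i)"])
    show "\<rho> (x + y) $$ (i, i) = \<rho> x $$ (i, i) + \<rho> y $$ (i, i)" for x y
      using i \<rho>c[of x] \<rho>c[of y] by (simp add: lie_homsD(2)[OF \<rho>])
    show "\<rho> (c *s x) $$ (i, i) = c * \<rho> x $$ (i, i)" for c x
      using i \<rho>c[of x] by (simp add: lie_homsD(3)[OF \<rho>])
    show "\<rho> (bracket x y) $$ (i, i) = 0" for x y
      using i \<rho>c[of x] \<rho>c[of y] upper_triangular_mult_diag[OF \<rho>c \<rho>c ut ut i, of x y]
        upper_triangular_mult_diag[OF \<rho>c \<rho>c ut ut i, of y x]
      by (simp add: lie_homsD(4)[OF \<rho>] del: index_mult_mat(1))
  qed
  have \<rho>t0: "\<rho>t 0 = diag_rep v"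
  proof
    fix x
    show "\<rho>t 0 x = diag_rep v x"
    proof (rule eq_matI)
      fix i j assume "i < dim_row (diag_rep v x)" "j < dim_col (diag_rep v x)"
      then have ij: "i < n" "j < n" using diag_rep_carrier[of v x] by auto
      show "\<rho>t 0 x $$ (i, j) = diag_rep v x $$ (i, j)"
      proof (cases "i = j")
        case True
        then show ?thesis using ij diag[of i x] by (simp add: \<rho>t_def diag_rep_index v_def)
      next
        case False
        then show ?thesis using ij by (auto simp: \<rho>t_def diag_rep_index power_0_left)
      qed
    qed (use diag_rep_carrier[of v x] in \<open>auto simp: \<rho>t_def\<close>)
  qed
  have conj: "\<exists>g\<in>GL n. \<rho>t t = conjugation n g \<rho>" if t: "t \<noteq> 0" for t
  proof -
    define g where "g = mat_diag n (\<lambda>i. inverse (t ^ i))"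
    define h where "h = mat_diag n (\<lambda>i. t ^ i)"
    have gh: "g \<in> carrier_mat n n" "h \<in> carrier_mat n n" "g * h = 1\<^sub>m n"
      using t by (auto simp: g_def h_def)
    have eq: "\<rho>t t x = g * \<rho> x * h" for x
    proof -
      have "g * \<rho> x * h = mat n n (\<lambda>(i, j). inverse (t ^ i) * \<rho> x $$ (i, j) * t ^ j)"
        unfolding g_def h_def mat_diag_mult_left[OF \<rho>c]
        by (subst mat_diag_mult_right[of _ n n]) (auto intro!: eq_matI)
      also have "\<dots> = \<rho>t t x"
      proof (rule eq_matI)
        fix i j assume "i < dim_row (\<rho>t t x)" "j < dim_col (\<rho>t t x)"
        then have ij: "i < n" "j < n" by (auto simp: \<rho>t_def)
        show "mat n n (\<lambda>(i, j). inverse (t ^ i) * \<rho> x $$ (i, j) * t ^ j) $$ (i, j) = \<rho>t t x $$ (i, j)"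
        proof (cases "i \<le> j")
          case True
          then have "t ^ j = t ^ i * t ^ (j - i)" by (simp flip: power_add)
          then show ?thesis using ij True t by (simp add: \<rho>t_def field_simps)
        next
          case False
          then show ?thesis
            using ij \<rho>c[of x] upper_triangularD[OF ut, of j i] by (simp add: \<rho>t_def)
        qed
      qed (auto simp: \<rho>t_def)
      finally show ?thesis ..
    qed
    have "\<rho>t t = conjugation n g \<rho>"
      unfolding conjugation_eq[OF gh] using eq by (rule ext)
    then show ?thesis using GL_inv(1)[OF gh] by blast
  qed
  have "f \<rho> = f (diag_rep v)" if f: "f \<in> invs" for f
  proof -
    have "f \<in> poly_funs entries" using f by (simp add: invs_def)
    then have "\<exists>p. \<forall>t. f (\<rho>t t) = poly p t"
    proof (induction rule: poly_funs_induct)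
      case (const a)
      show ?case by (rule exI[of _ "[:a:]"]) simp
    next
      case (coord f)
      then obtain x i j where f: "f = (\<lambda>\<rho>. \<rho> x $$ (i, j))" and ij: "i < n" "j < n"
        unfolding entries_def by blast
      show ?case
        by (rule exI[of _ "if i \<le> j then monom (\<rho> x $$ (i, j)) (j - i) else 0"])
          (use ij in \<open>auto simp: f \<rho>t_def poly_monom\<close>)
    next
      case (add f g)
      then show ?case by (metis poly_add)
    next
      case (mult f g)
      then show ?case by (metis poly_mult)
    qed
    then obtain p where p: "\<And>t. f (\<rho>t t) = poly p t" by blast
    \<comment> \<open>For nonzero \<open>t\<close> the representation \<open>\<rho>t t\<close> is
      conjugate to \<open>\<rho>\<close>, so \<open>p\<close> takes the value
      \<open>f \<rho>\<close> infinitely often and therefore also at 0.\<close>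
    have "poly (p - [:f \<rho>:]) t = 0" if t: "t \<noteq> 0" for t
    proof -
      obtain g where "g \<in> GL n" "\<rho>t t = conjugation n g \<rho>" using conj[OF t] by blast
      then have "f (\<rho>t t) = f \<rho>" using f \<rho> by (simp add: invs_def)
      then show ?thesis by (simp add: p)
    qed
    then have "- {0} \<subseteq> {t. poly (p - [:f \<rho>:]) t = 0}" by auto
    moreover have "infinite (- {0 :: complex})"
      by (simp add: infinite_UNIV_char_0 Compl_eq_Diff_UNIV)
    ultimately have "p - [:f \<rho>:] = 0"
      using poly_roots_finite finite_subset by blast
    then have "poly p 0 = f \<rho>" by simp
    then show ?thesis using p[of 0] \<rho>t0 by simp
  qed
  moreover have "v \<in> {..<n} \<rightarrow>\<^sub>E carrier_vec l" by (auto simp: v_def)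
  ultimately show ?thesis by blast
qed

text \<open>The tuple \<open>v\<close> is chosen before \<open>f\<close>: one diagonal
  representation matches \<open>\<rho>\<close> for all invariants at once, as needed to compare two
  of them.\<close>

lemma invs_eq_diag_rep:
  assumes \<rho>: "\<rho> \<in> reps"
  shows "\<exists>v \<in> {..<n} \<rightarrow>\<^sub>E carrier_vec l. \<forall>f\<in>invs. f \<rho> = f (diag_rep v)"
proof -
  obtain P Q where PQ: "P \<in> carrier_mat n n" "Q \<in> carrier_mat n n" "P * Q = 1\<^sub>m n" "Q * P = 1\<^sub>m n"
    and ut: "\<And>x. upper_triangular (Q * \<rho> x * P)"
    using ex_triangularization[OF fd nil \<rho>] by blast
  have eq: "conjugation n Q \<rho> = (\<lambda>x. Q * \<rho> x * P)" by (rule conjugation_eq[OF PQ(2,1,4)])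
  have Q: "Q \<in> GL n" by (rule GL_inv(1)[OF PQ(2,1,4)])
  have "conjugation n Q \<rho> \<in> reps" by (rule conjugation_lie_homs[OF Q \<rho>])
  then obtain v where "v \<in> {..<n} \<rightarrow>\<^sub>E carrier_vec l" "\<forall>f\<in>invs. f (conjugation n Q \<rho>) = f (diag_rep v)"
    using invs_triangular[of "conjugation n Q \<rho>"] ut by (auto simp: eq)
  moreover have "f (conjugation n Q \<rho>) = f \<rho>" if "f \<in> invs" for f
    using that Q \<rho> by (simp add: invs_def)
  ultimately show ?thesis by metis
qed

lemma invs_diag_rep_permute:
  assumes f: "f \<in> invs" and \<sigma>: "\<sigma> permutes {..<n}"
  shows "f (diag_rep (v \<circ> \<sigma>)) = f (diag_rep v)"
proof -
  \<comment> \<open>\<open>g\<close> is the permutation matrix of \<open>\<sigma>\<close> and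
    \<open>h\<close> its transpose; multiplying by them on the two sides puts the entry
    \<open>(\<sigma> i, \<sigma> j)\<close> in place \<open>(i, j)\<close>.\<close>
  define g where "g = mat n n (\<lambda>(i, k). of_bool (k = \<sigma> i) :: complex)"
  define h where "h = mat n n (\<lambda>(k, j). of_bool (k = \<sigma> j) :: complex)"
  have \<sigma>n: "\<sigma> i < n" if "i < n" for i using permutes_in_image[OF \<sigma>, of i] that by simp
  have inj: "\<sigma> i = \<sigma> j \<longleftrightarrow> i = j" for i j using permutes_inj[OF \<sigma>] by (auto dest: injD)
  have gA: "g * A = mat n n (\<lambda>(i, j). A $$ (\<sigma> i, j))" if "A \<in> carrier_mat n n" for A
  proof (rule eq_matI)
    fix i j assume "i < dim_row (mat n n (\<lambda>(i, j). A $$ (\<sigma> i, j)))" "j < dim_col (mat n n (\<lambda>(i, j). A $$ (\<sigma> i, j)))"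
    then have ij: "i < n" "j < n" by auto
    then have "(g * A) $$ (i, j) = (\<Sum>k<n. of_bool (k = \<sigma> i) * A $$ (k, j))"
      using that by (simp add: g_def scalar_prod_def atLeast0LessThan)
    also have "\<dots> = (\<Sum>k<n. if k = \<sigma> i then A $$ (\<sigma> i, j) else 0)"
      by (intro sum.cong) auto
    finally show "(g * A) $$ (i, j) = mat n n (\<lambda>(i, j). A $$ (\<sigma> i, j)) $$ (i, j)"
      using ij \<sigma>n by simp
  qed (use that in \<open>auto simp: g_def\<close>)
  have Ah: "A * h = mat n n (\<lambda>(i, j). A $$ (i, \<sigma> j))" if "A \<in> carrier_mat n n" for A
  proof (rule eq_matI)
    fix i j assume "i < dim_row (mat n n (\<lambda>(i, j). A $$ (i, \<sigma> j)))" "j < dim_col (mat n n (\<lambda>(i, j). A $$ (i, \<sigma> j)))"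
    then have ij: "i < n" "j < n" by auto
    then have "(A * h) $$ (i, j) = (\<Sum>k<n. A $$ (i, k) * of_bool (k = \<sigma> j))"
      using that by (simp add: h_def scalar_prod_def atLeast0LessThan)
    also have "\<dots> = (\<Sum>k<n. if k = \<sigma> j then A $$ (i, \<sigma> j) else 0)"
      by (intro sum.cong) auto
    finally show "(A * h) $$ (i, j) = mat n n (\<lambda>(i, j). A $$ (i, \<sigma> j)) $$ (i, j)"
      using ij \<sigma>n by simp
  qed (use that in \<open>auto simp: h_def\<close>)
  have gc: "g \<in> carrier_mat n n" and hc: "h \<in> carrier_mat n n" by (auto simp: g_def h_def)
  have gh: "g * h = 1\<^sub>m n"
    unfolding gA[OF hc] by (intro eq_matI) (auto simp: h_def inj \<sigma>n)
  have eq: "diag_rep (v \<circ> \<sigma>) x = g * diag_rep v x * h" for x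
  proof -
    have "g * diag_rep v x * h = mat n n (\<lambda>(i, j). diag_rep v x $$ (\<sigma> i, \<sigma> j))"
      unfolding gA[OF diag_rep_carrier] by (subst Ah) (auto intro!: eq_matI simp: \<sigma>n)
    also have "\<dots> = diag_rep (v \<circ> \<sigma>) x"
      using diag_rep_carrier[of "v \<circ> \<sigma>" x]
      by (intro eq_matI) (auto simp: diag_rep_index \<sigma>n inj)
    finally show ?thesis ..
  qed
  have "diag_rep (v \<circ> \<sigma>) = conjugation n g (diag_rep v)"
    unfolding conjugation_eq[OF gc hc gh] using eq by (rule ext)
  then show ?thesis using f GL_inv(1)[OF gc hc gh] diag_rep_in_reps by (simp add: invs_def)
qed

section \<open>Traces of equivariant matrix polynomials\<close>

lemma sum_diag_similar:
  fixes A :: "complex mat"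
  assumes A: "A \<in> carrier_mat n n" and g: "g \<in> carrier_mat n n" and h: "h \<in> carrier_mat n n"
    and hg: "h * g = 1\<^sub>m n"
  shows "(\<Sum>i<n. (g * A * h) $$ (i, i)) = (\<Sum>i<n. A $$ (i, i))"
proof -
  have tr: "(\<Sum>i<n. (B * C) $$ (i, i)) = (\<Sum>i<n. (C * B) $$ (i, i))"
    if "B \<in> carrier_mat n n" "C \<in> carrier_mat n n" for B C :: "complex mat"
  proof -
    have "(\<Sum>i<n. (B * C) $$ (i, i)) = (\<Sum>i<n. \<Sum>k<n. B $$ (i, k) * C $$ (k, i))"
      using that by (intro sum.cong) (auto simp: scalar_prod_def atLeast0LessThan)
    also have "\<dots> = (\<Sum>k<n. \<Sum>i<n. C $$ (k, i) * B $$ (i, k))"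
      by (subst sum.swap) (simp add: mult.commute)
    also have "\<dots> = (\<Sum>i<n. (C * B) $$ (i, i))"
      using that by (intro sum.cong) (auto simp: scalar_prod_def atLeast0LessThan)
    finally show ?thesis .
  qed
  have "(\<Sum>i<n. (g * A * h) $$ (i, i)) = (\<Sum>i<n. (h * (g * A)) $$ (i, i))"
    by (rule tr) (use A g h in auto)
  also have "h * (g * A) = (h * g) * A"
    using A g h by (simp add: assoc_mult_mat[of _ n n _ n _ n])
  also have "\<dots> = A" using A by (simp add: hg)
  finally show ?thesis .
qed

definition vec_coords :: "(complex vec \<Rightarrow> complex) set" where
  "vec_coords = {\<lambda>u. u $ j | j. j < l}"

text \<open>The induction on \<open>g\<close> runs over matrix-valued covariants because a trace is
  not multiplicative, while a product of matrices multiplies the values on diagonal representations.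
  The trace is taken only at the end.\<close>

definition equivariant_matrix ::
    "(('a \<Rightarrow> complex mat) \<Rightarrow> complex mat) \<Rightarrow> (complex vec \<Rightarrow> complex) \<Rightarrow> bool" where
  "equivariant_matrix M g \<longleftrightarrow> (\<forall>\<rho>\<in>reps. M \<rho> \<in> carrier_mat n n) \<and>
    (\<forall>i<n. \<forall>j<n. \<exists>p\<in>poly_funs entries. \<forall>\<rho>\<in>reps. M \<rho> $$ (i, j) = p \<rho>) \<and>
    (\<forall>\<rho>\<in>reps. \<forall>k\<in>carrier_mat n n. \<forall>h\<in>carrier_mat n n. k * h = 1\<^sub>m n \<longrightarrow>
       M (\<lambda>x. k * \<rho> x * h) = k * M \<rho> * h) \<and>
    (\<forall>v. M (diag_rep v) = mat_diag n (\<lambda>i. g (v i)))"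

lemma equivariant_matrixD:
  assumes "equivariant_matrix M g"
  shows "\<rho> \<in> reps \<Longrightarrow> M \<rho> \<in> carrier_mat n n"
    "i < n \<Longrightarrow> j < n \<Longrightarrow> \<exists>p\<in>poly_funs entries. \<forall>\<rho>\<in>reps. M \<rho> $$ (i, j) = p \<rho>"
    "\<rho> \<in> reps \<Longrightarrow> k \<in> carrier_mat n n \<Longrightarrow> h \<in> carrier_mat n n \<Longrightarrow> k * h = 1\<^sub>m n \<Longrightarrow>
      M (\<lambda>x. k * \<rho> x * h) = k * M \<rho> * h"
    "M (diag_rep v) = mat_diag n (\<lambda>i. g (v i))"
  using assms unfolding equivariant_matrix_def by simp_all

text \<open>The power sum of \<open>g\<close> is the restriction to diagonal representations of the trace of a
  conjugation-equivariant matrix polynomial.\<close>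

lemma ex_equivariant_matrix:
  assumes "g \<in> poly_funs vec_coords"
  shows "\<exists>M. equivariant_matrix M g"
  using assms
proof (induction rule: poly_funs_induct)
  case (const a)
  show ?case
    unfolding equivariant_matrix_def
  proof (rule exI[of _ "\<lambda>\<rho>. a \<cdot>\<^sub>m 1\<^sub>m n"], intro conjI ballI allI impI)
    fix i j assume "i < n" "j < n"
    then show "\<exists>p\<in>poly_funs entries. \<forall>\<rho>\<in>reps. (a \<cdot>\<^sub>m 1\<^sub>m n) $$ (i, j) = p \<rho>"
      by (intro bexI[OF _ poly_funs_const[of "if i = j then a else 0"]]) auto
  next
    fix k h :: "complex mat"
    assume "k \<in> carrier_mat n n" "h \<in> carrier_mat n n" "k * h = 1\<^sub>m n"
    then show "a \<cdot>\<^sub>m 1\<^sub>m n = k * (a \<cdot>\<^sub>m 1\<^sub>m n) * h"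
      by (simp add: mult_smult_distrib[of _ n n _ n] mult_smult_assoc_mat[of _ n n _ n])
  next
    show "a \<cdot>\<^sub>m 1\<^sub>m n = mat_diag n (\<lambda>i. a)"
      by (intro eq_matI) (auto simp: mat_diag_def)
  qed auto
next
  case (coord f)
  then obtain k where k: "k < l" and f: "f = (\<lambda>u. u $ k)" unfolding vec_coords_def by blast
  show ?case
    unfolding equivariant_matrix_def
  \<comment> \<open>On \<open>diag_rep v\<close> the matrix of \<open>b k\<close> has diagonal
    entries \<open>v i $ k\<close>, because \<open>\<pi>\<close> is dual to
    \<open>b\<close>.\<close>
  proof (rule exI[of _ "\<lambda>\<rho>. \<rho> (b k)"], intro conjI ballI allI impI)
    fix i j assume "i < n" "j < n"
    then have "(\<lambda>\<rho>. \<rho> (b k) $$ (i, j)) \<in> poly_funs entries"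
      by (intro poly_funs_coord) (auto simp: entries_def)
    then show "\<exists>p\<in>poly_funs entries. \<forall>\<rho>\<in>reps. \<rho> (b k) $$ (i, j) = p \<rho>"
      by (rule bexI[rotated]) simp
  next
    fix v :: "nat \<Rightarrow> complex vec"
    have "(\<Sum>m<l. \<pi> m (b k) * v i $ m) = v i $ k" for i
    proof -
      have "(\<Sum>m<l. \<pi> m (b k) * v i $ m) = (\<Sum>m<l. if m = k then v i $ k else 0)"
        using k by (intro sum.cong) (auto simp: pi_dual)
      then show ?thesis using k by simp
    qed
    then show "diag_rep v (b k) = mat_diag n (\<lambda>i. f (v i))"
      by (simp add: diag_rep_def f)
  qed (auto simp: lie_homsD(1))
next
  case (add f1 f2)
  from add.IH(1) obtain M1 where M1: "equivariant_matrix M1 f1" by blast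
  note c1 = equivariant_matrixD(1)[OF M1] and p1 = equivariant_matrixD(2)[OF M1]
    and e1 = equivariant_matrixD(3)[OF M1] and d1 = equivariant_matrixD(4)[OF M1]
  from add.IH(2) obtain M2 where M2: "equivariant_matrix M2 f2" by blast
  note c2 = equivariant_matrixD(1)[OF M2] and p2 = equivariant_matrixD(2)[OF M2]
    and e2 = equivariant_matrixD(3)[OF M2] and d2 = equivariant_matrixD(4)[OF M2]
  show ?case
    unfolding equivariant_matrix_def
  proof (rule exI[of _ "\<lambda>\<rho>. M1 \<rho> + M2 \<rho>"], intro conjI ballI allI impI)
    show "M1 \<rho> + M2 \<rho> \<in> carrier_mat n n" if "\<rho> \<in> reps" for \<rho> using that c1 c2 by auto
  next
    fix i j assume ij: "i < n" "j < n"
    obtain p q where p: "p \<in> poly_funs entries" "\<forall>\<rho>\<in>reps. M1 \<rho> $$ (i, j) = p \<rho>"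
      and q: "q \<in> poly_funs entries" "\<forall>\<rho>\<in>reps. M2 \<rho> $$ (i, j) = q \<rho>"
      using p1[OF ij] p2[OF ij] by blast
    have "(M1 \<rho> + M2 \<rho>) $$ (i, j) = p \<rho> + q \<rho>" if "\<rho> \<in> reps" for \<rho>
      using ij c1[OF that] c2[OF that] p(2) q(2) that by simp
    then show "\<exists>p\<in>poly_funs entries. \<forall>\<rho>\<in>reps. (M1 \<rho> + M2 \<rho>) $$ (i, j) = p \<rho>"
      by (intro bexI[OF _ poly_funs_add[OF p(1) q(1)]]) simp
  next
    fix \<rho> and k h :: "complex mat"
    assume \<rho>: "\<rho> \<in> reps" and kh: "k \<in> carrier_mat n n" "h \<in> carrier_mat n n" "k * h = 1\<^sub>m n"
    show "M1 (\<lambda>x. k * \<rho> x * h) + M2 (\<lambda>x. k * \<rho> x * h) = k * (M1 \<rho> + M2 \<rho>) * h"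
      using kh c1[OF \<rho>] c2[OF \<rho>] unfolding e1[OF \<rho> kh] e2[OF \<rho> kh]
      by (simp add: mult_add_distrib_mat[of _ n n _ n] add_mult_distrib_mat[of _ n n _ _ n])
  next
    fix v :: "nat \<Rightarrow> complex vec"
    show "M1 (diag_rep v) + M2 (diag_rep v) = mat_diag n (\<lambda>i. f1 (v i) + f2 (v i))"
      unfolding d1 d2 by (intro eq_matI) (auto simp: mat_diag_def)
  qed
next
  case (mult f1 f2)
  from mult.IH(1) obtain M1 where M1: "equivariant_matrix M1 f1" by blast
  note c1 = equivariant_matrixD(1)[OF M1] and p1 = equivariant_matrixD(2)[OF M1]
    and e1 = equivariant_matrixD(3)[OF M1] and d1 = equivariant_matrixD(4)[OF M1]
  from mult.IH(2) obtain M2 where M2: "equivariant_matrix M2 f2" by blast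
  note c2 = equivariant_matrixD(1)[OF M2] and p2 = equivariant_matrixD(2)[OF M2]
    and e2 = equivariant_matrixD(3)[OF M2] and d2 = equivariant_matrixD(4)[OF M2]
  show ?case
    unfolding equivariant_matrix_def
  proof (rule exI[of _ "\<lambda>\<rho>. M1 \<rho> * M2 \<rho>"], intro conjI ballI allI impI)
    show "M1 \<rho> * M2 \<rho> \<in> carrier_mat n n" if "\<rho> \<in> reps" for \<rho>
      by (rule mult_carrier_mat[OF c1[OF that] c2[OF that]])
  next
    fix i j assume ij: "i < n" "j < n"
    have "\<forall>k. \<exists>p. k < n \<longrightarrow> p \<in> poly_funs entries \<and> (\<forall>\<rho>\<in>reps. M1 \<rho> $$ (i, k) = p \<rho>)"
      using p1[OF ij(1)] by blast
    then obtain p where p: "\<And>k. k < n \<Longrightarrow> p k \<in> poly_funs entries"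
      "\<And>k \<rho>. k < n \<Longrightarrow> \<rho> \<in> reps \<Longrightarrow> M1 \<rho> $$ (i, k) = p k \<rho>" by metis
    have "\<forall>k. \<exists>p. k < n \<longrightarrow> p \<in> poly_funs entries \<and> (\<forall>\<rho>\<in>reps. M2 \<rho> $$ (k, j) = p \<rho>)"
      using p2[OF _ ij(2)] by blast
    then obtain q where q: "\<And>k. k < n \<Longrightarrow> q k \<in> poly_funs entries"
      "\<And>k \<rho>. k < n \<Longrightarrow> \<rho> \<in> reps \<Longrightarrow> M2 \<rho> $$ (k, j) = q k \<rho>" by metis
    have "(M1 \<rho> * M2 \<rho>) $$ (i, j) = (\<Sum>k<n. p k \<rho> * q k \<rho>)" if "\<rho> \<in> reps" for \<rho>
      using ij c1[OF that] c2[OF that] p(2) q(2) that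
      by (simp add: scalar_prod_def atLeast0LessThan)
    moreover have "(\<lambda>\<rho>. \<Sum>k<n. p k \<rho> * q k \<rho>) \<in> poly_funs entries"
      using p(1) q(1) by (intro poly_funs_sum poly_funs_mult) auto
    ultimately show "\<exists>p\<in>poly_funs entries. \<forall>\<rho>\<in>reps. (M1 \<rho> * M2 \<rho>) $$ (i, j) = p \<rho>"
      by (intro bexI[of _ "\<lambda>\<rho>. \<Sum>k<n. p k \<rho> * q k \<rho>"]) auto
  next
    fix \<rho> and k h :: "complex mat"
    assume \<rho>: "\<rho> \<in> reps" and kh: "k \<in> carrier_mat n n" "h \<in> carrier_mat n n" "k * h = 1\<^sub>m n"
    have hk: "h * k = 1\<^sub>m n" using mat_mult_left_right_inverse[OF kh] .
    have "k * M1 \<rho> * h * (k * M2 \<rho> * h) = k * M1 \<rho> * (h * k) * (M2 \<rho> * h)"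
      using kh(1,2) c1[OF \<rho>] c2[OF \<rho>] by (simp add: assoc_mult_mat[of _ n n _ n _ n])
    also have "\<dots> = k * (M1 \<rho> * M2 \<rho>) * h"
      using kh(1,2) c1[OF \<rho>] c2[OF \<rho>] by (simp add: hk assoc_mult_mat[of _ n n _ n _ n])
    finally show "M1 (\<lambda>x. k * \<rho> x * h) * M2 (\<lambda>x. k * \<rho> x * h) = k * (M1 \<rho> * M2 \<rho>) * h"
      unfolding e1[OF \<rho> kh] e2[OF \<rho> kh] .
  next
    fix v :: "nat \<Rightarrow> complex vec"
    show "M1 (diag_rep v) * M2 (diag_rep v) = mat_diag n (\<lambda>i. f1 (v i) * f2 (v i))"
      unfolding d1 d2 by simp
  qed
qed

definition restricted_invs :: "((nat \<Rightarrow> complex vec) \<Rightarrow> complex) set" where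
  "restricted_invs = {h. \<exists>a\<in>invs. \<forall>v. h v = a (diag_rep v)}"

lemma invs_const: "(\<lambda>\<rho>. c) \<in> invs"
  by (simp add: invs_def poly_funs_const)

lemma invs_add: "f \<in> invs \<Longrightarrow> g \<in> invs \<Longrightarrow> (\<lambda>\<rho>. f \<rho> + g \<rho>) \<in> invs"
  by (simp add: invs_def poly_funs_add)

lemma invs_mult: "f \<in> invs \<Longrightarrow> g \<in> invs \<Longrightarrow> (\<lambda>\<rho>. f \<rho> * g \<rho>) \<in> invs"
  by (simp add: invs_def poly_funs_mult)

lemma power_sum_restricted:
  assumes "g \<in> poly_funs vec_coords"
  shows "(\<lambda>v. \<Sum>i<n. g (v i)) \<in> restricted_invs"
proof -
  obtain M where M: "equivariant_matrix M g" using ex_equivariant_matrix[OF assms] by blast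
  note c = equivariant_matrixD(1)[OF M] and p = equivariant_matrixD(2)[OF M]
    and e = equivariant_matrixD(3)[OF M] and d = equivariant_matrixD(4)[OF M]
  have "\<forall>i. \<exists>q. i < n \<longrightarrow> q \<in> poly_funs entries \<and> (\<forall>\<rho>\<in>reps. M \<rho> $$ (i, i) = q \<rho>)"
    using p by blast
  then obtain q where q: "\<And>i. i < n \<Longrightarrow> q i \<in> poly_funs entries"
    "\<And>i \<rho>. i < n \<Longrightarrow> \<rho> \<in> reps \<Longrightarrow> M \<rho> $$ (i, i) = q i \<rho>" by metis
  define a where "a \<rho> = (\<Sum>i<n. q i \<rho>)" for \<rho>
  have a: "a \<rho> = (\<Sum>i<n. M \<rho> $$ (i, i))" if "\<rho> \<in> reps" for \<rho>
    using q(2) that by (simp add: a_def)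
  have "a \<in> invs"
    unfolding invs_def
  proof (intro CollectI conjI ballI)
    show "a \<in> poly_funs entries"
      unfolding a_def[abs_def] using q(1) by (intro poly_funs_sum) auto
    fix k \<rho> assume k: "k \<in> GL n" and \<rho>: "\<rho> \<in> reps"
    obtain h where kh: "k \<in> carrier_mat n n" "h \<in> carrier_mat n n" "k * h = 1\<^sub>m n" "h * k = 1\<^sub>m n"
      using k GL_iff by blast
    have "a (conjugation n k \<rho>) = (\<Sum>i<n. (k * M \<rho> * h) $$ (i, i))"
      using a[OF conjugation_lie_homs[OF k \<rho>]] e[OF \<rho> kh(1-3)] conjugation_eq[OF kh(1-3), of \<rho>] by simp
    also have "\<dots> = a \<rho>" using sum_diag_similar[OF c[OF \<rho>] kh(1,2,4)] a[OF \<rho>] by simp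
    finally show "a (conjugation n k \<rho>) = a \<rho>" .
  qed
  moreover have "(\<Sum>i<n. g (v i)) = a (diag_rep v)" for v
    using a[OF diag_rep_in_reps, of v] by (simp add: d mat_diag_def)
  ultimately show ?thesis unfolding restricted_invs_def by blast
qed

text \<open>Through \<open>symmetrization_mem\<close> this lifts every symmetrized polynomial in the
  tuple coordinates to an invariant polynomial on representations.\<close>

sublocale restricted: power_sum_algebra n restricted_invs vec_coords
proof
  show "(\<lambda>v. a) \<in> restricted_invs" for a
    unfolding restricted_invs_def by (intro CollectI bexI[OF _ invs_const[of a]]) simp
  show "(\<lambda>v. f v + h v) \<in> restricted_invs" if "f \<in> restricted_invs" "h \<in> restricted_invs" for f h
  proof -
    obtain a b where "a \<in> invs" "\<forall>v. f v = a (diag_rep v)" "b \<in> invs" "\<forall>v. h v = b (diag_rep v)"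
      using \<open>f \<in> _\<close> \<open>h \<in> _\<close> unfolding restricted_invs_def by blast
    then show ?thesis unfolding restricted_invs_def
      by (intro CollectI bexI[OF _ invs_add[of a b]]) auto
  qed
  show "(\<lambda>v. f v * h v) \<in> restricted_invs" if "f \<in> restricted_invs" "h \<in> restricted_invs" for f h
  proof -
    obtain a b where "a \<in> invs" "\<forall>v. f v = a (diag_rep v)" "b \<in> invs" "\<forall>v. h v = b (diag_rep v)"
      using \<open>f \<in> _\<close> \<open>h \<in> _\<close> unfolding restricted_invs_def by blast
    then show ?thesis unfolding restricted_invs_def
      by (intro CollectI bexI[OF _ invs_mult[of a b]]) auto
  qed
qed (rule power_sum_restricted)

end

section \<open>Spectra of function algebras\<close>

locale function_algebra =
  fixes X :: "'x set" and A :: "('x \<Rightarrow> complex) set"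
  assumes A_ext: "f \<in> A \<Longrightarrow> f \<in> extensional X"
    and A_const: "(\<lambda>x\<in>X. c) \<in> A"
    and A_add: "f \<in> A \<Longrightarrow> g \<in> A \<Longrightarrow> (\<lambda>x\<in>X. f x + g x) \<in> A"
    and A_mult: "f \<in> A \<Longrightarrow> g \<in> A \<Longrightarrow> (\<lambda>x\<in>X. f x * g x) \<in> A"
begin

abbreviation R :: "('x \<Rightarrow> complex) ring" where
  "R \<equiv> function_ring X A"

lemma R_simps:
  "carrier R = A" "f \<otimes>\<^bsub>R\<^esub> g = (\<lambda>x\<in>X. f x * g x)" "f \<oplus>\<^bsub>R\<^esub> g = (\<lambda>x\<in>X. f x + g x)"
  "\<one>\<^bsub>R\<^esub> = (\<lambda>x\<in>X. 1)" "\<zero>\<^bsub>R\<^esub> = (\<lambda>x\<in>X. 0)"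
  by (simp_all add: function_ring_def)

lemma A_uminus: "f \<in> A \<Longrightarrow> (\<lambda>x\<in>X. - f x) \<in> A"
  using A_mult[OF A_const[of "-1"], of f] by (simp cong: restrict_cong)

lemma A_eqI: "f \<in> A \<Longrightarrow> g \<in> A \<Longrightarrow> (\<And>x. x \<in> X \<Longrightarrow> f x = g x) \<Longrightarrow> f = g"
  using A_ext extensionalityI by blast

lemma A_restrict [simp]: "f \<in> A \<Longrightarrow> restrict f X = f"
  using A_ext extensional_restrict by blast

lemma cring_R: "cring R"
proof (rule cringI)
  show "abelian_group R"
  proof (rule abelian_groupI)
    fix f assume f: "f \<in> carrier R"
    show "\<exists>g \<in> carrier R. g \<oplus>\<^bsub>R\<^esub> f = \<zero>\<^bsub>R\<^esub>"
      using A_uminus[of f] f by (intro bexI[of _ "\<lambda>x\<in>X. - f x"]) (auto simp: R_simps cong: restrict_cong)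
  qed (auto simp: R_simps A_add A_const add_ac cong: restrict_cong
      intro!: A_eqI intro: A_add A_const)
  show "comm_monoid R"
    by (rule comm_monoidI)
      (auto simp: R_simps A_mult A_const mult_ac cong: restrict_cong
        intro!: A_eqI intro: A_mult A_const)
qed (auto simp: R_simps distrib_right cong: restrict_cong)

lemma R_uminus:
  assumes "g \<in> A"
  shows "\<ominus>\<^bsub>R\<^esub> g = (\<lambda>x\<in>X. - g x)"
proof -
  interpret cring R by (rule cring_R)
  have "(\<lambda>x\<in>X. - g x) \<oplus>\<^bsub>R\<^esub> g = \<zero>\<^bsub>R\<^esub>" by (auto simp: R_simps cong: restrict_cong)
  then show ?thesis
    using A_uminus[OF assms] assms by (intro minus_equality) (simp_all add: R_simps)
qed

lemma R_minus: "g \<in> A \<Longrightarrow> f \<ominus>\<^bsub>R\<^esub> g = (\<lambda>x\<in>X. f x - g x)"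
  by (simp add: a_minus_def R_uminus R_simps cong: restrict_cong)

lemma idealD:
  assumes "ideal m R"
  shows "m \<subseteq> A" "(\<lambda>x\<in>X. 0) \<in> m" "f \<in> m \<Longrightarrow> g \<in> m \<Longrightarrow> (\<lambda>x\<in>X. f x + g x) \<in> m"
    "f \<in> A \<Longrightarrow> g \<in> m \<Longrightarrow> (\<lambda>x\<in>X. f x * g x) \<in> m"
    "c \<noteq> 0 \<Longrightarrow> (\<lambda>x\<in>X. c) \<in> m \<Longrightarrow> m = A"
proof -
  interpret ideal m R by (rule assms)
  show "m \<subseteq> A" using a_subset by (simp add: R_simps)
  show "(\<lambda>x\<in>X. 0) \<in> m" using additive_subgroup.zero_closed[OF is_additive_subgroup] by (simp add: R_simps)
  show "f \<in> m \<Longrightarrow> g \<in> m \<Longrightarrow> (\<lambda>x\<in>X. f x + g x) \<in> m"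
    using additive_subgroup.a_closed[OF is_additive_subgroup, of f g] by (simp add: R_simps)
  show mult: "f \<in> A \<Longrightarrow> g \<in> m \<Longrightarrow> (\<lambda>x\<in>X. f x * g x) \<in> m" for f g
    using I_l_closed[of g f] by (simp add: R_simps)
  show "m = A" if "c \<noteq> 0" "(\<lambda>x\<in>X. c) \<in> m"
  proof -
    have "(\<lambda>x\<in>X. (\<lambda>x\<in>X. 1 / c) x * (\<lambda>x\<in>X. c) x) \<in> m"
      by (rule mult[OF A_const that(2)])
    then have "\<one>\<^bsub>R\<^esub> \<in> m" using that(1) by (simp add: R_simps cong: restrict_cong)
    then show ?thesis using one_imp_carrier by (simp add: R_simps)
  qed
qed

definition point_ideal :: "'x \<Rightarrow> ('x \<Rightarrow> complex) set" where
  "point_ideal x = {f \<in> A. f x = 0}"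

context
  fixes x
  assumes x: "x \<in> X"
begin

lemma ideal_point_ideal: "ideal (point_ideal x) R"
proof (rule idealI)
  interpret cring R by (rule cring_R)
  show "ring R" by (rule ring_axioms)
  show "subgroup (point_ideal x) (add_monoid R)"
  proof
    fix f assume f: "f \<in> point_ideal x"
    then have "\<ominus>\<^bsub>R\<^esub> f = (\<lambda>x\<in>X. - f x)" by (intro R_uminus) (simp add: point_ideal_def)
    then show "inv\<^bsub>add_monoid R\<^esub> f \<in> point_ideal x"
      using f x A_uminus by (simp add: point_ideal_def a_inv_def)
  qed (use x in \<open>auto simp: point_ideal_def R_simps A_add A_const\<close>)
  show "g \<otimes>\<^bsub>R\<^esub> f \<in> point_ideal x" if "f \<in> point_ideal x" "g \<in> carrier R" for f g
    using that x by (auto simp: point_ideal_def R_simps A_mult)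
  show "f \<otimes>\<^bsub>R\<^esub> g \<in> point_ideal x" if "f \<in> point_ideal x" "g \<in> carrier R" for f g
    using that x by (auto simp: point_ideal_def R_simps A_mult)
qed

lemma one_notin_point_ideal: "(\<lambda>y\<in>X. 1) \<notin> point_ideal x"
  using x by (simp add: point_ideal_def)

text \<open>A larger ideal contains some \<open>f\<close> with \<open>f x\<close> nonzero, and also
  \<open>f x - f\<close>, which vanishes at \<open>x\<close>; their sum is a nonzero
  constant.\<close>

lemma maximalideal_point_ideal: "maximalideal (point_ideal x) R"
proof (rule maximalidealI[OF ideal_point_ideal])
  show "carrier R \<noteq> point_ideal x"
    using one_notin_point_ideal A_const[of 1] by (auto simp: R_simps)
  fix J assume J: "ideal J R" "point_ideal x \<subseteq> J" "J \<subseteq> carrier R"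
  show "J = point_ideal x \<or> J = carrier R"
  proof (cases "J = point_ideal x")
    case False
    then obtain f where f: "f \<in> J" "f \<in> A" "f x \<noteq> 0"
      using J(2,3) by (auto simp: point_ideal_def R_simps)
    have "(\<lambda>y\<in>X. (\<lambda>y\<in>X. - 1) y * f y) \<in> A" by (rule A_mult[OF A_const f(2)])
    then have "(\<lambda>y\<in>X. (\<lambda>y\<in>X. f x) y + (\<lambda>y\<in>X. (\<lambda>y\<in>X. - 1) y * f y) y) \<in> A"
      by (rule A_add[OF A_const])
    then have "(\<lambda>y\<in>X. (\<lambda>y\<in>X. f x) y + (\<lambda>y\<in>X. (\<lambda>y\<in>X. - 1) y * f y) y) \<in> J"
      using x J(2) by (auto simp: point_ideal_def)
    from idealD(3)[OF J(1) this f(1)] have "(\<lambda>y\<in>X. f x) \<in> J" by (simp cong: restrict_cong)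
    then show ?thesis using idealD(5)[OF J(1) f(3)] by (simp add: R_simps)
  qed simp
qed

lemma maximalideal_eq_point_ideal:
  assumes "maximalideal m R" "m \<subseteq> point_ideal x"
  shows "m = point_ideal x"
proof -
  interpret maximalideal m R by (rule assms(1))
  have "point_ideal x \<subseteq> carrier R" by (auto simp: point_ideal_def R_simps)
  then have "point_ideal x = m \<or> point_ideal x = carrier R"
    by (rule I_maximal[OF ideal_point_ideal assms(2)])
  then show ?thesis using one_notin_point_ideal A_const[of 1] by (auto simp: R_simps)
qed

text \<open>Equality of cosets means that \<open>a - c\<close> vanishes at \<open>x\<close>. So the
  functions that \<open>Spec\<close> attaches to elements of \<open>A\<close> are evaluations at
  those maximal ideals that come from points.\<close>

lemma residue_value:
  assumes a: "a \<in> A"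
  shows "(THE c. point_ideal x +>\<^bsub>R\<^esub> a = point_ideal x +>\<^bsub>R\<^esub> (\<lambda>y\<in>X. c)) = a x"
proof -
  interpret cring R by (rule cring_R)
  have "point_ideal x +>\<^bsub>R\<^esub> a = point_ideal x +>\<^bsub>R\<^esub> (\<lambda>y\<in>X. c) \<longleftrightarrow> a x = c" for c
  proof -
    have "a \<ominus>\<^bsub>R\<^esub> (\<lambda>y\<in>X. c) \<in> A" using a A_const minus_closed by (simp add: R_simps(1))
    then have "a \<ominus>\<^bsub>R\<^esub> (\<lambda>y\<in>X. c) \<in> point_ideal x \<longleftrightarrow> a x = c"
      using x by (simp add: R_minus[OF A_const] point_ideal_def)
    then show ?thesis
      using quotient_eq_iff_same_a_r_cos[OF ideal_point_ideal, of a "\<lambda>y\<in>X. c"] a A_const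
      by (simp add: R_simps(1))
  qed
  then show ?thesis by simp
qed

end

end

section \<open>The quotient and the symmetric product\<close>

lemma sum_permutations_const:
  "(\<Sum>\<sigma> | \<sigma> permutes {..<n}. c) = fact n * (c :: complex)"
  by (simp add: card_permutations[of _ n])

context nilpotent_lie_algebra_coordinates
begin

definition inv_ring :: "(('a \<Rightarrow> complex mat) \<Rightarrow> complex) set" where
  "inv_ring = (\<lambda>f. restrict f reps) ` invs"

abbreviation vec_tuples :: "(nat \<Rightarrow> complex vec) set" where
  "vec_tuples \<equiv> {..<n} \<rightarrow>\<^sub>E carrier_vec l"

definition tuple_coords :: "((nat \<Rightarrow> complex vec) \<Rightarrow> complex) set" where
  "tuple_coords = {\<lambda>v. v i $ j | i j. i < n \<and> j < l}"

lemma tuple_coords_eq: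
  "tuple_coords = {\<lambda>v. c (v i) | c i. c \<in> vec_coords \<and> i < n}"
proof (intro equalityI subsetI)
  fix f assume "f \<in> tuple_coords"
  then obtain i j where "f = (\<lambda>v. v i $ j)" "i < n" "j < l" unfolding tuple_coords_def by blast
  then show "f \<in> {\<lambda>v. c (v i) | c i. c \<in> vec_coords \<and> i < n}"
    by (intro CollectI exI[of _ "\<lambda>u. u $ j"] exI[of _ i]) (auto simp: vec_coords_def)
qed (auto simp: tuple_coords_def vec_coords_def)

lemma invariants_eq:
  "invariants (Hom_variety scale bracket n) (GL n) (conjugation n) = inv_ring"
proof (intro equalityI subsetI)
  fix f assume f: "f \<in> invariants (Hom_variety scale bracket n) (GL n) (conjugation n)"
  then have "f \<in> polynomial_functions reps entries"
    by (simp add: invariants_def Hom_variety_def entries_def)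
  then obtain p where p: "p \<in> poly_funs entries" "f = restrict p reps"
    by (rule polynomial_functionsE)
  have "p \<in> invs"
    unfolding invs_def
  proof (intro CollectI conjI ballI p(1))
    fix g \<rho> assume g: "g \<in> GL n" "\<rho> \<in> reps"
    then have "f (conjugation n g \<rho>) = f \<rho>"
      using f by (simp add: invariants_def Hom_variety_def)
    then show "p (conjugation n g \<rho>) = p \<rho>"
      using p(2) g conjugation_lie_homs[OF g] by simp
  qed
  then show "f \<in> inv_ring" unfolding inv_ring_def p(2) by blast
next
  fix f assume "f \<in> inv_ring"
  then obtain p where p: "p \<in> invs" "f = restrict p reps" unfolding inv_ring_def by blast
  then have "f \<in> polynomial_functions reps entries"
    by (simp add: invs_def polynomial_functionsI)
  moreover have "f (conjugation n g \<rho>) = f \<rho>" if "g \<in> GL n" "\<rho> \<in> reps" for g \<rho>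
    using p that conjugation_lie_homs[OF that] by (simp add: invs_def)
  ultimately show "f \<in> invariants (Hom_variety scale bracket n) (GL n) (conjugation n)"
    by (simp add: invariants_def Hom_variety_def entries_def)
qed

sublocale quotient: function_algebra reps inv_ring
proof unfold_locales
  fix f g assume "f \<in> inv_ring" "g \<in> inv_ring"
  then obtain p q where p: "p \<in> invs" "f = restrict p reps" and q: "q \<in> invs" "g = restrict q reps"
    unfolding inv_ring_def by blast
  have "(\<lambda>\<rho>\<in>reps. f \<rho> + g \<rho>) = restrict (\<lambda>\<rho>. p \<rho> + q \<rho>) reps"
    unfolding p(2) q(2) by (rule restrict_ext) simp
  then show "(\<lambda>\<rho>\<in>reps. f \<rho> + g \<rho>) \<in> inv_ring"
    unfolding inv_ring_def using invs_add[OF p(1) q(1)] by blast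
  have "(\<lambda>\<rho>\<in>reps. f \<rho> * g \<rho>) = restrict (\<lambda>\<rho>. p \<rho> * q \<rho>) reps"
    unfolding p(2) q(2) by (rule restrict_ext) simp
  then show "(\<lambda>\<rho>\<in>reps. f \<rho> * g \<rho>) \<in> inv_ring"
    unfolding inv_ring_def using invs_mult[OF p(1) q(1)] by blast
next
  show "f \<in> extensional reps" if "f \<in> inv_ring" for f using that unfolding inv_ring_def by auto
  show "(\<lambda>\<rho>\<in>reps. c) \<in> inv_ring" for c
    unfolding inv_ring_def by (rule imageI) (rule invs_const)
qed

lemma inv_ring_diag_rep_poly:
  assumes "f \<in> inv_ring"
  shows "(\<lambda>v. f (diag_rep v)) \<in> poly_funs tuple_coords"
proof -
  obtain p where p: "p \<in> invs" "f = restrict p reps" using assms unfolding inv_ring_def by blast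
  have "(\<lambda>v. p (diag_rep v)) \<in> poly_funs tuple_coords"
  proof (rule poly_funs_compose[where f = p and \<phi> = diag_rep and C = entries])
    show "p \<in> poly_funs entries" using p(1) by (simp add: invs_def)
    fix c assume "c \<in> entries"
    then obtain x i j where c: "c = (\<lambda>\<rho>. \<rho> x $$ (i, j))" "i < n" "j < n"
      unfolding entries_def by blast
    have "(\<lambda>v. \<Sum>k<l. \<pi> k x * v i $ k) \<in> poly_funs tuple_coords"
      using c(2) by (intro poly_funs_sum poly_funs_mult poly_funs_const poly_funs_coord)
        (auto simp: tuple_coords_def)
    then show "(\<lambda>v. c (diag_rep v)) \<in> poly_funs tuple_coords"
      using c poly_funs_const[of 0] by (cases "i = j") (simp_all add: diag_rep_index)
  qed
  then show ?thesis using p(2) diag_rep_in_reps by simp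
qed

lemma inv_ring_diag_rep_permute:
  assumes "f \<in> inv_ring" "\<sigma> permutes {..<n}"
  shows "f (diag_rep (v \<circ> \<sigma>)) = f (diag_rep v)"
  using assms invs_diag_rep_permute diag_rep_in_reps unfolding inv_ring_def by auto

text \<open>The injective half of the comparison with multisymmetric polynomials: by
  \<open>invs_eq_diag_rep\<close> each representation has the invariant values of a diagonal
  one.\<close>

lemma inv_ring_eqI:
  assumes "f \<in> inv_ring" "g \<in> inv_ring"
    and "\<And>v. v \<in> vec_tuples \<Longrightarrow> f (diag_rep v) = g (diag_rep v)"
  shows "f = g"
proof (rule quotient.A_eqI[OF assms(1,2)])
  fix \<rho> assume \<rho>: "\<rho> \<in> reps"
  obtain v where v: "v \<in> vec_tuples" "\<forall>f\<in>invs. f \<rho> = f (diag_rep v)"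
    using invs_eq_diag_rep[OF \<rho>] by blast
  have "h \<rho> = h (diag_rep v)" if "h \<in> inv_ring" for h
    using that v(2) \<rho> diag_rep_in_reps unfolding inv_ring_def by auto
  from this[OF assms(1)] this[OF assms(2)] show "f \<rho> = g \<rho>" using assms(3)[OF v(1)] by simp
qed

text \<open>The surjective half, up to the factor \<open>n!\<close> that symmetrizing a symmetric
  polynomial produces.\<close>

lemma symmetrization_inv_ring:
  assumes "p \<in> poly_funs tuple_coords"
  shows "\<exists>f\<in>inv_ring. \<forall>v. f (diag_rep v) = (\<Sum>\<sigma> | \<sigma> permutes {..<n}. p (v \<circ> \<sigma>))"
proof -
  have "(\<lambda>v. \<Sum>\<sigma> | \<sigma> permutes {..<n}. p (v \<circ> \<sigma>)) \<in> restricted_invs"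
    using restricted.symmetrization_mem assms unfolding tuple_coords_eq by blast
  then obtain a where a: "a \<in> invs"
    "\<And>v. (\<Sum>\<sigma> | \<sigma> permutes {..<n}. p (v \<circ> \<sigma>)) = a (diag_rep v)"
    unfolding restricted_invs_def by blast
  have "restrict a reps \<in> inv_ring" unfolding inv_ring_def by (rule imageI) (rule a(1))
  then show ?thesis by (rule bexI[rotated]) (simp add: a(2) diag_rep_in_reps)
qed

lemma permute_vec_tuples:
  assumes v: "v \<in> vec_tuples" and \<sigma>: "\<sigma> permutes {..<n}"
  shows "v \<circ> \<sigma> \<in> vec_tuples"
proof
  fix i assume "i \<in> {..<n}"
  then have "\<sigma> i \<in> {..<n}" using permutes_in_image[OF \<sigma>] by blast
  then show "(v \<circ> \<sigma>) i \<in> carrier_vec l" using v by auto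
next
  fix i assume "i \<notin> {..<n}"
  then show "(v \<circ> \<sigma>) i = undefined"
    using v permutes_not_in[OF \<sigma>] by (auto simp: PiE_def extensional_def)
qed

abbreviation point :: "(nat \<Rightarrow> complex vec) \<Rightarrow> (('a \<Rightarrow> complex mat) \<Rightarrow> complex) set" where
  "point v \<equiv> quotient.point_ideal (diag_rep v)"

text \<open>Every maximal ideal is the ideal of a diagonal representation: the functions \<open>h\<close> all of
  whose multiples have symmetrization in \<open>m\<close> form an ideal of the polynomial ring that contains
  (the pullbacks of) \<open>m\<close> and is proper, so it has a zero.\<close>

lemma maximalideal_point:
  assumes m: "maximalideal m quotient.R"
  shows "\<exists>v\<in>vec_tuples. m = point v"
proof -
  have mi: "ideal m quotient.R" using m by (rule maximalideal.axioms(1))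
  have m_proper: "m \<noteq> inv_ring"
    using maximalideal.I_notcarr[OF m] by (simp add: quotient.R_simps(1))
  note mD = quotient.idealD[OF mi]
  define sym where "sym h v = (\<Sum>\<sigma> | \<sigma> permutes {..<n}. h (v \<circ> \<sigma>))"
    for h :: "(nat \<Rightarrow> complex vec) \<Rightarrow> complex" and v :: "nat \<Rightarrow> complex vec"
  \<comment> \<open>Testing against all \<open>g\<close> builds closure under multiplication into
    \<open>I\<close>; the bare condition that the symmetrization of \<open>h\<close> comes from
    \<open>m\<close> need not define an ideal.\<close>
  define I where "I = {h \<in> poly_funs tuple_coords. \<forall>g\<in>poly_funs tuple_coords.
    \<exists>f\<in>m. \<forall>v. f (diag_rep v) = sym (\<lambda>v. h v * g v) v}"
  have I_D: "\<exists>f\<in>m. \<forall>v. f (diag_rep v) = sym (\<lambda>v. h v * g v) v"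
    if "h \<in> I" "g \<in> poly_funs tuple_coords" for h g
    using that unfolding I_def by blast
  have "proper_ideal (poly_funs tuple_coords) I"
    unfolding proper_ideal_def
  proof (intro conjI ballI)
    show "I \<subseteq> poly_funs tuple_coords" unfolding I_def by blast
    have "\<exists>f\<in>m. \<forall>v. f (diag_rep v) = sym (\<lambda>v. 0 * g v) v" for g
      using diag_rep_in_reps by (intro bexI[OF _ mD(2)]) (simp add: sym_def)
    then show "(\<lambda>v. 0) \<in> I" unfolding I_def using poly_funs_const by blast
    show "(\<lambda>v. 1) \<notin> I"
    proof
      \<comment> \<open>Symmetrizing 1 gives the constant \<open>n!\<close>, a unit of the invariant
        ring.\<close>
      assume "(\<lambda>v. 1) \<in> I"
      then have "\<forall>g\<in>poly_funs tuple_coords. \<exists>f\<in>m. \<forall>v. f (diag_rep v) = sym (\<lambda>v. 1 * g v) v"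
        unfolding I_def by blast
      then have "\<exists>f\<in>m. \<forall>v. f (diag_rep v) = sym (\<lambda>v. 1 * 1) v"
        by (rule bspec) (rule poly_funs_const)
      then obtain f where f: "f \<in> m" "\<And>v. f (diag_rep v) = fact n"
        by (auto simp: sym_def card_permutations[OF card_lessThan])
      have "f = (\<lambda>\<rho>\<in>reps. fact n)"
        using f mD(1) quotient.A_const diag_rep_in_reps by (intro inv_ring_eqI) auto
      then show False using mD(5)[of "fact n"] f(1) m_proper by simp
    qed
  next
    fix h1 h2 assume h: "h1 \<in> I" "h2 \<in> I"
    have "\<exists>f\<in>m. \<forall>v. f (diag_rep v) = sym (\<lambda>v. (h1 v + h2 v) * g v) v"
      if g: "g \<in> poly_funs tuple_coords" for g
    proof -
      obtain f1 where f1: "f1 \<in> m" "\<forall>v. f1 (diag_rep v) = sym (\<lambda>v. h1 v * g v) v"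
        using I_D[OF h(1) g] by blast
      obtain f2 where f2: "f2 \<in> m" "\<forall>v. f2 (diag_rep v) = sym (\<lambda>v. h2 v * g v) v"
        using I_D[OF h(2) g] by blast
      show ?thesis
        by (rule bexI[OF _ mD(3)[OF f1(1) f2(1)]])
          (simp add: f1(2) f2(2) diag_rep_in_reps sym_def distrib_right sum.distrib)
    qed
    then show "(\<lambda>v. h1 v + h2 v) \<in> I"
      using h poly_funs_add unfolding I_def by blast
  next
    fix p h assume p: "p \<in> poly_funs tuple_coords" and h: "h \<in> I"
    have "\<exists>f\<in>m. \<forall>v. f (diag_rep v) = sym (\<lambda>v. (p v * h v) * g v) v"
      if g: "g \<in> poly_funs tuple_coords" for g
    proof -
      have "\<exists>f\<in>m. \<forall>v. f (diag_rep v) = sym (\<lambda>v. h v * (p v * g v)) v"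
        by (rule I_D[OF h poly_funs_mult[OF p g]])
      then show ?thesis by (simp add: mult_ac)
    qed
    then show "(\<lambda>v. p v * h v) \<in> I"
      using h p poly_funs_mult unfolding I_def by blast
  qed
  moreover have "tuple_coords = (\<lambda>(i, j) v. v i $ j) ` ({..<n} \<times> {..<l})"
    unfolding tuple_coords_def by auto
  ultimately obtain a where a: "\<And>v. \<forall>k\<in>{..<n} \<times> {..<l}. (\<lambda>(i, j) v. v i $ j) k v = a k \<Longrightarrow>
      \<forall>h\<in>I. h v = 0"
    using weak_nullstellensatz[of "\<lambda>(i, j) (v :: nat \<Rightarrow> complex vec). v i $ j" "{..<n} \<times> {..<l}" I]
    by auto
  \<comment> \<open>Every array of values \<open>a\<close> comes from an actual tuple, so the
    conclusion of the Nullstellensatz is not vacuous.\<close>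
  define v where "v = (\<lambda>i\<in>{..<n}. vec l (\<lambda>j. a (i, j)))"
  have v: "v \<in> vec_tuples" by (auto simp: v_def)
  have zero: "h v = 0" if "h \<in> I" for h
    using a[of v] that by (auto simp: v_def)
  have "f (diag_rep v) = 0" if f: "f \<in> m" for f
  proof -
    have fA: "f \<in> inv_ring" using f mD(1) by blast
    have "(\<lambda>v. f (diag_rep v)) \<in> I"
      unfolding I_def
    proof (intro CollectI conjI ballI inv_ring_diag_rep_poly fA)
      fix g assume "g \<in> poly_funs tuple_coords"
      then obtain f' where f': "f' \<in> inv_ring" "\<And>v. f' (diag_rep v) = sym g v"
        using symmetrization_inv_ring unfolding sym_def by blast
      \<comment> \<open>Symmetrization is linear over symmetric functions, so \<open>f\<close> can
        be taken out; what remains is \<open>f\<close> times the invariant \<open>f'\<close>, which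
        lies in the ideal \<open>m\<close>.\<close>
      have "sym (\<lambda>v. f (diag_rep v) * g v) v = f (diag_rep v) * f' (diag_rep v)" for v
        unfolding f'(2) by (simp add: sym_def inv_ring_diag_rep_permute[OF fA] sum_distrib_left)
      then show "\<exists>f'\<in>m. \<forall>v. f' (diag_rep v) = sym (\<lambda>v. f (diag_rep v) * g v) v"
        using diag_rep_in_reps by (intro bexI[OF _ mD(4)[OF f'(1) f]]) (simp add: mult.commute)
    qed
    then show ?thesis using zero by blast
  qed
  then have "m \<subseteq> point v" using mD(1) unfolding quotient.point_ideal_def by blast
  then have "m = point v"
    using quotient.maximalideal_eq_point_ideal[OF diag_rep_in_reps m] by blast
  then show ?thesis using v by blast
qed

section \<open>Separation of orbits and the isomorphism\<close>

lemma ex_separating_poly: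
  assumes "finite F" "F \<subseteq> vec_tuples" "w \<in> vec_tuples" "w \<notin> F"
  shows "\<exists>p\<in>poly_funs tuple_coords. p w = 1 \<and> (\<forall>u\<in>F. p u = 0)"
  using assms
proof (induction F)
  case empty
  show ?case by (rule bexI[OF _ poly_funs_const[of 1]]) simp
next
  case (insert u F)
  then obtain p where p: "p \<in> poly_funs tuple_coords" "p w = 1" "\<forall>u\<in>F. p u = 0" by auto
  have u: "u \<in> vec_tuples" "w \<in> vec_tuples" using insert.prems by auto
  have "\<exists>i j. i < n \<and> j < l \<and> w i $ j \<noteq> u i $ j"
  proof (rule ccontr)
    assume *: "\<not> ?thesis"
    have "w = u"
    proof (rule PiE_ext[OF u(2,1)])
      fix i assume "i \<in> {..<n}"
      moreover from this have "w i \<in> carrier_vec l" "u i \<in> carrier_vec l" using u by auto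
      ultimately show "w i = u i" using * by (intro eq_vecI) auto
    qed
    then show False using insert.prems by blast
  qed
  then obtain i j where ij: "i < n" "j < l" "w i $ j \<noteq> u i $ j" by blast
  \<comment> \<open>The new factor is linear in a coordinate where \<open>w\<close> and
    \<open>u\<close> differ, normalized to be 1 at \<open>w\<close> and 0 at
    \<open>u\<close>.\<close>
  define q where "q v = p v * (1 / (w i $ j - u i $ j) * (v i $ j - u i $ j))" for v
  have "q \<in> poly_funs tuple_coords"
    unfolding q_def[abs_def] using ij
    by (intro poly_funs_mult poly_funs_diff poly_funs_const poly_funs_coord p(1))
      (auto simp: tuple_coords_def)
  moreover have "q w = 1" "\<forall>v\<in>insert u F. q v = 0" using p(2,3) ij by (auto simp: q_def)
  ultimately show ?case by blast
qed

abbreviation orbit :: "(nat \<Rightarrow> complex vec) \<Rightarrow> (nat \<Rightarrow> complex vec) set" where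
  "orbit \<equiv> orbit_of {p. p permutes {..<n}} (\<lambda>p v. v \<circ> p)"

lemma orbit_refl: "v \<in> orbit v"
  unfolding orbit_of_def using permutes_id[of "{..<n}"] by (intro image_eqI[of _ _ id]) auto

lemma orbit_permute:
  assumes "\<sigma> permutes {..<n}"
  shows "orbit (v \<circ> \<sigma>) = orbit v"
proof (intro equalityI subsetI)
  fix w assume "w \<in> orbit (v \<circ> \<sigma>)"
  then obtain p where "p permutes {..<n}" "w = v \<circ> (\<sigma> \<circ> p)" by (auto simp: orbit_of_def o_assoc)
  then show "w \<in> orbit v"
    using permutes_compose[OF _ assms] unfolding orbit_of_def by blast
next
  fix w assume "w \<in> orbit v"
  then obtain p where p: "p permutes {..<n}" "w = v \<circ> p" by (auto simp: orbit_of_def)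
  have "w = (v \<circ> \<sigma>) \<circ> (inv_into UNIV \<sigma> \<circ> p)"
    using permutes_inv_o(1)[OF assms] unfolding p(2) by (metis comp_assoc comp_id)
  then show "w \<in> orbit (v \<circ> \<sigma>)"
    using permutes_compose[OF p(1) permutes_inv[OF assms]] unfolding orbit_of_def by blast
qed

text \<open>For distinct orbits take \<open>p\<close> that is 1 at \<open>w\<close> and 0 at all
  other points of both orbits. Its symmetrization is 0 at \<open>v\<close>, while at
  \<open>w\<close> it is the order of the stabilizer of \<open>w\<close>, which is positive.\<close>

lemma point_eq_iff:
  assumes v: "v \<in> vec_tuples" and w: "w \<in> vec_tuples"
  shows "point v = point w \<longleftrightarrow> orbit v = orbit w"
proof
  assume "orbit v = orbit w"
  then have "w \<in> orbit v" using orbit_refl by blast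
  then obtain \<sigma> where "\<sigma> permutes {..<n}" "w = v \<circ> \<sigma>" by (auto simp: orbit_of_def)
  then show "point v = point w"
    unfolding quotient.point_ideal_def by (auto simp: inv_ring_diag_rep_permute)
next
  assume eq: "point v = point w"
  have "w \<in> orbit v"
  proof (rule ccontr)
    assume no: "w \<notin> orbit v"
    let ?S = "{\<sigma>. \<sigma> permutes {..<n}}"
    define F where "F = orbit v \<union> (orbit w - {w})"
    have fin: "finite ?S" by (rule finite_permutations) simp
    have "finite F" unfolding F_def orbit_of_def using fin by auto
    moreover have "F \<subseteq> vec_tuples"
      unfolding F_def orbit_of_def using permute_vec_tuples v w by auto
    moreover have "w \<notin> F" using no by (auto simp: F_def)
    ultimately obtain p where p: "p \<in> poly_funs tuple_coords" "p w = 1" "\<forall>u\<in>F. p u = 0"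
      using ex_separating_poly w by blast
    obtain f where f: "f \<in> inv_ring"
      "\<And>v. f (diag_rep v) = (\<Sum>\<sigma> | \<sigma> permutes {..<n}. p (v \<circ> \<sigma>))"
      using symmetrization_inv_ring[OF p(1)] by blast
    have "f (diag_rep v) = 0"
      unfolding f(2) using p(3) by (intro sum.neutral) (auto simp: F_def orbit_of_def)
    then have "f \<in> point w" using f(1) eq unfolding quotient.point_ideal_def by blast
    then have "f (diag_rep w) = 0" by (simp add: quotient.point_ideal_def)
    moreover have "f (diag_rep w) = of_nat (card {\<sigma> \<in> ?S. w \<circ> \<sigma> = w})"
    proof -
      have "(\<Sum>\<sigma>\<in>?S. p (w \<circ> \<sigma>)) = (\<Sum>\<sigma>\<in>?S. if w \<circ> \<sigma> = w then 1 else 0)"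
        using p(2,3) by (intro sum.cong refl) (auto simp: F_def orbit_of_def)
      also have "\<dots> = (\<Sum>\<sigma>\<in>{\<sigma> \<in> ?S. w \<circ> \<sigma> = w}. 1)"
        using fin by (intro sum.mono_neutral_cong_right) auto
      finally show ?thesis by (simp add: f(2))
    qed
    ultimately have "card {\<sigma> \<in> ?S. w \<circ> \<sigma> = w} = 0" by simp
    moreover have "id \<in> {\<sigma> \<in> ?S. w \<circ> \<sigma> = w}" using permutes_id[of "{..<n}"] by simp
    moreover have "finite {\<sigma> \<in> ?S. w \<circ> \<sigma> = w}" using fin by simp
    ultimately show False using card_0_eq[of "{\<sigma> \<in> ?S. w \<circ> \<sigma> = w}"] by blast
  qed
  then obtain \<sigma> where "\<sigma> permutes {..<n}" "w = v \<circ> \<sigma>" by (auto simp: orbit_of_def)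
  then show "orbit v = orbit w" using orbit_permute by simp
qed

lemma quotient_isomorphic_symmetric_product:
  "categorical_quotient (Hom_variety scale bracket n) (GL n) (conjugation n)
     \<cong>\<^sub>v symmetric_product n l"
proof -
  let ?Q = "categorical_quotient (Hom_variety scale bracket n) (GL n) (conjugation n)"
  let ?S = "symmetric_product n l"
  define val where
    "val a = (\<lambda>m\<in>points ?Q. THE c. m +>\<^bsub>quotient.R\<^esub> a = m +>\<^bsub>quotient.R\<^esub> (\<lambda>\<rho>\<in>reps. c))" for a
  have Q: "?Q = Spec quotient.R (\<lambda>c. \<lambda>\<rho>\<in>reps. c)"
    unfolding categorical_quotient_def invariants_eq by (simp add: Hom_variety_def)
  have Q_points: "points ?Q = point ` vec_tuples"
    unfolding Q Spec_def
    using maximalideal_point quotient.maximalideal_point_ideal[OF diag_rep_in_reps] by auto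
  have Q_ring: "coord_ring ?Q = val ` inv_ring"
    unfolding val_def by (simp add: Q Spec_def quotient.R_simps(1))
  have val: "val a (point v) = a (diag_rep v)" if "v \<in> vec_tuples" "a \<in> inv_ring" for a v
    using that quotient.residue_value[OF diag_rep_in_reps] by (simp add: val_def Q_points)
  have S_points: "points ?S = orbit ` vec_tuples"
    by (simp add: symmetric_product_def orbit_variety_def vec_power_variety_def)
  have S_ring: "f \<in> coord_ring ?S \<longleftrightarrow> f \<in> extensional (orbit ` vec_tuples) \<and>
      compose vec_tuples f orbit \<in> polynomial_functions vec_tuples tuple_coords" for f
    by (simp add: symmetric_product_def orbit_variety_def vec_power_variety_def tuple_coords_def)
  \<comment> \<open>Both maps choose representatives; by \<open>point_eq_iff\<close> the result does
    not depend on the choice.\<close>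
  define \<phi> where "\<phi> m = orbit (SOME v. v \<in> vec_tuples \<and> m = point v)" for m
  define \<psi> where "\<psi> X = point (SOME v. v \<in> vec_tuples \<and> X = orbit v)" for X
  have \<phi>: "\<phi> (point v) = orbit v" if v: "v \<in> vec_tuples" for v
  proof -
    define u where "u = (SOME u. u \<in> vec_tuples \<and> point v = point u)"
    have "u \<in> vec_tuples \<and> point v = point u"
      unfolding u_def by (rule someI[of _ v]) (use v in simp)
    then show ?thesis using point_eq_iff[OF v, of u] by (simp add: \<phi>_def u_def)
  qed
  have \<psi>: "\<psi> (orbit v) = point v" if v: "v \<in> vec_tuples" for v
  proof -
    define u where "u = (SOME u. u \<in> vec_tuples \<and> orbit v = orbit u)"
    have "u \<in> vec_tuples \<and> orbit v = orbit u"
      unfolding u_def by (rule someI[of _ v]) (use v in simp)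
    then show ?thesis using point_eq_iff[OF v, of u] by (simp add: \<psi>_def u_def)
  qed
  have "variety_morphism ?Q ?S \<phi>"
    unfolding variety_morphism_def
  proof (intro conjI ballI)
    show "\<phi> \<in> points ?Q \<rightarrow> points ?S" using \<phi> by (auto simp: Q_points S_points)
    fix f assume "f \<in> coord_ring ?S"
    then have "compose vec_tuples f orbit \<in> polynomial_functions vec_tuples tuple_coords"
      by (simp add: S_ring)
    then obtain p where
      p: "p \<in> poly_funs tuple_coords" "compose vec_tuples f orbit = restrict p vec_tuples"
      by (rule polynomial_functionsE)
    have pf: "p v = f (orbit v)" if "v \<in> vec_tuples" for v
      using fun_cong[OF p(2), of v] that by (simp add: compose_def)
    \<comment> \<open>On tuples \<open>p\<close> agrees with a function of the orbit, so its
      symmetrization there is \<open>n!\<close> times \<open>p\<close>; the factor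
      \<open>1 / fact n\<close> compensates.\<close>
    have "(\<lambda>v. 1 / fact n * p v) \<in> poly_funs tuple_coords"
      by (intro poly_funs_mult poly_funs_const p(1))
    then obtain a where a: "a \<in> inv_ring"
      "\<And>v. a (diag_rep v) = (\<Sum>\<sigma> | \<sigma> permutes {..<n}. 1 / fact n * p (v \<circ> \<sigma>))"
      using symmetrization_inv_ring by blast
    have av: "a (diag_rep v) = f (orbit v)" if v: "v \<in> vec_tuples" for v
    proof -
      have "a (diag_rep v) = (\<Sum>\<sigma> | \<sigma> permutes {..<n}. 1 / fact n * f (orbit v))"
        unfolding a(2)
      proof (intro sum.cong refl)
        fix \<sigma> assume "\<sigma> \<in> {\<sigma>. \<sigma> permutes {..<n}}"
        then have \<sigma>: "\<sigma> permutes {..<n}" by simp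
        show "1 / fact n * p (v \<circ> \<sigma>) = 1 / fact n * f (orbit v)"
          using pf[OF permute_vec_tuples[OF v \<sigma>]] orbit_permute[OF \<sigma>] by simp
      qed
      then show ?thesis by (simp only: sum_permutations_const) simp
    qed
    have "compose (points ?Q) f \<phi> = val a"
    proof (rule extensionalityI[of _ "points ?Q"])
      show "val a \<in> extensional (points ?Q)" by (simp add: val_def)
      fix m assume m: "m \<in> points ?Q"
      then obtain v where v: "v \<in> vec_tuples" "m = point v" unfolding Q_points by blast
      show "compose (points ?Q) f \<phi> m = val a m"
        using m v val[OF v(1) a(1)] \<phi>[OF v(1)] av[OF v(1)] by (simp add: compose_eq)
    qed simp
    then show "compose (points ?Q) f \<phi> \<in> coord_ring ?Q" using a(1) by (simp add: Q_ring)
  qed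
  moreover have "variety_morphism ?S ?Q \<psi>"
    unfolding variety_morphism_def
  proof (intro conjI ballI)
    show "\<psi> \<in> points ?S \<rightarrow> points ?Q" using \<psi> by (auto simp: Q_points S_points)
    fix f assume "f \<in> coord_ring ?Q"
    then obtain a where a: "a \<in> inv_ring" "f = val a" unfolding Q_ring by blast
    have "compose vec_tuples (compose (points ?S) f \<psi>) orbit = restrict (\<lambda>v. a (diag_rep v)) vec_tuples"
    proof (rule extensionalityI[of _ vec_tuples])
      fix v assume v: "v \<in> vec_tuples"
      then show "compose vec_tuples (compose (points ?S) f \<psi>) orbit v
          = restrict (\<lambda>v. a (diag_rep v)) vec_tuples v"
        using \<psi>[OF v] val[OF v a(1)] by (simp add: compose_eq S_points a(2))
    qed auto
    then have "compose vec_tuples (compose (points ?S) f \<psi>) orbit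
        \<in> polynomial_functions vec_tuples tuple_coords"
      using polynomial_functionsI[OF inv_ring_diag_rep_poly[OF a(1)]] by simp
    moreover have "compose (points ?S) f \<psi> \<in> extensional (orbit ` vec_tuples)"
      by (simp add: S_points)
    ultimately show "compose (points ?S) f \<psi> \<in> coord_ring ?S" unfolding S_ring by blast
  qed
  moreover have "\<forall>m\<in>points ?Q. \<psi> (\<phi> m) = m" using \<phi> \<psi> by (auto simp: Q_points)
  moreover have "\<forall>X\<in>points ?S. \<phi> (\<psi> X) = X" using \<phi> \<psi> by (auto simp: S_points)
  ultimately show ?thesis unfolding variety_isomorphic_def by blast
qed

end

theorem proposition0p2:
  fixes scale :: "complex \<Rightarrow> 'a::ab_group_add \<Rightarrow> 'a"
    and bracket :: "'a \<Rightarrow> 'a \<Rightarrow> 'a"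
    and n l :: nat
  assumes "lie_algebra scale bracket"
    and "lie_algebra.finite_dimensional scale"
    and "lie_algebra.nilpotent scale bracket"
    and "l = lie_algebra.abelianization_dim scale bracket"
    and "n \<ge> 1"
  shows "categorical_quotient (Hom_variety scale bracket n) (GL n) (conjugation n)
           \<cong>\<^sub>v symmetric_product n l"
proof -
  interpret lie_algebra scale bracket by (rule assms(1))
  obtain b :: "nat \<Rightarrow> 'a" and \<pi> :: "nat \<Rightarrow> 'a \<Rightarrow> complex" where
    "\<forall>j x y. \<pi> j (x + y) = \<pi> j x + \<pi> j y" "\<forall>j c x. \<pi> j (scale c x) = c * \<pi> j x"
    "\<forall>j. \<forall>x\<in>derived. \<pi> j x = 0" "\<forall>i<l. \<forall>j<l. \<pi> j (b i) = of_bool (i = j)"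
    "\<forall>x. x - (\<Sum>i<l. scale (\<pi> i x) (b i)) \<in> derived"
    using ex_abelianization_coordinates[OF assms(2)] unfolding assms(4) by auto
  then interpret nilpotent_lie_algebra_coordinates scale bracket n l b \<pi>
    using assms(2,3) by unfold_locales auto
  show ?thesis by (rule quotient_isomorphic_symmetric_product)
qed

end
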